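(* For every integer $n\ge 2$, the polynomial $Z_{T_n}(x)=Z_{K_{2,n}}(x)$, i.e. the common $Z$-polynomial of the graphic matroids of $T_n=K_{1,1,n}$ and of $K_{2,n}$, has $n+1$ distinct negative real zeros.
   Context: $K_{1,1,n}$ is the complete tripartite graph with parts of sizes $1,1,n$; equivalently, it is the complete bipartite graph $K_{2,n}$ together with an edge joining the two vertices of the part of size $2$. Both graphic matroids have rank $n+1$ for $n\ge 2$. The equality $Z_{T_n}(x)=Z_{K_{2,n}}(x)$ for $n\ge2$ is a known result of Ferroni, Nasr and Vecchi. Kazhdan--Lusztig polynomial of a matroid (Elias--Proudfoot--Wakefield): to every loopless matroid $M$ on a finite ground set there is a unique way to assign a polynomial $P_M(x)\in\mathbb Z[x]$ such that (1) if $\operatorname{rk}M=0$ then $P_M(x)=1$; (2) if $\operatorname{rk}M>0$ then $\deg P_M<\tfrac12\operatorname{rk}M$; (3) for every $M$, $x^{\operatorname{rk}M}P_M(x^{-1})=\sum_{F}\chi_{M|F}(x)\,P_{M/F}(x)$, where $F$ ranges over the flats of $M$, $M|F$ is the restriction of $M$ to $F$, $M/F$ is the contraction of $M$ by $F$, and $\chi_{N}(x)=\sum_{G}\mu_N(\emptyset,G)\,x^{\operatorname{rk}N-\operatorname{rk}G}$ (sum over flats $G$ of $N$, $\mu_N$ the Möbius function of the lattice of flats) is the characteristic polynomial. The $Z$-polynomial of $M$ (Proudfoot--Xu--Young) is $Z_M(x)=\sum_F x^{\operatorname{rk}F}P_{M/F}(x)$, with $F$ ranging over the flats of $M$. For a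 graph $G$, $Z_G$ denotes the $Z$-polynomial of its graphic matroid. *)

theory Defs
  imports Complex_Main "HOL-Computational_Algebra.Polynomial"
begin

section \<open>Matroids\<close>

record 'a matroid =
  ground :: "'a set"
  indep :: "'a set \<Rightarrow> bool"

definition is_matroid :: "'a matroid \<Rightarrow> bool" where
  "is_matroid M \<longleftrightarrow>
     finite (ground M) \<and>
     (\<forall>A. indep M A \<longrightarrow> A \<subseteq> ground M) \<and>
     indep M {} \<and>
     (\<forall>A B. indep M B \<and> A \<subseteq> B \<longrightarrow> indep M A) \<and>
     (\<forall>A B. indep M A \<and> indep M B \<and> card A < card B \<longrightarrow>
        (\<exists>x\<in>B - A. indep M (insert x A)))"

definition loopless :: "'a matroid \<Rightarrow> bool" where
  "loopless M \<longleftrightarrow> (\<forall>e\<in>ground M. indep M {e})"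

definition rk_of :: "'a matroid \<Rightarrow> 'a set \<Rightarrow> nat" where
  "rk_of M S = Max (card ` {A. A \<subseteq> S \<and> indep M A})"

abbreviation rk :: "'a matroid \<Rightarrow> nat" where
  "rk M \<equiv> rk_of M (ground M)"

definition flats :: "'a matroid \<Rightarrow> 'a set set" where
  "flats M = {F. F \<subseteq> ground M \<and> (\<forall>e\<in>ground M - F. rk_of M F < rk_of M (insert e F))}"

text \<open>Restriction to, and contraction by, a subset \<open>S\<close> of the ground set.  In the contraction,
  \<open>B\<close> is a basis of \<open>S\<close>.\<close>

definition restriction :: "'a matroid \<Rightarrow> 'a set \<Rightarrow> 'a matroid" where
  "restriction M S = \<lparr>ground = S, indep = (\<lambda>A. A \<subseteq> S \<and> indep M A)\<rparr>"

definition contraction :: "'a matroid \<Rightarrow> 'a set \<Rightarrow> 'a matroid" where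
  "contraction M S =
     \<lparr>ground = ground M - S,
      indep = (\<lambda>A. A \<subseteq> ground M - S \<and>
        (\<exists>B. B \<subseteq> S \<and> indep M B \<and> card B = rk_of M S \<and> indep M (A \<union> B)))\<rparr>"


section \<open>Characteristic, Kazhdan-Lusztig and Z-polynomials\<close>

text \<open>Moebius function of a family \<open>L\<close> of finite sets ordered by inclusion.  Infinite second
  arguments only occur for the sake of totality.\<close>

function mobius :: "'a set set \<Rightarrow> 'a set \<Rightarrow> 'a set \<Rightarrow> int" where
  "mobius L A B =
     (if A = B then 1
      else if finite B \<and> A \<subset> B then - (\<Sum>H\<in>{H\<in>L. A \<subseteq> H \<and> H \<subset> B}. mobius L A H)
      else 0)"
  by pat_completeness auto
termination
  by (relation "measure (\<lambda>(L, A, B). card B)") (auto intro: psubset_card_mono)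

declare mobius.simps [simp del]

definition char_poly :: "'a matroid \<Rightarrow> int poly" where
  "char_poly M = (\<Sum>G\<in>flats M. monom (mobius (flats M) {} G) (rk M - rk_of M G))"

text \<open>An assignment \<open>P\<close> on all loopless matroids with ground set in the type \<open>'a\<close> (a class closed
  under the minors that occur).  Since \<open>degree (P M) \<le> rk M\<close> by the first two conditions,
  the left-hand side of the last one is \<open>x ^ rk M * P M (1 / x)\<close>.\<close>

definition KL_assignment :: "('a matroid \<Rightarrow> int poly) \<Rightarrow> bool" where
  "KL_assignment P \<longleftrightarrow>
     (\<forall>M. is_matroid M \<and> loopless M \<longrightarrow>
        (rk M = 0 \<longrightarrow> P M = 1) \<and>
        (rk M > 0 \<longrightarrow> real (degree (P M)) < real (rk M) / 2) \<and>
        monom 1 (rk M - degree (P M)) * reflect_poly (P M) =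
          (\<Sum>F\<in>flats M. char_poly (restriction M F) * P (contraction M F)))"

text \<open>The value at \<open>M\<close> of the unique such assignment; meaningful for loopless matroids only.\<close>

definition KL_poly :: "'a matroid \<Rightarrow> int poly" where
  "KL_poly M = (THE p. \<exists>P. KL_assignment P \<and> P M = p)"

definition Z_poly :: "'a matroid \<Rightarrow> int poly" where
  "Z_poly M = (\<Sum>F\<in>flats M. monom 1 (rk_of M F) * KL_poly (contraction M F))"


section \<open>Graphs\<close>

text \<open>A simple graph is given by its edges, which are two-element sets of vertices; isolated
  vertices do not affect the graphic matroid.\<close>

definition has_cycle :: "'v set set \<Rightarrow> bool" where
  "has_cycle E \<longleftrightarrow>
     (\<exists>vs. 3 \<le> length vs \<and> distinct vs \<and>
        (\<forall>i<length vs. {vs ! i, vs ! (Suc i mod length vs)} \<in> E))"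

definition graphic_matroid :: "'v set set \<Rightarrow> 'v set matroid" where
  "graphic_matroid E = \<lparr>ground = E, indep = (\<lambda>A. A \<subseteq> E \<and> \<not> has_cycle A)\<rparr>"

text \<open>The part with index \<open>i\<close> has the \<open>ns ! i\<close> vertices \<open>(i, 0)\<close>, \<open>(i, 1)\<close>, and so on.\<close>

definition complete_multipartite :: "nat list \<Rightarrow> (nat \<times> nat) set set" where
  "complete_multipartite ns =
     {{(i, a), (j, b)} | i a j b.
        i < length ns \<and> a < ns ! i \<and> j < length ns \<and> b < ns ! j \<and> i \<noteq> j}"

definition K2n :: "nat \<Rightarrow> (nat \<times> nat) set set" where
  "K2n n = complete_multipartite [2, n]"

definition T :: "nat \<Rightarrow> (nat \<times> nat) set set" where
  "T n = complete_multipartite [1, 1, n]"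

end

theory Submission
  imports Defs "HOL-Analysis.Henstock_Kurzweil_Integration"
    "HOL-Computational_Algebra.Formal_Power_Series"
begin

text \<open>
  For loopless matroids, the Kazhdan-Lusztig polynomials are determined by
  \<open>deg P < rk / 2\<close> together with palindromicity of the Z-polynomials of all contractions.
  On the lattice of flats of \<open>T n\<close> this pins down \<open>P (T n) = t n\<close> with
  \<open>t n = (\<Sum>i + j = n - 1. t i * t j) + (x - 1) * (\<Sum>i + j = n - 2. t i * t j)\<close>, and the only change
  for \<open>K2n n\<close> is that \<open>P\<close> gains the summand \<open>x\<close>, which makes up for the missing flat consisting
  of the edge that joins the two hubs. So both Z-polynomials are
  \<open>Z n = x * (1 + x) ^ n + (\<Sum>j. (n choose j) * (2 * x) ^ j * t (n - j))\<close>.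

  With \<open>s = 1 + x\<close>, the series \<open>Y = (1 - s * v) * (\<Sum>n. Z n * v ^ (n + 1))\<close> satisfies
  \<open>(1 - 2 * Y)\<^sup>2 = (1 - 2 * s * v)\<^sup>2 - 4 * x * v\<^sup>2\<close>. In the variable \<open>w = x / s\<^sup>2\<close> its coefficients become
  polynomials \<open>V m\<close> with a three-term recurrence (Gegenbauer polynomials for the parameter -1/2, up to a
  substitution), whose negative roots interlace, and \<open>Z n = s ^ (n + 1) * g n\<close> with
  \<open>g n = 1 + (\<Sum>m = 2..n + 1. V m)\<close>. At a root of \<open>V (n + 1)\<close> summation by parts turns the sum into a
  positive multiple of \<open>V n\<close> minus a small constant, so \<open>g n\<close> alternates in sign there and has
  \<open>(n + 1) div 2\<close> negative roots. Each of them has two negative preimages \<open>x\<close> and \<open>1 / x\<close>; for even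
  \<open>n\<close> the root \<open>-1\<close> is added.\<close>

text \<open>With \<open>v = t / s\<close> the radicand of \<open>1 - 2 * Y\<close> becomes
  \<open>D t = 1 - 4 * t + 4 * \<rho> * t^2\<close> for \<open>\<rho> = 1 - w\<close>. For negative
  \<open>w\<close> this is positive on the whole real line, so its powers can serve as weights of
  moments. The Sturm argument controls \<open>V\<close> but not its partial sums. At a root of
  \<open>V (n + 1)\<close> the sum equals \<open>P - (S - 1) / 2\<close>, where \<open>P\<close> is
  a positive multiple of \<open>V n\<close> and \<open>S = sqrt (D 1) > 1\<close>. The constant is
  harmless where \<open>V n < 0\<close>. Where \<open>V n > 0\<close> it must be beaten uniformly in
  \<open>w\<close>. The lower bound for the multiplier decays like \<open>1 / n\<close>, so
  exponential growth of \<open>V n\<close> is needed; it comes from a quadratic form in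
  \<open>V n\<close> and \<open>V (n + 1)\<close> that grows at least by the factor
  \<open>4 * \<rho>\<close> per step. On the matroid side no characteristic polynomial is computed:
  values are guessed for all flats at once, and only the degree bound and the palindromicity of each
  upper sum are checked. The palindromicity of \<open>Z n\<close> itself is read off from the
  generating function.\<close>

section \<open>Palindromic polynomials\<close>

text \<open>The reversal \<open>x ^ r * p (1 / x)\<close> at a fixed length \<open>r\<close>. In
  contrast to \<open>reflect_poly\<close> it is additive, so it can be applied to a sum over flats
  term by term.\<close>

definition rev_poly :: "nat \<Rightarrow> 'a::comm_ring_1 poly \<Rightarrow> 'a poly" where
  "rev_poly r p = (\<Sum>i\<le>r. monom (coeff p (r - i)) i)"

lemma coeff_rev_poly: "coeff (rev_poly r p) i = (if i \<le> r then coeff p (r - i) else 0)"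
proof -
  have "coeff (rev_poly r p) i = (\<Sum>j\<le>r. if j = i then coeff p (r - j) else 0)"
    by (simp add: rev_poly_def coeff_sum coeff_monom)
  also have "\<dots> = (if i \<le> r then coeff p (r - i) else 0)"
    by (simp add: sum.delta)
  finally show ?thesis .
qed

lemma rev_poly_0 [simp]: "rev_poly r 0 = 0"
  by (rule poly_eqI) (simp add: coeff_rev_poly)

lemma rev_poly_add: "rev_poly r (p + q) = rev_poly r p + rev_poly r q"
  by (rule poly_eqI) (simp add: coeff_rev_poly)

lemma rev_poly_diff: "rev_poly r (p - q) = rev_poly r p - rev_poly r q"
  by (rule poly_eqI) (simp add: coeff_rev_poly)

lemma rev_poly_sum: "rev_poly r (\<Sum>i\<in>A. f i) = (\<Sum>i\<in>A. rev_poly r (f i))"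
  by (induction A rule: infinite_finite_induct) (simp_all add: rev_poly_add)

lemma rev_poly_monom_mult:
  assumes "degree p \<le> b"
  shows "rev_poly (a + b) (monom 1 a * p) = rev_poly b p"
  by (rule poly_eqI) (use assms in \<open>auto simp: coeff_rev_poly coeff_monom_mult coeff_eq_0\<close>)

lemma rev_poly_conv_reflect:
  assumes "degree p \<le> r"
  shows "rev_poly r p = monom 1 (r - degree p) * reflect_poly p"
proof (rule poly_eqI)
  fix i
  show "coeff (rev_poly r p) i = coeff (monom 1 (r - degree p) * reflect_poly p) i"
    using assms by (auto simp: coeff_rev_poly coeff_monom_mult coeff_reflect_poly coeff_eq_0)
qed

lemma poly_rev_poly:
  fixes x :: "'a::field"
  assumes "degree p \<le> r" "x \<noteq> 0"
  shows "poly (rev_poly r p) x = x ^ r * poly p (1 / x)"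
proof -
  have "x ^ r * poly p (1 / x) = x ^ (r - degree p) * (x ^ degree p * poly p (inverse x))"
    using assms(1) by (simp add: field_simps flip: power_add)
  also have "\<dots> = x ^ (r - degree p) * poly (reflect_poly p) x"
    using assms(2) by (simp add: poly_reflect_poly_nz)
  also have "\<dots> = poly (rev_poly r p) x"
    using assms(1) by (simp add: rev_poly_conv_reflect poly_monom)
  finally show ?thesis ..
qed

text \<open>A nonzero leading coefficient would be mirrored to the exponent
  \<open>r - degree p\<close>, which exceeds the degree.\<close>

lemma palindromic_low_degree:
  assumes "rev_poly r p = p" "2 * degree p < r"
  shows "p = 0"
proof (rule ccontr)
  assume "p \<noteq> 0"
  have "coeff p (r - degree p) = coeff (rev_poly r p) (degree p)"
    using assms(2) by (simp add: coeff_rev_poly)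
  also have "\<dots> \<noteq> 0"
    using assms(1) \<open>p \<noteq> 0\<close> by simp
  finally have "r - degree p \<le> degree p"
    by (rule le_degree)
  with assms(2) show False by simp
qed

text \<open>\<open>c\<close> stands for the part of a Z-polynomial that comes from the larger flats,
  \<open>p\<close> and \<open>q\<close> for two candidates for the Kazhdan-Lusztig
  polynomial.\<close>

lemma palindromic_completion_unique:
  assumes "rev_poly r (p + c) = p + c" "rev_poly r (q + c) = q + c"
    and "2 * degree p < r" "2 * degree q < r"
  shows "p = q"
proof -
  have "rev_poly r ((p + c) - (q + c)) = (p + c) - (q + c)"
    unfolding rev_poly_diff assms(1,2) ..
  then have "rev_poly r (p - q) = p - q" by simp
  moreover have "2 * degree (p - q) < r"
    using degree_diff_le_max[of p q] assms(3,4) by linarith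
  ultimately show ?thesis
    using palindromic_low_degree by fastforce
qed

text \<open>Existence counterpart of the uniqueness above: the lower half of \<open>q\<close> is
  corrected so as to mirror the upper half. The correction lives below the middle and thus meets the
  degree bound of a Kazhdan-Lusztig polynomial.\<close>

definition palindromic_completion :: "nat \<Rightarrow> 'a::comm_ring_1 poly \<Rightarrow> 'a poly" where
  "palindromic_completion r q = (\<Sum>i | 2 * i < r. monom (coeff q (r - i) - coeff q i) i)"

lemma coeff_palindromic_completion:
  "coeff (palindromic_completion r q) j = (if 2 * j < r then coeff q (r - j) - coeff q j else 0)"
proof -
  have fin: "finite {i. 2 * i < r}" by (rule finite_subset[of _ "{..r}"]) auto
  have "coeff (palindromic_completion r q) j =
      (\<Sum>i | 2 * i < r. if i = j then coeff q (r - i) - coeff q i else 0)"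
    by (simp add: palindromic_completion_def coeff_sum coeff_monom)
  also have "\<dots> = (if 2 * j < r then coeff q (r - j) - coeff q j else 0)"
    using fin by (subst sum.delta) auto
  finally show ?thesis .
qed

lemma degree_palindromic_completion:
  assumes "0 < r"
  shows "2 * degree (palindromic_completion r q) < r"
proof -
  have "degree (palindromic_completion r q) \<le> (r - 1) div 2"
    by (rule degree_le) (auto simp: coeff_palindromic_completion)
  with assms show ?thesis by linarith
qed

lemma palindromic_completion:
  assumes "degree q \<le> r"
  shows "rev_poly r (palindromic_completion r q + q) = palindromic_completion r q + q"
proof (rule poly_eqI)
  fix i
  consider "2 * i < r" | "2 * i = r" | "r < 2 * i" "i \<le> r" | "r < i" by linarith
  then show "coeff (rev_poly r (palindromic_completion r q + q)) i =
      coeff (palindromic_completion r q + q) i"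
  proof cases
    case 1
    then have "\<not> 2 * (r - i) < r" "r - (r - i) = i" by linarith+
    with 1 show ?thesis by (simp add: coeff_rev_poly coeff_palindromic_completion)
  next
    case 2
    then have "r - i = i" by simp
    with 2 show ?thesis by (simp add: coeff_rev_poly)
  next
    case 3
    then have "2 * (r - i) < r" by linarith
    with 3 show ?thesis by (simp add: coeff_rev_poly coeff_palindromic_completion)
  next
    case 4
    with assms show ?thesis
      by (simp add: coeff_rev_poly coeff_palindromic_completion coeff_eq_0)
  qed
qed

section \<open>Matroids\<close>

locale finite_matroid =
  fixes M :: "'a matroid"
  assumes is_matroid: "is_matroid M"
begin

lemma finite_ground: "finite (ground M)"
  using is_matroid by (simp add: is_matroid_def)

lemma indep_subset_ground: "indep M A \<Longrightarrow> A \<subseteq> ground M"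
  using is_matroid by (simp add: is_matroid_def)

lemma indep_empty: "indep M {}"
  using is_matroid by (simp add: is_matroid_def)

lemma indep_subset: "indep M B \<Longrightarrow> A \<subseteq> B \<Longrightarrow> indep M A"
  using is_matroid unfolding is_matroid_def by blast

lemma augment:
  "indep M A \<Longrightarrow> indep M B \<Longrightarrow> card A < card B \<Longrightarrow> \<exists>x\<in>B - A. indep M (insert x A)"
  using is_matroid unfolding is_matroid_def by blast

lemma finite_indep: "indep M A \<Longrightarrow> finite A"
  using indep_subset_ground finite_ground by (blast intro: finite_subset)

lemma finite_indeps: "finite {A. A \<subseteq> S \<and> indep M A}"
  by (rule finite_subset[of _ "Pow (ground M)"]) (use indep_subset_ground finite_ground in auto)

lemma card_le_rk: "indep M A \<Longrightarrow> A \<subseteq> S \<Longrightarrow> card A \<le> rk_of M S"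
  unfolding rk_of_def by (rule Max_ge) (use finite_indeps in auto)

lemma rk_le: "(\<And>A. indep M A \<Longrightarrow> A \<subseteq> S \<Longrightarrow> card A \<le> k) \<Longrightarrow> rk_of M S \<le> k"
  unfolding rk_of_def
  by (rule Max.boundedI) (use finite_indeps indep_empty in auto)

lemma ex_basis: "\<exists>A\<subseteq>S. indep M A \<and> card A = rk_of M S"
proof -
  have "rk_of M S \<in> card ` {A. A \<subseteq> S \<and> indep M A}"
    unfolding rk_of_def by (rule Max_in) (use finite_indeps indep_empty in auto)
  then show ?thesis by auto
qed

lemma extend_to_basis:
  assumes "indep M A" "A \<subseteq> S"
  shows "\<exists>B. A \<subseteq> B \<and> B \<subseteq> S \<and> indep M B \<and> card B = rk_of M S"
  using assms
proof (induction "rk_of M S - card A" arbitrary: A)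
  case 0
  then show ?case using card_le_rk[of A S] by (intro exI[of _ A]) auto
next
  case (Suc k)
  obtain C where C: "C \<subseteq> S" "indep M C" "card C = rk_of M S"
    using ex_basis by blast
  have "card A < card C" using Suc.hyps(2) C(3) by linarith
  then obtain x where x: "x \<in> C - A" "indep M (insert x A)"
    using augment[OF Suc.prems(1) C(2)] by blast
  then have "card (insert x A) = Suc (card A)"
    using finite_indep[OF Suc.prems(1)] by auto
  then have "k = rk_of M S - card (insert x A)"
    using Suc.hyps(2) by simp
  moreover have "insert x A \<subseteq> S" using x C Suc.prems by auto
  ultimately obtain B where "insert x A \<subseteq> B" "B \<subseteq> S" "indep M B" "card B = rk_of M S"
    using Suc.hyps(1)[OF _ x(2)] by metis
  then show ?case by auto
qed

lemma rk_mono: "S \<subseteq> S' \<Longrightarrow> rk_of M S \<le> rk_of M S'"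
  by (rule rk_le) (meson card_le_rk order_trans)

lemma rk_empty [simp]: "rk_of M {} = 0"
  using rk_le[of "{}" 0] by auto

lemma rk_Un_le:
  assumes "finite A"
  shows "rk_of M (A \<union> S) \<le> card A + rk_of M S"
proof (rule rk_le)
  fix I assume I: "indep M I" "I \<subseteq> A \<union> S"
  have "I = (I \<inter> A) \<union> (I - A)" by blast
  then have "card I \<le> card (I \<inter> A) + card (I - A)"
    by (metis card_Un_le)
  also have "card (I \<inter> A) \<le> card A"
    using assms by (intro card_mono) auto
  also have "card (I - A) \<le> rk_of M S"
    using I indep_subset by (intro card_le_rk) blast+
  finally show "card I \<le> card A + rk_of M S" by simp
qed

text \<open>A larger intersection with \<open>S\<close> would be an independent subset of
  \<open>S\<close> exceeding its rank.\<close>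

lemma extend_basis:
  assumes "B \<subseteq> S" "indep M B" "card B = rk_of M S" "S \<subseteq> S'"
  obtains C where "B \<subseteq> C" "C \<subseteq> S'" "indep M C" "card C = rk_of M S'" "C \<inter> S = B"
proof -
  obtain C where C: "B \<subseteq> C" "C \<subseteq> S'" "indep M C" "card C = rk_of M S'"
    using extend_to_basis[of B S'] assms by blast
  have "indep M (C \<inter> S)" using C indep_subset by blast
  then have "card (C \<inter> S) \<le> card B" using assms card_le_rk by force
  then have "C \<inter> S = B"
    using card_seteq[of "C \<inter> S" B] \<open>indep M (C \<inter> S)\<close> finite_indep C(1) assms(1) by auto
  with C that show ?thesis by blast
qed

text \<open>Otherwise a basis of \<open>S'\<close> that extends a basis of \<open>S\<close> could be
  enlarged by \<open>e\<close>, and then \<open>e\<close> would enlarge the basis of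
  \<open>S\<close> as well.\<close>

lemma rk_insert_closure:
  assumes "S \<subseteq> S'" "rk_of M (insert e S) = rk_of M S"
  shows "rk_of M (insert e S') = rk_of M S'"
proof (rule ccontr)
  assume neq: "rk_of M (insert e S') \<noteq> rk_of M S'"
  then have less: "rk_of M S' < rk_of M (insert e S')"
    using rk_mono[of S' "insert e S'"] by (simp add: subset_insertI)
  obtain B where B: "B \<subseteq> S" "indep M B" "card B = rk_of M S"
    using ex_basis by blast
  obtain B' where B': "B \<subseteq> B'" "B' \<subseteq> S'" "indep M B'" "card B' = rk_of M S'"
    using extend_basis[OF B assms(1)] by metis
  obtain C where C: "C \<subseteq> insert e S'" "indep M C" "card C = rk_of M (insert e S')"
    using ex_basis by blast
  obtain x where x: "x \<in> C - B'" "indep M (insert x B')"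
    using augment[of B' C] B' C less by auto
  have "card (insert x B') = Suc (rk_of M S')"
    using x B' finite_indep by auto
  then have "x \<notin> S'"
    using card_le_rk[OF x(2), of S'] B'(2) by auto
  then have "x = e" using x C by auto
  have "indep M (insert e B)"
    using x(2) \<open>x = e\<close> B'(1) indep_subset by blast
  moreover have "card (insert e B) = Suc (rk_of M S)"
    using B finite_indep[OF B(2)] \<open>x \<notin> S'\<close> \<open>x = e\<close> assms(1) by (subst card_insert_disjoint) auto
  ultimately show False
    using card_le_rk[of "insert e B" "insert e S"] B(1) assms(2) by auto
qed

lemma flat_subset_ground: "F \<in> flats M \<Longrightarrow> F \<subseteq> ground M"
  by (simp add: flats_def)

lemma finite_flats: "finite (flats M)"
  by (rule finite_subset[of _ "Pow (ground M)"]) (use finite_ground flat_subset_ground in auto)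

lemma finite_flat: "F \<in> flats M \<Longrightarrow> finite F"
  using flat_subset_ground finite_ground finite_subset by blast

lemma rk_flat_less:
  assumes "F \<in> flats M" "F \<subset> S" "S \<subseteq> ground M"
  shows "rk_of M F < rk_of M S"
proof -
  obtain e where e: "e \<in> S - F" using assms(2) by blast
  then have "rk_of M F < rk_of M (insert e F)"
    using assms by (auto simp: flats_def)
  also have "\<dots> \<le> rk_of M S" using e assms(2) by (intro rk_mono) auto
  finally show ?thesis .
qed

lemma rk_restriction: "G \<subseteq> F \<Longrightarrow> rk_of (restriction M F) G = rk_of M G"
  unfolding rk_of_def restriction_def
  by (rule arg_cong[where f = Max], rule image_cong) auto

lemma flats_restriction:
  assumes "F \<in> flats M"
  shows "flats (restriction M F) = {G \<in> flats M. G \<subseteq> F}"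
proof (intro set_eqI iffI)
  fix G assume G: "G \<in> flats (restriction M F)"
  then have sub: "G \<subseteq> F" and less: "\<And>e. e \<in> F - G \<Longrightarrow> rk_of M G < rk_of M (insert e G)"
    by (auto simp: flats_def restriction_def rk_restriction[unfolded restriction_def])
  have "rk_of M G < rk_of M (insert e G)" if e: "e \<in> ground M - G" for e
  proof (cases "e \<in> F")
    case True
    with e less show ?thesis by blast
  next
    case False
    then have "rk_of M F < rk_of M (insert e F)"
      using assms e by (auto simp: flats_def)
    then have "rk_of M (insert e G) \<noteq> rk_of M G"
      using rk_insert_closure[OF sub] by auto
    with rk_mono[of G "insert e G"] show ?thesis by (simp add: subset_insertI)
  qed
  with sub assms show "G \<in> {G \<in> flats M. G \<subseteq> F}" by (auto simp: flats_def)
next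
  fix G assume "G \<in> {G \<in> flats M. G \<subseteq> F}"
  with assms show "G \<in> flats (restriction M F)"
    by (auto simp: flats_def restriction_def rk_restriction[unfolded restriction_def])
qed

section \<open>Contractions and their flats\<close>

lemma ground_contraction [simp]: "ground (contraction M S) = ground M - S"
  by (simp add: contraction_def)

text \<open>Replaces the choice of a basis of \<open>S\<close> by rank arithmetic, which makes
  iterated contractions tractable.\<close>

lemma indep_contraction_iff:
  assumes "S \<subseteq> ground M" "A \<subseteq> ground M - S"
  shows "indep (contraction M S) A \<longleftrightarrow> rk_of M (A \<union> S) = card A + rk_of M S"
proof
  assume "indep (contraction M S) A"
  then obtain B where B: "B \<subseteq> S" "indep M B" "card B = rk_of M S" "indep M (A \<union> B)"
    by (auto simp: contraction_def)
  have fin: "finite A" "finite B" using B(4) finite_indep by auto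
  have "card (A \<union> B) = card A + card B"
    using fin B(1) assms(2) by (intro card_Un_disjoint) auto
  then have "card A + rk_of M S \<le> rk_of M (A \<union> S)"
    using card_le_rk[OF B(4), of "A \<union> S"] B by auto
  with rk_Un_le[OF fin(1), of S] show "rk_of M (A \<union> S) = card A + rk_of M S" by simp
next
  assume eq: "rk_of M (A \<union> S) = card A + rk_of M S"
  obtain B where B: "B \<subseteq> S" "indep M B" "card B = rk_of M S"
    using ex_basis by blast
  obtain C where C: "B \<subseteq> C" "C \<subseteq> A \<union> S" "indep M C" "card C = rk_of M (A \<union> S)" "C \<inter> S = B"
    using extend_basis[OF B, of "A \<union> S"] by blast
  have fin: "finite A" using assms finite_ground finite_subset by blast
  have "C = (C \<inter> A) \<union> B" using C by blast
  then have "card C \<le> card (C \<inter> A) + card B" by (metis card_Un_le)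
  then have "card A \<le> card (C \<inter> A)" using C(4) eq B(3) by simp
  then have "C \<inter> A = A" using card_seteq[of A "C \<inter> A"] fin by auto
  then have "A \<union> B \<subseteq> C" using C(1) by blast
  with C(3) have "indep M (A \<union> B)" by (rule indep_subset)
  with B assms(2) show "indep (contraction M S) A"
    by (auto simp: contraction_def)
qed

lemma rk_contraction:
  assumes "S \<subseteq> ground M" "X \<subseteq> ground M - S"
  shows "rk_of (contraction M S) X = rk_of M (X \<union> S) - rk_of M S"
proof -
  let ?I = "{A. A \<subseteq> X \<and> indep (contraction M S) A}"
  have fin: "finite X" using assms finite_ground finite_subset by blast
  obtain B where B: "B \<subseteq> S" "indep M B" "card B = rk_of M S"
    using ex_basis by blast
  obtain C where C: "B \<subseteq> C" "C \<subseteq> X \<union> S" "indep M C" "card C = rk_of M (X \<union> S)" "C \<inter> S = B"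
    using extend_basis[OF B, of "X \<union> S"] by blast
  have sub: "C - B \<subseteq> X" using C by blast
  have "(C - B) \<union> B = C" using C by blast
  then have "indep (contraction M S) (C - B)"
    using B C sub assms(2) by (auto simp: contraction_def)
  moreover have "card (C - B) = rk_of M (X \<union> S) - rk_of M S"
    using C B finite_indep card_Diff_subset by metis
  ultimately have mem: "rk_of M (X \<union> S) - rk_of M S \<in> card ` ?I"
    using sub by (metis (mono_tags, lifting) image_eqI mem_Collect_eq)
  have "card A \<le> rk_of M (X \<union> S) - rk_of M S" if "A \<in> ?I" for A
  proof -
    have "rk_of M (A \<union> S) = card A + rk_of M S"
      using that assms indep_contraction_iff[of S A] by blast
    moreover have "rk_of M (A \<union> S) \<le> rk_of M (X \<union> S)"
      using that by (intro rk_mono) auto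
    ultimately show ?thesis by simp
  qed
  moreover have "finite ?I"
    by (rule finite_subset[of _ "Pow X"]) (use fin in auto)
  ultimately show ?thesis
    unfolding rk_of_def[of "contraction M S"] using mem by (intro Max_eqI) auto
qed

lemma matroid_contraction:
  assumes "S \<subseteq> ground M"
  shows "is_matroid (contraction M S)"
  unfolding is_matroid_def
proof (intro conjI allI impI)
  show "finite (ground (contraction M S))" using finite_ground by simp
  show "A \<subseteq> ground (contraction M S)" if "indep (contraction M S) A" for A
    using that by (auto simp: contraction_def)
  show "indep (contraction M S) {}"
    using ex_basis[of S] by (auto simp: contraction_def)
  show "indep (contraction M S) A" if "indep (contraction M S) B \<and> A \<subseteq> B" for A B
  proof -
    from that obtain C where C: "B \<subseteq> ground M - S" "C \<subseteq> S" "indep M C" "card C = rk_of M S"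
      "indep M (B \<union> C)" "A \<subseteq> B"
      by (auto simp: contraction_def)
    then have "indep M (A \<union> C)" using indep_subset[of "B \<union> C" "A \<union> C"] by blast
    with C show ?thesis by (auto simp: contraction_def)
  qed
  fix A1 A2
  assume *: "indep (contraction M S) A1 \<and> indep (contraction M S) A2 \<and> card A1 < card A2"
  obtain B1 where B1: "A1 \<subseteq> ground M - S" "B1 \<subseteq> S" "indep M B1" "card B1 = rk_of M S"
    "indep M (A1 \<union> B1)"
    using * by (auto simp: contraction_def)
  obtain B2 where B2: "A2 \<subseteq> ground M - S" "B2 \<subseteq> S" "indep M B2" "card B2 = rk_of M S"
    "indep M (A2 \<union> B2)"
    using * by (auto simp: contraction_def)
  have "card (A1 \<union> B1) = card A1 + card B1" "card (A2 \<union> B2) = card A2 + card B2"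
    using B1(1,2) B2(1,2) finite_indep[OF B1(5)] finite_indep[OF B2(5)]
    by (auto intro!: card_Un_disjoint)
  then obtain x where x: "x \<in> (A2 \<union> B2) - (A1 \<union> B1)" "indep M (insert x (A1 \<union> B1))"
    using augment[of "A1 \<union> B1" "A2 \<union> B2"] * B1 B2 by auto
  have "x \<notin> S"
  proof
    assume "x \<in> S"
    moreover have "indep M (insert x B1)" using x(2) indep_subset by blast
    ultimately have "card (insert x B1) \<le> rk_of M S" using B1 by (intro card_le_rk) auto
    with x B1 finite_indep[of B1] show False by auto
  qed
  then have "x \<in> A2 - A1" using x B2 by auto
  moreover from this have "indep (contraction M S) (insert x A1)"
    using B1 B2 x by (auto simp: contraction_def)
  ultimately show "\<exists>x\<in>A2 - A1. indep (contraction M S) (insert x A1)" by blast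
qed

lemma loopless_contraction:
  assumes "F \<in> flats M"
  shows "loopless (contraction M F)"
  unfolding loopless_def
proof
  fix e assume e: "e \<in> ground (contraction M F)"
  then have "rk_of M F < rk_of M (insert e F)"
    using assms by (auto simp: flats_def)
  moreover have "rk_of M ({e} \<union> F) \<le> card {e} + rk_of M F" by (rule rk_Un_le) simp
  ultimately have "rk_of M ({e} \<union> F) = card {e} + rk_of M F" by simp
  then show "indep (contraction M F) {e}"
    using indep_contraction_iff[of F "{e}"] e flat_subset_ground[OF assms] by auto
qed

lemma flats_contraction:
  assumes "S \<subseteq> ground M"
  shows "flats (contraction M S) = (\<lambda>G. G - S) ` {G \<in> flats M. S \<subseteq> G}"
proof -
  have *: "X \<in> flats (contraction M S) \<longleftrightarrow> X \<union> S \<in> flats M" if X: "X \<subseteq> ground M - S" for X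
  proof -
    have "rk_of (contraction M S) X < rk_of (contraction M S) (insert e X) \<longleftrightarrow>
        rk_of M (X \<union> S) < rk_of M (insert e (X \<union> S))" if e: "e \<in> ground M - S - X" for e
      using e X assms rk_mono[of S "X \<union> S"] rk_mono[of S "insert e (X \<union> S)"]
      by (simp add: rk_contraction subset_insertI2 less_diff_iff)
    with X assms show ?thesis
      by (auto simp: flats_def)
  qed
  show ?thesis
  proof (intro set_eqI iffI)
    fix X assume X: "X \<in> flats (contraction M S)"
    then have sub: "X \<subseteq> ground M - S" by (auto simp: flats_def)
    then have "X = (X \<union> S) - S" by blast
    with X *[OF sub] show "X \<in> (\<lambda>G. G - S) ` {G \<in> flats M. S \<subseteq> G}" by blast
  next
    fix X assume "X \<in> (\<lambda>G. G - S) ` {G \<in> flats M. S \<subseteq> G}"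
    then obtain G where G: "X = G - S" "G \<in> flats M" "S \<subseteq> G" by blast
    then have "X \<union> S = G" "X \<subseteq> ground M - S" using flat_subset_ground by auto
    with * G(2) show "X \<in> flats (contraction M S)" by simp
  qed
qed

lemma sum_flats_contraction:
  assumes "S \<subseteq> ground M"
  shows "(\<Sum>X\<in>flats (contraction M S). f X) = (\<Sum>G\<in>{G \<in> flats M. S \<subseteq> G}. f (G - S))"
  unfolding flats_contraction[OF assms]
  by (subst sum.reindex) (auto simp: inj_on_def)

lemma rk_contraction_flat:
  assumes "F \<subseteq> G" "G \<subseteq> ground M"
  shows "rk_of (contraction M F) (G - F) = rk_of M G - rk_of M F"
proof -
  have "(G - F) \<union> F = G" using assms by blast
  then show ?thesis using rk_contraction[of F "G - F"] assms by auto
qed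

text \<open>An equality of records and not merely an isomorphism is required, because
  \<open>kl\<close> and \<open>KL_poly\<close> are functions of the matroid itself. Off the ground
  set both independence predicates are false.\<close>

lemma contraction_contraction:
  assumes "F \<subseteq> G" "G \<subseteq> ground M"
  shows "contraction (contraction M F) (G - F) = contraction M G"
proof -
  interpret C: finite_matroid "contraction M F"
    by standard (use matroid_contraction assms in auto)
  have ground: "ground M - F - (G - F) = ground M - G" using assms by blast
  have "indep (contraction (contraction M F) (G - F)) A \<longleftrightarrow> indep (contraction M G) A" for A
  proof (cases "A \<subseteq> ground M - G")
    case True
    have eq: "A \<union> (G - F) = (A \<union> G) - F" using True assms by blast
    have "indep (contraction (contraction M F) (G - F)) A \<longleftrightarrow>
        rk_of (contraction M F) (A \<union> (G - F)) = card A + rk_of (contraction M F) (G - F)"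
      using True assms by (intro C.indep_contraction_iff) auto
    also have "\<dots> \<longleftrightarrow> rk_of M (A \<union> G) - rk_of M F = card A + (rk_of M G - rk_of M F)"
      unfolding eq using True assms by (subst rk_contraction_flat; auto simp: rk_contraction_flat)
    also have "\<dots> \<longleftrightarrow> rk_of M (A \<union> G) = card A + rk_of M G"
      using rk_mono[of F G] rk_mono[of G "A \<union> G"] assms by auto
    also have "\<dots> \<longleftrightarrow> indep (contraction M G) A"
      using True assms indep_contraction_iff by auto
    finally show ?thesis .
  next
    case False
    with ground show ?thesis by (auto simp: contraction_def)
  qed
  then show ?thesis
    using ground by (auto simp: contraction_def)
qed

lemma contraction_empty [simp]: "contraction M {} = M"
  using indep_subset_ground indep_empty by (auto simp: contraction_def intro!: matroid.equality)

end

section \<open>Kazhdan-Lusztig polynomials from palindromicity\<close>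

lemma sum_mobius_bot:
  assumes "finite L" "{} \<in> L" "H \<in> L" "finite H"
  shows "(\<Sum>G | G \<in> L \<and> G \<subseteq> H. mobius L {} G) = (if H = {} then 1 else 0)"
proof (cases "H = {}")
  case True
  with assms(2) have "{G. G \<in> L \<and> G \<subseteq> H} = {{}}" by auto
  with True show ?thesis by (simp add: mobius.simps)
next
  case False
  have "{G. G \<in> L \<and> G \<subseteq> H} = insert H {G \<in> L. {} \<subseteq> G \<and> G \<subset> H}" using assms(3) by auto
  then have "(\<Sum>G | G \<in> L \<and> G \<subseteq> H. mobius L {} G) =
      mobius L {} H + (\<Sum>G\<in>{G \<in> L. {} \<subseteq> G \<and> G \<subset> H}. mobius L {} G)"
    using assms(1) by (subst sum.insert[symmetric]) auto
  also have "mobius L {} H = - (\<Sum>G\<in>{G \<in> L. {} \<subseteq> G \<and> G \<subset> H}. mobius L {} G)"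
    using False assms(4) by (subst mobius.simps) auto
  finally show ?thesis using False by simp
qed

text \<open>The recursion at \<open>G\<close> only looks at members below \<open>G\<close>, so
  passing to the flats of a restriction does not change the value.\<close>

lemma mobius_below:
  assumes "finite G" "G \<subseteq> F"
  shows "mobius {G \<in> L. G \<subseteq> F} A G = mobius L A G"
  using assms
proof (induction G rule: finite_psubset_induct)
  case (psubset G)
  have "{H \<in> {G \<in> L. G \<subseteq> F}. A \<subseteq> H \<and> H \<subset> G} = {H \<in> L. A \<subseteq> H \<and> H \<subset> G}"
    using psubset.prems by auto
  moreover have "(\<Sum>H\<in>{H \<in> L. A \<subseteq> H \<and> H \<subset> G}. mobius {G \<in> L. G \<subseteq> F} A H) =
      (\<Sum>H\<in>{H \<in> L. A \<subseteq> H \<and> H \<subset> G}. mobius L A H)"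
    using psubset by (intro sum.cong) auto
  ultimately show ?case
    by (subst (1 2) mobius.simps) simp
qed

section \<open>Loopless matroids and their contractions by flats\<close>

locale loopless_matroid = finite_matroid +
  assumes loopless: "loopless M"
begin

lemma empty_flat: "{} \<in> flats M"
proof -
  have "rk_of M {} < rk_of M {e}" if "e \<in> ground M" for e
    using card_le_rk[of "{e}" "{e}"] that loopless by (auto simp: loopless_def)
  then show ?thesis by (auto simp: flats_def)
qed

lemma rk_0_iff: "rk M = 0 \<longleftrightarrow> ground M = {}"
  using rk_flat_less[OF empty_flat, of "ground M"] 
  by (metis bot.not_eq_extremum less_irrefl order_refl rk_empty)

lemma contraction: "F \<in> flats M \<Longrightarrow> loopless_matroid (contraction M F)"
  by standard (use matroid_contraction loopless_contraction flat_subset_ground in auto)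

lemma card_ground_contraction_less:
  assumes "F \<in> flats M" "F \<noteq> {}"
  shows "card (ground (contraction M F)) < card (ground M)"
  using assms flat_subset_ground[OF assms(1)] finite_ground
  by (auto intro!: psubset_card_mono)

lemma rk_contraction_ground: "F \<in> flats M \<Longrightarrow> rk (contraction M F) = rk M - rk_of M F"
  using rk_contraction_flat[of F "ground M"] flat_subset_ground by simp

lemma rk_le_ground: "S \<subseteq> ground M \<Longrightarrow> rk_of M S \<le> rk M"
  by (rule rk_mono)

lemma char_poly_restriction:
  assumes "F \<in> flats M"
  shows "char_poly (restriction M F) =
    (\<Sum>G | G \<in> flats M \<and> G \<subseteq> F. monom (mobius (flats M) {} G) (rk_of M F - rk_of M G))"
proof -
  have ground: "ground (restriction M F) = F" by (simp add: restriction_def)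
  show ?thesis
    unfolding char_poly_def ground flats_restriction[OF assms]
    by (rule sum.cong) (auto simp: rk_restriction mobius_below finite_flat)
qed

lemma char_poly_restriction_empty: "char_poly (restriction M {}) = 1"
proof -
  have "{G. G \<in> flats M \<and> G \<subseteq> {}} = {{}}" using empty_flat by auto
  then show ?thesis
    by (simp add: char_poly_restriction[OF empty_flat] mobius.simps)
qed

end

text \<open>Builds the solution from palindromicity instead of from the defining equation: the
  summand of the flat \<open>{}\<close> in the Z-polynomial is what completes the sum over the other
  flats. The value 1 is correct in rank 0 and a mere default outside the loopless matroids.\<close>

function kl :: "'a matroid \<Rightarrow> int poly" where
  "kl M = (if is_matroid M \<and> loopless M \<and> rk M > 0
     then palindromic_completion (rk M)
       (\<Sum>F\<in>flats M - {{}}. monom 1 (rk_of M F) * kl (contraction M F))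
     else 1)"
  by pat_completeness auto
termination
proof (relation "Wellfounded.measure (\<lambda>M. card (ground M))")
  fix M :: "'a matroid" and F
  assume "is_matroid M \<and> loopless M \<and> 0 < rk M" "F \<in> flats M - {{}}"
  then interpret loopless_matroid M by unfold_locales auto
  show "(contraction M F, M) \<in> Wellfounded.measure (\<lambda>M. card (ground M))"
    using card_ground_contraction_less \<open>F \<in> flats M - {{}}\<close> by auto
qed auto

declare kl.simps [simp del]

context loopless_matroid
begin

lemma kl_rk_0: "rk M = 0 \<Longrightarrow> kl M = 1"
  by (subst kl.simps) simp

lemma degree_kl: "0 < rk M \<Longrightarrow> 2 * degree (kl M) < rk M"
  by (subst kl.simps) (use is_matroid loopless degree_palindromic_completion in auto)

lemma degree_kl_le: "degree (kl M) \<le> rk M"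
  using kl_rk_0 degree_kl by (cases "rk M = 0") auto

end

lemma degree_monom_mult_le: "degree p \<le> b \<Longrightarrow> degree (monom c a * p) \<le> a + b"
  using degree_mult_le[of "monom c a" p] degree_monom_le[of c a] by linarith

context loopless_matroid
begin

lemma degree_kl_contraction_le:
  assumes "F \<in> flats M"
  shows "degree (kl (contraction M F)) \<le> rk M - rk_of M F"
proof -
  interpret C: loopless_matroid "contraction M F" by (rule contraction[OF assms])
  show ?thesis using C.degree_kl_le by (simp only: rk_contraction_ground[OF assms])
qed

lemma kl_Z_palindromic:
  "rev_poly (rk M) (\<Sum>F\<in>flats M. monom 1 (rk_of M F) * kl (contraction M F)) =
     (\<Sum>F\<in>flats M. monom 1 (rk_of M F) * kl (contraction M F))"
proof -
  let ?f = "\<lambda>F. monom 1 (rk_of M F) * kl (contraction M F)"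
  have split: "sum ?f (flats M) = kl M + sum ?f (flats M - {{}})"
    using sum.remove[OF finite_flats empty_flat, of ?f] by simp
  show ?thesis
  proof (cases "rk M = 0")
    case True
    then have "flats M = {{}}" using empty_flat rk_0_iff by (auto simp: flats_def)
    with True show ?thesis
      by (intro poly_eqI) (simp add: kl_rk_0 coeff_rev_poly)
  next
    case False
    have "degree (?f F) \<le> rk M" if "F \<in> flats M - {{}}" for F
      using degree_monom_mult_le[OF degree_kl_contraction_le, of F 1 "rk_of M F"]
        rk_le_ground flat_subset_ground that by fastforce
    then have "degree (sum ?f (flats M - {{}})) \<le> rk M"
      by (intro degree_sum_le) (auto simp: finite_flats)
    moreover have "kl M = palindromic_completion (rk M) (sum ?f (flats M - {{}}))"
      using False is_matroid loopless by (subst kl.simps) simp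
    ultimately show ?thesis
      unfolding split using palindromic_completion by simp
  qed
qed

text \<open>All contractions are reindexed by flats of the one matroid \<open>M\<close>, so that the
  identities for different \<open>F\<close> can be combined.\<close>

lemma Z_contraction:
  assumes "F \<in> flats M"
  shows "(\<Sum>G\<in>flats (contraction M F). monom 1 (rk_of (contraction M F) G) *
      f (contraction (contraction M F) G)) =
    (\<Sum>G | G \<in> flats M \<and> F \<subseteq> G. monom 1 (rk_of M G - rk_of M F) * f (contraction M G))"
  unfolding sum_flats_contraction[OF flat_subset_ground[OF assms]]
  by (rule sum.cong) (auto simp: contraction_contraction rk_contraction_flat flat_subset_ground)

text \<open>Reversing a summand at the length belonging to \<open>F\<close> cancels its shift and
  leaves the reversal at the length belonging to \<open>G\<close>. The result no longer depends on
  \<open>F\<close>, which is what permits an inversion over \<open>F\<close>.\<close>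

lemma rev_poly_Z_sum:
  assumes "F \<in> flats M" and deg: "\<And>G. G \<in> flats M \<Longrightarrow> degree (p G) \<le> rk M - rk_of M G"
  shows "rev_poly (rk M - rk_of M F)
      (\<Sum>G | G \<in> flats M \<and> F \<subseteq> G. monom 1 (rk_of M G - rk_of M F) * p G) =
    (\<Sum>G | G \<in> flats M \<and> F \<subseteq> G. rev_poly (rk M - rk_of M G) (p G))"
  unfolding rev_poly_sum
proof (rule sum.cong)
  fix G assume G: "G \<in> {G. G \<in> flats M \<and> F \<subseteq> G}"
  then have "rk_of M F \<le> rk_of M G" "rk_of M G \<le> rk M"
    using rk_mono flat_subset_ground by auto
  then have "rk M - rk_of M F = (rk_of M G - rk_of M F) + (rk M - rk_of M G)" by simp
  then show "rev_poly (rk M - rk_of M F) (monom 1 (rk_of M G - rk_of M F) * p G) =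
      rev_poly (rk M - rk_of M G) (p G)"
    using deg G by (simp add: rev_poly_monom_mult)
qed simp

lemma kl_Z_contraction_palindromic:
  assumes "F \<in> flats M"
  shows "rev_poly (rk M - rk_of M F)
      (\<Sum>G | G \<in> flats M \<and> F \<subseteq> G. monom 1 (rk_of M G - rk_of M F) * kl (contraction M G)) =
    (\<Sum>G | G \<in> flats M \<and> F \<subseteq> G. monom 1 (rk_of M G - rk_of M F) * kl (contraction M G))"
proof -
  interpret C: loopless_matroid "contraction M F" by (rule contraction[OF assms])
  show ?thesis
    using C.kl_Z_palindromic
    by (simp only: rk_contraction_ground[OF assms] Z_contraction[OF assms])
qed

text \<open>Moebius inversion of the palindromicity of the Z-polynomials of all contractions \<open>M/G\<close>;
  only the defining identity of the Moebius function is needed.\<close>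

lemma kl_equation:
  "rev_poly (rk M) (kl M) = (\<Sum>F\<in>flats M. char_poly (restriction M F) * kl (contraction M F))"
proof -
  let ?L = "flats M" and ?\<mu> = "mobius (flats M) {}"
  let ?r = "\<lambda>H. rev_poly (rk M - rk_of M H) (kl (contraction M H))"
  have fin: "finite ?L" by (rule finite_flats)
  have "rev_poly (rk M) (kl M) = ?r {}" by simp
  also have "\<dots> = (\<Sum>H\<in>?L. if H = {} then ?r H else 0)"
    using fin empty_flat by (subst sum.delta) auto
  also have "\<dots> = (\<Sum>H\<in>?L. of_int (\<Sum>G | G \<in> ?L \<and> G \<subseteq> H. ?\<mu> G) * ?r H)"
    by (rule sum.cong) (auto simp: sum_mobius_bot fin empty_flat finite_flat)
  also have "\<dots> = (\<Sum>H\<in>?L. \<Sum>G | G \<in> ?L \<and> G \<subseteq> H. of_int (?\<mu> G) * ?r H)"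
    by (simp add: sum_distrib_right)
  also have "\<dots> = (\<Sum>G\<in>?L. \<Sum>H | H \<in> ?L \<and> G \<subseteq> H. of_int (?\<mu> G) * ?r H)"
    using fin by (subst sum.swap_restrict) auto
  also have "\<dots> = (\<Sum>G\<in>?L. of_int (?\<mu> G) * (\<Sum>H | H \<in> ?L \<and> G \<subseteq> H. ?r H))"
    by (simp add: sum_distrib_left)
  also have "\<dots> = (\<Sum>G\<in>?L. of_int (?\<mu> G) *
      (\<Sum>H | H \<in> ?L \<and> G \<subseteq> H. monom 1 (rk_of M H - rk_of M G) * kl (contraction M H)))"
  proof (rule sum.cong)
    fix G assume G: "G \<in> ?L"
    show "of_int (?\<mu> G) * (\<Sum>H | H \<in> ?L \<and> G \<subseteq> H. ?r H) = of_int (?\<mu> G) *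
      (\<Sum>H | H \<in> ?L \<and> G \<subseteq> H. monom 1 (rk_of M H - rk_of M G) * kl (contraction M H))"
      using kl_Z_contraction_palindromic[OF G]
        rev_poly_Z_sum[OF G degree_kl_contraction_le] by simp
  qed simp
  also have "\<dots> = (\<Sum>G\<in>?L. \<Sum>H | H \<in> ?L \<and> G \<subseteq> H.
      monom (?\<mu> G) (rk_of M H - rk_of M G) * kl (contraction M H))"
    by (simp add: sum_distrib_left of_int_poly smult_monom flip: mult.assoc)
  also have "\<dots> = (\<Sum>H\<in>?L. \<Sum>G | G \<in> ?L \<and> G \<subseteq> H.
      monom (?\<mu> G) (rk_of M H - rk_of M G) * kl (contraction M H))"
    using fin by (subst sum.swap_restrict) auto
  also have "\<dots> = (\<Sum>H\<in>?L. char_poly (restriction M H) * kl (contraction M H))"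
    by (simp add: char_poly_restriction sum_distrib_right)
  finally show ?thesis .
qed

end

lemma KL_assignment_kl: "KL_assignment kl"
  unfolding KL_assignment_def
proof (intro allI impI)
  fix M :: "'a matroid"
  assume "is_matroid M \<and> loopless M"
  then interpret loopless_matroid M by unfold_locales auto
  show "(rk M = 0 \<longrightarrow> kl M = 1) \<and>
      (rk M > 0 \<longrightarrow> real (degree (kl M)) < real (rk M) / 2) \<and>
      monom 1 (rk M - degree (kl M)) * reflect_poly (kl M) =
        (\<Sum>F\<in>flats M. char_poly (restriction M F) * kl (contraction M F))"
    using kl_rk_0 degree_kl rev_poly_conv_reflect[OF degree_kl_le] kl_equation by auto
qed

text \<open>\<open>P M\<close> enters the right-hand side only through the flat \<open>{}\<close>,
  with factor 1. The other terms agree by induction, so the difference of two solutions is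
  palindromic and of low degree.\<close>

lemma KL_assignment_unique:
  assumes "KL_assignment P" "KL_assignment Q" "loopless_matroid M"
  shows "P M = Q M"
  using assms(3)
proof (induction "card (ground M)" arbitrary: M rule: less_induct)
  case less
  interpret loopless_matroid M by (rule less.prems)
  show ?case
  proof (cases "rk M = 0")
    case True
    with assms(1,2) is_matroid loopless show ?thesis by (simp add: KL_assignment_def)
  next
    case False
    define c where
      "c P = (\<Sum>F\<in>flats M - {{}}. char_poly (restriction M F) * P (contraction M F))" for P
    have *: "2 * degree (P M) < rk M \<and> rev_poly (rk M) (P M) = P M + c P"
      if "KL_assignment P" for P
    proof -
      have deg: "2 * degree (P M) < rk M"
        using that False is_matroid loopless by (fastforce simp: KL_assignment_def)
      then have "rev_poly (rk M) (P M) =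
          (\<Sum>F\<in>flats M. char_poly (restriction M F) * P (contraction M F))"
        using that is_matroid loopless by (simp add: KL_assignment_def rev_poly_conv_reflect)
      also have "\<dots> = P M + c P"
        unfolding c_def
        by (subst sum.remove[OF finite_flats empty_flat])
          (simp_all add: char_poly_restriction_empty)
      finally show ?thesis using deg by simp
    qed
    have "c P = c Q"
      unfolding c_def
    proof (rule sum.cong)
      fix F assume "F \<in> flats M - {{}}"
      then show "char_poly (restriction M F) * P (contraction M F) =
          char_poly (restriction M F) * Q (contraction M F)"
        using less.hyps[OF card_ground_contraction_less contraction] by simp
    qed simp
    then have "rev_poly (rk M) (P M - Q M) = P M - Q M"
      using *[OF assms(1)] *[OF assms(2)] by (simp add: rev_poly_diff)
    moreover have "2 * degree (P M - Q M) < rk M"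
      using degree_diff_le_max[of "P M" "Q M"] *[OF assms(1)] *[OF assms(2)] by linarith
    ultimately show ?thesis using palindromic_low_degree by fastforce
  qed
qed

lemma KL_poly_eq_kl:
  assumes "loopless_matroid M"
  shows "KL_poly M = kl M"
  unfolding KL_poly_def
  by (rule the_equality) (use KL_assignment_kl KL_assignment_unique assms in blast)+

context loopless_matroid
begin

text \<open>Recognition principle for values guessed on all contractions at once. The induction runs
  from the top flat downwards, since besides \<open>F\<close> itself the sum for \<open>F\<close>
  involves only larger flats.\<close>

lemma kl_contraction_eqI:
  fixes p :: "'a set \<Rightarrow> int poly"
  assumes top: "p (ground M) = 1"
    and deg: "\<And>F. F \<in> flats M \<Longrightarrow> F \<noteq> ground M \<Longrightarrow> 2 * degree (p F) < rk M - rk_of M F"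
    and pal: "\<And>F. F \<in> flats M \<Longrightarrow> F \<noteq> ground M \<Longrightarrow>
      rev_poly (rk M - rk_of M F)
        (\<Sum>G | G \<in> flats M \<and> F \<subseteq> G. monom 1 (rk_of M G - rk_of M F) * p G) =
      (\<Sum>G | G \<in> flats M \<and> F \<subseteq> G. monom 1 (rk_of M G - rk_of M F) * p G)"
    and F: "F \<in> flats M"
  shows "kl (contraction M F) = p F"
  using F
proof (induction "card (ground M - F)" arbitrary: F rule: less_induct)
  case less
  interpret C: loopless_matroid "contraction M F" by (rule contraction[OF less.prems])
  have rkC: "rk (contraction M F) = rk M - rk_of M F" by (rule rk_contraction_ground[OF less.prems])
  show ?case
  proof (cases "F = ground M")
    case True
    then show ?thesis using C.kl_rk_0 rkC top by simp
  next
    case False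
    then have pos: "0 < rk M - rk_of M F"
      using rk_flat_less[OF less.prems, of "ground M"] flat_subset_ground[OF less.prems] by auto
    let ?A = "{G. G \<in> flats M \<and> F \<subseteq> G}"
    define c where
      "c p = (\<Sum>G\<in>?A - {F}. monom 1 (rk_of M G - rk_of M F) * p G)" for p :: "'a set \<Rightarrow> int poly"
    have split: "(\<Sum>G\<in>?A. monom 1 (rk_of M G - rk_of M F) * p G) = p F + c p"
      for p :: "'a set \<Rightarrow> int poly"
      unfolding c_def using less.prems finite_flats by (subst sum.remove[of _ F]) auto
    have "c (\<lambda>G. kl (contraction M G)) = c p"
      unfolding c_def
    proof (rule sum.cong)
      fix G assume G: "G \<in> ?A - {F}"
      then have "card (ground M - G) < card (ground M - F)"
        using flat_subset_ground finite_ground by (intro psubset_card_mono) auto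
      with G less.hyps[of G] show "monom 1 (rk_of M G - rk_of M F) * kl (contraction M G) =
          monom 1 (rk_of M G - rk_of M F) * p G" by simp
    qed simp
    then show ?thesis
      using palindromic_completion_unique[of "rk M - rk_of M F" "kl (contraction M F)" "c p" "p F"]
        kl_Z_contraction_palindromic[OF less.prems] pal[OF less.prems False]
        C.degree_kl deg[OF less.prems False] pos
      unfolding split rkC by simp
  qed
qed

lemma Z_poly_eqI:
  fixes p :: "'a set \<Rightarrow> int poly"
  assumes "p (ground M) = 1"
    and "\<And>F. F \<in> flats M \<Longrightarrow> F \<noteq> ground M \<Longrightarrow> 2 * degree (p F) < rk M - rk_of M F"
    and "\<And>F. F \<in> flats M \<Longrightarrow> F \<noteq> ground M \<Longrightarrow>
      rev_poly (rk M - rk_of M F)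
        (\<Sum>G | G \<in> flats M \<and> F \<subseteq> G. monom 1 (rk_of M G - rk_of M F) * p G) =
      (\<Sum>G | G \<in> flats M \<and> F \<subseteq> G. monom 1 (rk_of M G - rk_of M F) * p G)"
  shows "Z_poly M = (\<Sum>F\<in>flats M. monom 1 (rk_of M F) * p F)"
  unfolding Z_poly_def
  by (rule sum.cong)
    (simp_all add: KL_poly_eq_kl contraction kl_contraction_eqI[OF assms])

end

section \<open>The generating function of the Z-polynomials\<close>

fun fan_kl :: "nat \<Rightarrow> int poly" where
  "fan_kl 0 = 1"
| "fan_kl (Suc n) = (\<Sum>i\<le>n. fan_kl i * fan_kl (n - i)) +
     [:-1, 1:] * (\<Sum>i<n. fan_kl i * fan_kl (n - 1 - i))"

declare fan_kl.simps(2) [simp del]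

text \<open>The first summand comes from the flats that connect the two hubs, above which the
  lattice of flats is Boolean. The sum comes from the flats with one edge at each of
  \<open>j\<close> spoke vertices and none elsewhere; there are \<open>(n choose j) * 2 ^ j\<close>
  of them, and contracting one leaves \<open>n - j\<close> spoke vertices.\<close>

definition fan_Z :: "nat \<Rightarrow> int poly" where
  "fan_Z n = monom 1 1 * [:1, 1:] ^ n +
     (\<Sum>j\<le>n. of_nat (n choose j) * 2 ^ j * (monom 1 j * fan_kl (n - j)))"

lemma degree_fan_kl: "2 * degree (fan_kl n) \<le> n"
proof (induction n rule: less_induct)
  case (less n)
  show ?case
  proof (cases n)
    case 0
    then show ?thesis by simp
  next
    case (Suc m)
    have *: "degree (fan_kl i * fan_kl j) \<le> (i + j) div 2" if "i < n" "j < n" for i j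
      using degree_mult_le[of "fan_kl i" "fan_kl j"] less.IH[OF that(1)] less.IH[OF that(2)]
      by linarith
    have "degree (\<Sum>i\<le>m. fan_kl i * fan_kl (m - i)) \<le> n div 2"
    proof (intro degree_sum_le)
      fix i assume "i \<in> {..m}"
      then have "degree (fan_kl i * fan_kl (m - i)) \<le> m div 2"
        using *[of i "m - i"] Suc by simp
      also have "m div 2 \<le> n div 2" using Suc by (intro div_le_mono) simp
      finally show "degree (fan_kl i * fan_kl (m - i)) \<le> n div 2" .
    qed simp
    \<comment> \<open>The factor of degree 1 is paid for by the sum of the two indices, which is
      \<open>n - 2\<close> here.\<close>
    moreover have "degree ([:-1, 1:] * (\<Sum>i<m. fan_kl i * fan_kl (m - 1 - i))) \<le> n div 2"
    proof (cases m)
      case 0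
      then show ?thesis by simp
    next
      case (Suc k)
      have "degree (\<Sum>i<m. fan_kl i * fan_kl (m - 1 - i)) \<le> k div 2"
      proof (intro degree_sum_le)
        fix i assume "i \<in> {..<m}"
        then show "degree (fan_kl i * fan_kl (m - 1 - i)) \<le> k div 2"
          using *[of i "m - 1 - i"] Suc \<open>n = Suc m\<close> by simp
      qed simp
      then have "degree ([:-1, 1:] * (\<Sum>i<m. fan_kl i * fan_kl (m - 1 - i))) \<le> 1 + k div 2"
        using degree_mult_le[of "[:-1, 1:] :: int poly" "\<Sum>i<m. fan_kl i * fan_kl (m - 1 - i)"]
        by simp
      then show ?thesis using Suc \<open>n = Suc m\<close> by simp
    qed
    ultimately have "degree (fan_kl n) \<le> n div 2"
      unfolding Suc fan_kl.simps(2) by (intro degree_add_le) auto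
    then show ?thesis by simp
  qed
qed

section \<open>Geometric series and binomial transforms of power series\<close>

unbundle fps_syntax and no vec_syntax

lemma rev_poly_mult:
  fixes p q :: "'a::idom poly"
  assumes "degree p \<le> a" "degree q \<le> b"
  shows "rev_poly (a + b) (p * q) = rev_poly a p * rev_poly b q"
proof (cases "p = 0 \<or> q = 0")
  case True
  then show ?thesis by auto
next
  case False
  then have deg: "degree (p * q) = degree p + degree q" by (simp add: degree_mult_eq)
  have "a + b - degree (p * q) = (a - degree p) + (b - degree q)"
    using assms deg by simp
  then have "monom 1 (a + b - degree (p * q)) =
      monom 1 (a - degree p) * (monom 1 (b - degree q) :: 'a poly)"
    by (simp add: mult_monom)
  then show ?thesis
    using assms deg by (simp add: rev_poly_conv_reflect reflect_poly_mult algebra_simps)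
qed

definition geometric_fps :: "'a::comm_ring_1 \<Rightarrow> 'a fps" where
  "geometric_fps a = Abs_fps (\<lambda>n. a ^ n)"

lemma geometric_fps: "(1 - fps_const a * fps_X) * geometric_fps a = 1"
  by (rule fps_ext)
    (auto simp: geometric_fps_def algebra_simps fps_mult_fps_X_commute[symmetric] power_Suc[symmetric]
      simp del: power_Suc split: nat.split)

lemma geometric_fps_power_nth:
  "(geometric_fps a ^ Suc j) $ m = of_nat ((j + m) choose m) * a ^ m"
proof (induction j arbitrary: m)
  case 0
  then show ?case by (simp add: geometric_fps_def)
next
  case (Suc j)
  have "(geometric_fps a ^ Suc (Suc j)) $ m =
      (\<Sum>k=0..m. (geometric_fps a ^ Suc j) $ k * geometric_fps a $ (m - k))"
    by (subst power_Suc2) (simp only: fps_mult_nth)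
  also have "\<dots> = (\<Sum>k\<le>m. of_nat ((j + k) choose k) * a ^ m)"
    unfolding atLeast0AtMost Suc.IH
    by (rule sum.cong) (simp_all add: geometric_fps_def mult.assoc flip: power_add)
  also have "\<dots> = of_nat (\<Sum>k\<le>m. (j + k) choose k) * a ^ m"
    by (simp add: sum_distrib_right)
  also have "(\<Sum>k\<le>m. (j + k) choose k) = (Suc j + m) choose m"
    using sum_choose_lower[of j m] by simp
  finally show ?case .
qed

text \<open>Substituting \<open>v / (1 - a * v)\<close> is a binomial transform;
  \<open>a = 2 * x\<close> gives the sum in \<open>fan_Z\<close>. The factor \<open>fps_X\<close>
  raises the exponents of the geometric series by one, which turns the coefficients into those of
  row \<open>n\<close> of Pascal's triangle.\<close>

lemma fps_compose_geometric_nth: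
  fixes f :: "'a::idom fps"
  shows "((fps_X * f) oo (fps_X * geometric_fps a)) $ Suc n =
    (\<Sum>j\<le>n. of_nat (n choose j) * a ^ j * f $ (n - j))"
proof -
  have "((fps_X * f) oo (fps_X * geometric_fps a)) $ Suc n =
      (\<Sum>i=0..Suc n. (fps_X * f) $ i * ((fps_X * geometric_fps a) ^ i) $ Suc n)"
    by (rule fps_compose_nth)
  also have "\<dots> = (\<Sum>i\<le>n. f $ i * ((fps_X * geometric_fps a) ^ Suc i) $ Suc n)"
    unfolding atLeast0AtMost by (subst sum.atMost_Suc_shift) simp
  also have "\<dots> = (\<Sum>i\<le>n. f $ i * (of_nat (n choose (n - i)) * a ^ (n - i)))"
  proof (rule sum.cong)
    fix i assume "i \<in> {..n}"
    then have "((fps_X * geometric_fps a) ^ Suc i) $ Suc n = (geometric_fps a ^ Suc i) $ (n - i)"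
      by (simp only: power_mult_distrib) (simp add: fps_X_power_mult_nth del: power_Suc)
    also have "\<dots> = of_nat (n choose (n - i)) * a ^ (n - i)"
      using \<open>i \<in> {..n}\<close> by (simp add: geometric_fps_power_nth del: power_Suc)
    finally show "f $ i * ((fps_X * geometric_fps a) ^ Suc i) $ Suc n =
        f $ i * (of_nat (n choose (n - i)) * a ^ (n - i))" by simp
  qed simp
  also have "\<dots> = (\<Sum>j\<le>n. of_nat (n choose j) * a ^ j * f $ (n - j))"
    by (rule sum.reindex_bij_witness[of _ "\<lambda>j. n - j" "\<lambda>j. n - j"]) auto
  finally show ?thesis .
qed

section \<open>The quadratic equation, the differential equation and the recurrence of
  \<open>fan_Y\<close>\<close>

abbreviation x_poly :: "int poly" where "x_poly \<equiv> [:0, 1:]"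

abbreviation s_poly :: "int poly" where "s_poly \<equiv> [:1, 1:]"

lemma fps_const_x_plus_1: "fps_const x_poly + 1 = fps_const s_poly"
proof -
  have "s_poly = x_poly + 1" by (simp add: one_pCons)
  then show ?thesis by (simp only: fps_const_add[symmetric] fps_const_1_eq_1)
qed

lemma numeral_mult_fps_const: "numeral k * fps_const c = fps_const (numeral k * c)"
  by (simp add: numeral_fps_const)

text \<open>The shift by \<open>fps_X\<close> puts \<open>fan_Z n\<close> at index
  \<open>n + 1\<close>, its reversal length. The other factor turns the coefficients into the
  differences \<open>fan_Z (n + 1) - s * fan_Z n\<close>.\<close>

definition fan_Y :: "int poly fps" where
  "fan_Y = (1 - fps_const s_poly * fps_X) * (fps_X * Abs_fps fan_Z)"

text \<open>For \<open>B = (1 - (x + 1) * X) * A\<close> the hypothesis becomes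
  \<open>B^2 = (1 - 2 * x * X) * B - X * (1 - (x + 1) * X)\<close>, and the shift by
  \<open>x * X\<close> makes the coefficient of the linear term constant. The summand
  \<open>x * (1 + x) ^ n\<close> of \<open>fan_Z\<close> supplies exactly this shift.\<close>

lemma quadratic_transform:
  fixes A Y X x :: "'a::idom"
  assumes "(1 - (x + 1) * X) * A\<^sup>2 = (1 - 2 * x * X) * A - X"
    and "Y = (1 - (x + 1) * X) * A + x * X"
  shows "Y\<^sup>2 = Y - (x + 1) * X * (1 - (x + 1) * X) - x * X\<^sup>2"
  using assms by algebra

lemma fan_Y_quadratic:
  defines "x \<equiv> fps_const x_poly"
  shows "fan_Y\<^sup>2 = fan_Y - (x + 1) * fps_X * (1 - (x + 1) * fps_X) - x * fps_X\<^sup>2"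
proof (rule quadratic_transform)
  let ?F = "Abs_fps fan_kl"
  define u where "u = fps_X * geometric_fps (2 * x_poly)"
  define p where "p = fps_const [:-1, 1 :: int:]"
  have sq: "(?F * ?F) $ m = (\<Sum>i\<le>m. fan_kl i * fan_kl (m - i))" for m
    by (simp add: fps_mult_nth atLeast0AtMost)
  have F: "?F = 1 + fps_X * (?F * ?F) + p * (fps_X * (fps_X * (?F * ?F)))"
  proof (rule fps_ext)
    fix n
    show "?F $ n = (1 + fps_X * (?F * ?F) + p * (fps_X * (fps_X * (?F * ?F)))) $ n"
    proof (cases n)
      case 0
      then show ?thesis by (simp add: p_def)
    next
      case (Suc m)
      have "(fps_X * (?F * ?F)) $ m = (\<Sum>i<m. fan_kl i * fan_kl (m - 1 - i))"
        by (cases m) (simp_all add: sq lessThan_Suc_atMost)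
      then show ?thesis
        using Suc by (simp add: p_def sq fan_kl.simps(2))
    qed
  qed
  have X_power: "monom 1 j = x_poly ^ j" for j by (simp add: monom_altdef)
  define A where "A = (fps_X * ?F) oo u"
  have u0: "u $ 0 = 0" by (simp add: u_def)
  have "A = u * (?F oo u)"
    by (simp add: A_def fps_compose_mult_distrib[OF u0] fps_X_fps_compose_startby0[OF u0])
  \<comment> \<open>The equation of the untransformed series after the substitution. As
    \<open>A = u * (?F oo u)\<close>, it becomes quadratic in \<open>A\<close> once \<open>u\<close>
    is eliminated.\<close>
  moreover have "?F oo u = 1 + u * (?F oo u)\<^sup>2 + p * (u * (u * (?F oo u)\<^sup>2))"
    by (subst F)
      (simp add: fps_compose_add_distrib fps_compose_mult_distrib[OF u0]
        fps_X_fps_compose_startby0[OF u0] p_def power2_eq_square)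
  moreover have "(1 - 2 * x * fps_X) * u = fps_X"
  proof -
    have "2 * x = fps_const (2 * x_poly)" unfolding x_def by (rule numeral_mult_fps_const)
    with geometric_fps[of "2 * x_poly"] show ?thesis
      unfolding u_def by (metis mult.left_commute mult.right_neutral)
  qed
  moreover have "p = x - 1"
  proof -
    have "[:-1, 1:] = x_poly - 1" by (simp add: one_pCons)
    then show ?thesis unfolding p_def x_def by (simp only: fps_const_sub[symmetric] fps_const_1_eq_1)
  qed
  ultimately show "(1 - (x + 1) * fps_X) * A\<^sup>2 = (1 - 2 * x * fps_X) * A - fps_X"
    by algebra
  have "fps_X * Abs_fps fan_Z = A + x * fps_X * geometric_fps s_poly"
  proof (rule fps_ext)
    fix n
    show "(fps_X * Abs_fps fan_Z) $ n = (A + x * fps_X * geometric_fps s_poly) $ n"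
    proof (cases n)
      case 0
      then show ?thesis by (simp add: A_def)
    next
      case (Suc m)
      have "A $ Suc m = (\<Sum>j\<le>m. of_nat (m choose j) * 2 ^ j * (monom 1 j * fan_kl (m - j)))"
        unfolding A_def u_def fps_compose_geometric_nth
        by (simp only: fps_nth_Abs_fps power_mult_distrib X_power mult.assoc)
      moreover have "(x * fps_X * geometric_fps s_poly) $ Suc m = monom 1 1 * s_poly ^ m"
        unfolding x_def geometric_fps_def mult.assoc fps_mult_left_const_nth X_power by simp
      ultimately show ?thesis
        using Suc by (simp add: fan_Z_def)
    qed
  qed
  moreover have "fps_const s_poly = x + 1"
    unfolding x_def by (rule fps_const_x_plus_1[symmetric])
  moreover have "(1 - fps_const s_poly * fps_X) * geometric_fps s_poly = 1"
    by (rule geometric_fps)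
  ultimately show "fan_Y = (1 - (x + 1) * fps_X) * A + x * fps_X"
    unfolding fan_Y_def by algebra
qed

text \<open>The quadratic equation says \<open>(1 - 2 * Y)^2 = 1 - 4 * s * v + 4 * q * v^2\<close>.
  Differentiating it and multiplying once more by \<open>1 - 2 * Y\<close> gives a linear equation,
  hence a recurrence for the coefficients.\<close>

lemma fan_Y_ode:
  fixes s q :: "int poly fps"
  defines "s \<equiv> fps_const s_poly" and "q \<equiv> fps_const (s_poly\<^sup>2 - x_poly)"
  shows "(1 - 4 * s * fps_X + 4 * q * fps_X\<^sup>2) * fps_deriv fan_Y =
    (s - 2 * q * fps_X) * (1 - 2 * fan_Y)"
proof -
  define x where "x = fps_const x_poly"
  have x: "x + 1 = s" unfolding x_def s_def by (rule fps_const_x_plus_1)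
  have q: "q = s\<^sup>2 - x"
    by (simp add: q_def s_def x_def flip: fps_const_sub fps_const_power)
  have sq: "fan_Y\<^sup>2 = fan_Y - s * fps_X * (1 - s * fps_X) - x * fps_X\<^sup>2"
    using fan_Y_quadratic by (fold x_def) (simp add: x)
  have ds: "fps_deriv s = 0" "fps_deriv x = 0" by (simp_all add: s_def x_def)
  have "fps_deriv (fan_Y\<^sup>2) = fps_deriv (fan_Y - s * fps_X * (1 - s * fps_X) - x * fps_X\<^sup>2)"
    by (simp only: sq)
  then have "2 * fan_Y * fps_deriv fan_Y = fps_deriv fan_Y - s * (1 - s * fps_X) + s * fps_X * s - 2 * x * fps_X"
    by (simp add: power2_eq_square ds algebra_simps)
  then have "(1 - 2 * fan_Y) * fps_deriv fan_Y = s - 2 * q * fps_X"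
    unfolding q by algebra
  with sq show ?thesis unfolding q by algebra
qed

lemma fan_Y_0: "fan_Y $ 0 = 0"
  by (simp add: fan_Y_def)

lemma fan_Y_ode_expanded:
  fixes q :: "int poly"
  defines "q \<equiv> s_poly\<^sup>2 - x_poly"
  shows "fps_deriv fan_Y - fps_const (4 * s_poly) * (fps_X * fps_deriv fan_Y)
      + fps_const (4 * q) * (fps_X * (fps_X * fps_deriv fan_Y)) =
    fps_const s_poly - fps_const (2 * q) * fps_X - fps_const (2 * s_poly) * fan_Y
      + fps_const (4 * q) * (fps_X * fan_Y)"
  using fan_Y_ode unfolding numeral_mult_fps_const[symmetric] q_def by algebra

lemma linear_ode_coeffs:
  fixes f :: "'a::comm_ring_1 fps"
  assumes "fps_deriv f - fps_const a * (fps_X * fps_deriv f)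
      + fps_const b * (fps_X * (fps_X * fps_deriv f)) =
    fps_const c - fps_const d * fps_X - fps_const e * f + fps_const g * (fps_X * f)"
  shows "f $ 1 = c - e * f $ 0"
    and "2 * f $ 2 - a * f $ 1 = g * f $ 0 - d - e * f $ 1"
    and "of_nat (m + 3) * f $ (m + 3) - a * (of_nat (m + 2) * f $ (m + 2))
        + b * (of_nat (m + 1) * f $ (m + 1)) = g * f $ (m + 1) - e * f $ (m + 2)"
proof -
  show "f $ 1 = c - e * f $ 0"
    using arg_cong[OF assms, of "\<lambda>f. f $ 0"] by simp
  show "2 * f $ 2 - a * f $ 1 = g * f $ 0 - d - e * f $ 1"
    using arg_cong[OF assms, of "\<lambda>f. f $ 1"] by (simp add: numeral_2_eq_2)
  show "of_nat (m + 3) * f $ (m + 3) - a * (of_nat (m + 2) * f $ (m + 2))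
        + b * (of_nat (m + 1) * f $ (m + 1)) = g * f $ (m + 1) - e * f $ (m + 2)"
    using arg_cong[OF assms, of "\<lambda>f. f $ (m + 2)"]
    by (simp add: numeral_2_eq_2 numeral_3_eq_3 add.assoc)
qed

lemma fan_Y_1: "fan_Y $ 1 = s_poly"
  using linear_ode_coeffs(1)[OF fan_Y_ode_expanded] by (simp add: fan_Y_0)

lemma fan_Y_2: "fan_Y $ 2 = x_poly"
proof -
  have "2 * fan_Y $ 2 = 2 * x_poly"
    using linear_ode_coeffs(2)[OF fan_Y_ode_expanded] unfolding fan_Y_1 fan_Y_0 by algebra
  then show ?thesis by (metis mult_left_cancel zero_neq_numeral)
qed

lemma fan_Y_rec:
  "of_nat (m + 3) * fan_Y $ (m + 3) =
    of_nat (4 * m + 6) * (s_poly * fan_Y $ (m + 2)) -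
    of_nat (4 * m) * ((s_poly\<^sup>2 - x_poly) * fan_Y $ (m + 1))"
  using linear_ode_coeffs(3)[OF fan_Y_ode_expanded, of m]
  unfolding of_nat_add of_nat_mult of_nat_numeral of_nat_1 by algebra

lemma fan_Z_0: "fan_Z 0 = fan_Y $ 1"
  by (simp add: fan_Y_def left_diff_distrib mult.assoc)

text \<open>All terms of the recurrence are reversed at the same length, as \<open>s\<close> and
  \<open>s^2 - x\<close> are palindromic of lengths 1 and 2. The factor \<open>of_nat m\<close> on
  the left cancels in integer polynomials, so no division is required.\<close>

lemma palindromic_fan_Y: "degree (fan_Y $ m) \<le> m \<and> rev_poly m (fan_Y $ m) = fan_Y $ m"
proof (induction m rule: less_induct)
  case (less m)
  consider "m = 0" | "m = 1" | "m = 2" | "3 \<le> m"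
    by linarith
  then show ?case
  proof cases
    case 1
    then show ?thesis by (simp add: fan_Y_0)
  next
    case 2
    then show ?thesis
      unfolding 2 fan_Y_1 by (simp add: rev_poly_conv_reflect reflect_poly_def)
  next
    case 3
    have "rev_poly 2 x_poly = x_poly"
      by (rule poly_eqI) (auto simp: coeff_rev_poly coeff_pCons split: nat.splits)
    then show ?thesis
      unfolding 3 fan_Y_2 by simp
  next
    case ge: 4
    define k where "k = m - 3"
    have 4: "m = k + 3" using ge by (simp add: k_def)
    define q where "q = s_poly\<^sup>2 - x_poly"
    have q: "degree q \<le> 2" "rev_poly 2 q = q"
      by (simp_all add: q_def power2_eq_square rev_poly_conv_reflect reflect_poly_def)
    have s: "degree s_poly \<le> 1" "rev_poly 1 s_poly = s_poly"
      by (simp_all add: rev_poly_conv_reflect reflect_poly_def)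
    have c: "degree (of_nat j * p) \<le> degree p" "rev_poly r (of_nat j * p) = of_nat j * rev_poly r p"
      for j r and p :: "int poly"
      by (simp_all add: of_nat_poly degree_smult_le poly_eq_iff coeff_rev_poly)
    have sY: "degree (s_poly * fan_Y $ (k + 2)) \<le> m"
        "rev_poly m (s_poly * fan_Y $ (k + 2)) = s_poly * fan_Y $ (k + 2)"
      using degree_mult_le[of s_poly "fan_Y $ (k + 2)"] rev_poly_mult[OF s(1), of "fan_Y $ (k + 2)" "k + 2"]
        less.IH[of "k + 2"] s 4 by (auto simp: eval_nat_numeral)
    have qY: "degree (q * fan_Y $ (k + 1)) \<le> m"
        "rev_poly m (q * fan_Y $ (k + 1)) = q * fan_Y $ (k + 1)"
      using degree_mult_le[of q "fan_Y $ (k + 1)"] rev_poly_mult[OF q(1), of "fan_Y $ (k + 1)" "k + 1"]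
        less.IH[of "k + 1"] q 4 by (auto simp: eval_nat_numeral)
    have rec: "of_nat m * fan_Y $ m =
        of_nat (4 * k + 6) * (s_poly * fan_Y $ (k + 2)) - of_nat (4 * k) * (q * fan_Y $ (k + 1))"
      unfolding 4 q_def by (rule fan_Y_rec)
    have m: "of_nat m \<noteq> (0 :: int)" using 4 by simp
    have "degree (of_nat m * fan_Y $ m) \<le> m"
      unfolding rec using order_trans[OF c(1) sY(1)] order_trans[OF c(1) qY(1)]
      by (intro degree_diff_le)
    then have "degree (fan_Y $ m) \<le> m"
      using m by (simp add: of_nat_poly)
    moreover have "of_nat m * rev_poly m (fan_Y $ m) = of_nat m * fan_Y $ m"
      unfolding c(2)[symmetric] unfolding rec rev_poly_diff c(2) sY qY ..
    then have "rev_poly m (fan_Y $ m) = fan_Y $ m"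
      using ge by (subst (asm) mult_left_cancel) auto
    ultimately show ?thesis ..
  qed
qed

lemma fan_Z_Suc: "fan_Z (Suc n) = s_poly * fan_Z n + fan_Y $ (n + 2)"
  by (simp add: fan_Y_def left_diff_distrib mult.assoc)

text \<open>Obtained without any matroid; this is what later confirms the guess
  \<open>fan_kl\<close>.\<close>

lemma degree_palindromic_fan_Z:
  "degree (fan_Z n) \<le> Suc n \<and> rev_poly (Suc n) (fan_Z n) = fan_Z n"
proof (induction n)
  case 0
  show ?case using palindromic_fan_Y[of 1] by (simp add: fan_Z_0)
next
  case (Suc n)
  have s: "degree s_poly \<le> 1" "rev_poly 1 s_poly = s_poly"
    by (simp_all add: rev_poly_conv_reflect reflect_poly_def)
  have "degree (s_poly * fan_Z n) \<le> Suc (Suc n)"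
    using degree_mult_le[of s_poly "fan_Z n"] s Suc by simp
  moreover have "rev_poly (Suc (Suc n)) (s_poly * fan_Z n) = s_poly * fan_Z n"
    using rev_poly_mult[OF s(1), of "fan_Z n" "Suc n"] s Suc by simp
  ultimately show ?case
    using palindromic_fan_Y[of "n + 2"] unfolding fan_Z_Suc rev_poly_add
    by (simp add: degree_add_le)
qed

section \<open>Kazhdan-Lusztig polynomials of fan-like matroids\<close>

lemma palindromic_one_plus_X_power: "rev_poly n ([:1, 1:] ^ n) = ([:1, 1:] ^ n :: int poly)"
proof -
  have "reflect_poly [:1, 1 :: int:] = [:1, 1:]" by (simp add: reflect_poly_def)
  then show ?thesis
    by (simp add: rev_poly_conv_reflect degree_power_eq reflect_poly_power)
qed

lemma sum_Pow_card_X: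
  assumes "finite I"
  shows "(\<Sum>J\<in>Pow I. monom 1 (card J)) = ([:1, 1:] ^ card I :: int poly)"
  using assms
proof (induction I rule: finite_induct)
  case empty
  then show ?case by (simp add: one_pCons)
next
  case (insert i I)
  have inj: "inj_on (insert i) (Pow I)"
    using insert.hyps by (auto simp: inj_on_def insert_ident)
  have disj: "Pow I \<inter> insert i ` Pow I = {}" using insert.hyps by auto
  have card: "card (insert i J) = Suc (card J)" if "J \<in> Pow I" for J
    using that insert.hyps finite_subset by (subst card_insert_disjoint) auto
  have X: "monom 1 (Suc k) = [:0, 1:] * (monom 1 k :: int poly)" for k
    by (simp add: monom_Suc)
  have "(\<Sum>J\<in>Pow (insert i I). monom 1 (card J)) =
      (\<Sum>J\<in>Pow I. monom 1 (card J)) + (\<Sum>J\<in>Pow I. [:0, 1:] * monom 1 (card J) :: int poly)"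
    unfolding Pow_insert using insert.hyps inj disj
    by (subst sum.union_disjoint) (auto simp: sum.reindex card X)
  also have "(\<Sum>J\<in>Pow I. [:0, 1:] * monom 1 (card J) :: int poly) =
      [:0, 1:] * (\<Sum>J\<in>Pow I. monom 1 (card J))"
    by (rule sum_distrib_left[symmetric])
  finally show ?case using insert by simp
qed

text \<open>\<open>l i\<close> and \<open>r i\<close> are the edges from the \<open>i\<close>-th spoke vertex to the two hubs, and \<open>e\<close> is the edge
  between the hubs, which may or may not belong to \<open>M\<close>.\<close>

locale fan_matroid =
  fixes l r :: "nat \<Rightarrow> 'e" and e :: 'e and n :: nat and M :: "'e matroid"
    and both touched :: "'e set \<Rightarrow> nat set" and joined :: "'e set \<Rightarrow> bool"
  defines "both A \<equiv> {i. i < n \<and> l i \<in> A \<and> r i \<in> A}"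
    and "touched A \<equiv> {i. i < n \<and> (l i \<in> A \<or> r i \<in> A)}"
    and "joined A \<equiv> e \<in> A \<or> both A \<noteq> {}"
  assumes l_eq_iff: "i < n \<Longrightarrow> j < n \<Longrightarrow> l i = l j \<longleftrightarrow> i = j"
    and r_eq_iff: "i < n \<Longrightarrow> j < n \<Longrightarrow> r i = r j \<longleftrightarrow> i = j"
    and l_neq_r: "i < n \<Longrightarrow> j < n \<Longrightarrow> l i \<noteq> r j"
    and l_neq_e: "i < n \<Longrightarrow> l i \<noteq> e"
    and r_neq_e: "i < n \<Longrightarrow> r i \<noteq> e"
    and ground_minus: "ground M - {e} = l ` {..<n} \<union> r ` {..<n}"
    and indep_iff: "indep M A \<longleftrightarrow>
      A \<subseteq> ground M \<and> card (both A) + (if e \<in> A then 1 else 0) \<le> 1"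
    and two_le: "2 \<le> n"
begin

lemmas edge_neq = l_eq_iff r_eq_iff l_neq_r l_neq_r[THEN not_sym] l_neq_e r_neq_e
  l_neq_e[THEN not_sym] r_neq_e[THEN not_sym]

lemma finite_both [simp]: "finite (both A)" by (simp add: both_def)

lemma finite_touched [simp]: "finite (touched A)" by (simp add: touched_def)

lemma both_mono: "A \<subseteq> B \<Longrightarrow> both A \<subseteq> both B" by (auto simp: both_def)

lemma touched_mono: "A \<subseteq> B \<Longrightarrow> touched A \<subseteq> touched B" by (auto simp: touched_def)

lemma edge_cases:
  assumes "x \<in> ground M"
  obtains j where "j < n" "x = l j" | j where "j < n" "x = r j" | "x = e"
proof (cases "x = e")
  case False
  with assms have "x \<in> l ` {..<n} \<union> r ` {..<n}" unfolding ground_minus[symmetric] by blast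
  with that show ?thesis by blast
qed (use that in blast)

lemma l_in_ground [simp]: "i < n \<Longrightarrow> l i \<in> ground M"
  using ground_minus by blast

lemma r_in_ground [simp]: "i < n \<Longrightarrow> r i \<in> ground M"
  using ground_minus by blast

lemma finite_fan_ground: "finite (ground M)"
  by (rule finite_subset[of _ "insert e (l ` {..<n} \<union> r ` {..<n})"]) (use ground_minus in auto)

lemma both_insert_l: "j < n \<Longrightarrow> both (insert (l j) A) = (if r j \<in> A then insert j (both A) else both A)"
  by (auto simp: both_def edge_neq)

lemma both_insert_r: "j < n \<Longrightarrow> both (insert (r j) A) = (if l j \<in> A then insert j (both A) else both A)"
  by (auto simp: both_def edge_neq)

lemma both_insert_e [simp]: "both (insert e A) = both A"
  by (auto simp: both_def edge_neq)

lemma touched_insert_l: "j < n \<Longrightarrow> touched (insert (l j) A) = insert j (touched A)"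
  by (auto simp: touched_def edge_neq)

lemma touched_insert_r: "j < n \<Longrightarrow> touched (insert (r j) A) = insert j (touched A)"
  by (auto simp: touched_def edge_neq)

lemma touched_insert_e [simp]: "touched (insert e A) = touched A"
  by (auto simp: touched_def edge_neq)

text \<open>Every touched spoke vertex carries one edge and every vertex in \<open>both A\<close> a
  second one.\<close>

lemma card_edges:
  assumes "A \<subseteq> ground M"
  shows "card A = card (touched A) + card (both A) + (if e \<in> A then 1 else 0)"
proof -
  define LA where "LA = {i. i < n \<and> l i \<in> A}"
  define RA where "RA = {i. i < n \<and> r i \<in> A}"
  have fin: "finite LA" "finite RA" by (auto simp: LA_def RA_def)
  have A: "A = (l ` LA \<union> r ` RA) \<union> (if e \<in> A then {e} else {})"
  proof (intro set_eqI iffI)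
    fix x assume x: "x \<in> A"
    with assms have "x \<in> ground M" by blast
    then show "x \<in> (l ` LA \<union> r ` RA) \<union> (if e \<in> A then {e} else {})"
      using x by (cases rule: edge_cases) (auto simp: LA_def RA_def)
  qed (auto simp: LA_def RA_def split: if_splits)
  have "card A = card (l ` LA \<union> r ` RA) + card (if e \<in> A then {e} else {})"
    by (subst (1) A, rule card_Un_disjoint) (auto simp: LA_def RA_def edge_neq)
  also have "card (l ` LA \<union> r ` RA) = card (l ` LA) + card (r ` RA)"
    by (rule card_Un_disjoint) (auto simp: LA_def RA_def edge_neq)
  also have "card (l ` LA) = card LA"
    by (rule card_image) (auto simp: inj_on_def LA_def edge_neq)
  also have "card (r ` RA) = card RA"
    by (rule card_image) (auto simp: inj_on_def RA_def edge_neq)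
  also have "card LA + card RA = card (LA \<union> RA) + card (LA \<inter> RA)"
    using fin by (rule card_Un_Int)
  also have "LA \<union> RA = touched A" by (auto simp: LA_def RA_def touched_def)
  also have "LA \<inter> RA = both A" by (auto simp: LA_def RA_def both_def)
  finally show ?thesis by auto
qed

text \<open>If \<open>B\<close> touches a spoke vertex that \<open>A\<close> misses, an edge of
  \<open>B\<close> there extends \<open>A\<close>. Otherwise counting edges shows that
  \<open>A\<close> leaves the hubs unconnected while \<open>B\<close> connects them, and an edge of
  that connection can be added to \<open>A\<close>.\<close>

lemma matroid: "is_matroid M"
  unfolding is_matroid_def
proof (intro conjI allI impI)
  show "finite (ground M)" by (rule finite_fan_ground)
  show "A \<subseteq> ground M" if "indep M A" for A using that by (simp add: indep_iff)
  show "indep M {}" by (simp add: indep_iff both_def)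
  show "indep M A" if "indep M B \<and> A \<subseteq> B" for A B
    using that card_mono[OF finite_both both_mono[of A B]] by (auto simp: indep_iff split: if_splits)
  fix A B assume *: "indep M A \<and> indep M B \<and> card A < card B"
  then have A: "A \<subseteq> ground M" "card (both A) + (if e \<in> A then 1 else 0) \<le> 1"
    and B: "B \<subseteq> ground M" "card (both B) + (if e \<in> B then 1 else 0) \<le> 1"
    by (auto simp: indep_iff)
  show "\<exists>x\<in>B - A. indep M (insert x A)"
  proof (cases "touched B \<subseteq> touched A")
    case False
    then obtain i where i: "i < n" "l i \<in> B \<or> r i \<in> B" "l i \<notin> A" "r i \<notin> A"
      by (auto simp: touched_def)
    then have "indep M (insert (l i) A)" "indep M (insert (r i) A)"
      using A by (auto simp: indep_iff both_insert_l both_insert_r edge_neq)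
    with i show ?thesis by blast
  next
    case True
    then have "card (touched B) \<le> card (touched A)" by (intro card_mono) auto
    then have "card (both A) + (if e \<in> A then 1 else 0) <
        card (both B) + (if e \<in> B then 1 else 0)"
      using * card_edges[OF A(1)] card_edges[OF B(1)] by linarith
    then have "card (both A) + (if e \<in> A then 1 else 0) = 0"
      and B': "card (both B) + (if e \<in> B then 1 else 0) = 1"
      using B(2) by linarith+
    then have A': "both A = {}" "e \<notin> A" by (auto split: if_splits)
    show ?thesis
    proof (cases "e \<in> B")
      case True
      with A' A(1) B(1) have "indep M (insert e A)" by (auto simp: indep_iff)
      with True A' show ?thesis by blast
    next
      case False
      with B' obtain i where "i \<in> both B" by fastforce
      then have i: "i < n" "l i \<in> B" "r i \<in> B" by (auto simp: both_def)
      then have "i \<in> touched A" using True by (auto simp: touched_def)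
      moreover have "l i \<notin> A \<or> r i \<notin> A" using A'(1) i by (auto simp: both_def)
      ultimately consider "l i \<in> A" "r i \<notin> A" | "r i \<in> A" "l i \<notin> A"
        by (auto simp: touched_def)
      then show ?thesis
      proof cases
        case 1
        with A' A(1) i have "indep M (insert (r i) A)"
          by (auto simp: indep_iff both_insert_r edge_neq)
        with 1 i show ?thesis by blast
      next
        case 2
        with A' A(1) i have "indep M (insert (l i) A)"
          by (auto simp: indep_iff both_insert_l edge_neq)
        with 2 i show ?thesis by blast
      qed
    qed
  qed
qed

sublocale loopless_matroid M
proof
  show "is_matroid M" by (rule matroid)
  have "both {x} = {}" for x by (auto simp: both_def edge_neq)
  then show "loopless M" by (auto simp: loopless_def indep_iff)
qed

text \<open>A basis takes one edge at each touched vertex and one further edge if the hubs are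
  connected within \<open>S\<close>.\<close>

lemma rk_eq:
  assumes "S \<subseteq> ground M"
  shows "rk_of M S = card (touched S) + (if joined S then 1 else 0)"
proof (rule antisym)
  show "rk_of M S \<le> card (touched S) + (if joined S then 1 else 0)"
  proof (rule rk_le)
    fix A assume A: "indep M A" "A \<subseteq> S"
    have "card (touched A) \<le> card (touched S)"
      using A(2) by (intro card_mono touched_mono) auto
    moreover have "card (both A) + (if e \<in> A then 1 else 0) \<le> (if joined S then 1 else 0)"
      using A both_mono[OF A(2)] by (auto simp: indep_iff joined_def)
    ultimately show "card A \<le> card (touched S) + (if joined S then 1 else 0)"
      using card_edges[of A] A(1) indep_subset_ground by fastforce
  qed
  define A where "A = {l i |i. i < n \<and> l i \<in> S} \<union> {r i |i. i < n \<and> r i \<in> S \<and> l i \<notin> S}"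
  have A: "A \<subseteq> S" "e \<notin> A" "both A = {}" "touched A = touched S"
    by (auto simp: A_def both_def touched_def edge_neq)
  have ind: "indep M A" using A assms by (auto simp: indep_iff)
  have card: "card A = card (touched S)" using card_edges[of A] A assms by auto
  show "card (touched S) + (if joined S then 1 else 0) \<le> rk_of M S"
  proof (cases "joined S")
    case False
    with card_le_rk[OF ind A(1)] card show ?thesis by simp
  next
    case True
    obtain x where x: "x \<in> S - A" "indep M (insert x A)"
    proof (cases "e \<in> S")
      case True
      with A assms have "indep M (insert e A)" by (auto simp: indep_iff)
      with True A that show ?thesis by blast
    next
      case False
      with \<open>joined S\<close> obtain i where i: "i < n" "l i \<in> S" "r i \<in> S"
        by (auto simp: joined_def both_def)
      with A assms have "indep M (insert (r i) A)"
        by (auto simp: indep_iff both_insert_r edge_neq)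
      moreover have "r i \<notin> A" using i by (auto simp: A_def edge_neq)
      ultimately show ?thesis using i that by blast
    qed
    have "card (insert x A) = Suc (card (touched S))"
      using x card finite_indep[OF ind] by simp
    moreover have "card (insert x A) \<le> rk_of M S"
      using card_le_rk[OF x(2)] x A by blast
    ultimately show ?thesis using True by simp
  qed
qed

text \<open>The closed sets that merge both hubs with the spoke vertices in \<open>S\<close>.
  Intersecting with \<open>{e}\<close> lets one definition serve the graphs with and without the hub
  edge; in the latter \<open>full {}\<close> is empty and does not connect the hubs.\<close>

definition full :: "nat set \<Rightarrow> 'e set" where
  "full S = l ` S \<union> r ` S \<union> (ground M \<inter> {e})"

lemma full_props:
  assumes "S \<subseteq> {..<n}"
  shows "touched (full S) = S" "both (full S) = S" "e \<in> full S \<longleftrightarrow> e \<in> ground M" "full S \<subseteq> ground M"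
    "joined (full S) \<longleftrightarrow> e \<in> ground M \<or> S \<noteq> {}"
proof -
  have *: "i < n" if "i \<in> S" for i using that assms by auto
  show "touched (full S) = S" "e \<in> full S \<longleftrightarrow> e \<in> ground M"
    using * by (auto simp: touched_def full_def edge_neq split: if_splits)
  show both: "both (full S) = S"
    using * by (auto simp: both_def full_def edge_neq split: if_splits)
  show "full S \<subseteq> ground M" using * by (auto simp: full_def split: if_splits)
  show "joined (full S) \<longleftrightarrow> e \<in> ground M \<or> S \<noteq> {}"
    using * unfolding joined_def both by (auto simp: full_def edge_neq split: if_splits)
qed

lemma full_subset_iff: "S \<subseteq> {..<n} \<Longrightarrow> S' \<subseteq> {..<n} \<Longrightarrow> full S \<subseteq> full S' \<longleftrightarrow> S \<subseteq> S'"
  using full_props(1)[of S] full_props(1)[of S'] touched_mono[of "full S" "full S'"]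
  by (auto simp: full_def)

lemma subset_full_iff:
  assumes "F \<subseteq> ground M" "S \<subseteq> {..<n}"
  shows "F \<subseteq> full S \<longleftrightarrow> touched F \<subseteq> S"
proof
  assume "F \<subseteq> full S"
  then show "touched F \<subseteq> S" using touched_mono full_props(1)[OF assms(2)] by blast
next
  assume *: "touched F \<subseteq> S"
  show "F \<subseteq> full S"
  proof
    fix x assume x: "x \<in> F"
    with assms(1) have "x \<in> ground M" by blast
    then show "x \<in> full S"
      unfolding full_def using x * \<open>x \<in> ground M\<close> by (cases rule: edge_cases) (auto simp: touched_def)
  qed
qed

text \<open>As long as the hubs are not connected, a new edge either touches a new vertex or
  connects them, so every such set is closed. Once they are connected, the closure contains both
  edges at each touched vertex, and the hub edge if it exists.\<close>

lemma flat_iff: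
  "F \<in> flats M \<longleftrightarrow> F \<subseteq> ground M \<and>
    (\<not> joined F \<or> joined F \<and> (\<exists>S\<subseteq>{..<n}. F = full S))"
proof (cases "F \<subseteq> ground M")
  case False
  then show ?thesis by (auto simp: flats_def)
next
  case sub: True
  have rk_ins: "rk_of M (insert x F) = card (touched (insert x F)) + (if joined (insert x F) then 1 else 0)"
    if "x \<in> ground M" for x
    using that sub by (intro rk_eq) auto
  show ?thesis
  proof (cases "joined F")
    case False
    have "rk_of M F < rk_of M (insert x F)" if x: "x \<in> ground M - F" for x
    proof -
      from x have "x \<in> ground M" by blast
      then show ?thesis
      proof (cases rule: edge_cases)
        case (1 j)
        show ?thesis
        proof (cases "r j \<in> F")
          case True
          with 1 have "joined (insert x F)" "touched (insert x F) = touched F"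
            by (auto simp: joined_def both_def touched_def edge_neq)
          with False x rk_ins rk_eq[OF sub] show ?thesis by auto
        next
          case r: False
          have "touched (insert x F) = insert j (touched F)"
            using 1 by (simp add: touched_insert_l)
          moreover have "j \<notin> touched F" using r 1 x by (auto simp: touched_def)
          ultimately show ?thesis using False x rk_ins rk_eq[OF sub] by auto
        qed
      next
        case (2 j)
        show ?thesis
        proof (cases "l j \<in> F")
          case True
          with 2 have "joined (insert x F)" "touched (insert x F) = touched F"
            by (auto simp: joined_def both_def touched_def edge_neq)
          with False x rk_ins rk_eq[OF sub] show ?thesis by auto
        next
          case l: False
          have "touched (insert x F) = insert j (touched F)"
            using 2 by (simp add: touched_insert_r)
          moreover have "j \<notin> touched F" using l 2 x by (auto simp: touched_def)
          ultimately show ?thesis using False x rk_ins rk_eq[OF sub] by auto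
        qed
      next
        case 3
        then have "joined (insert x F)" by (simp add: joined_def)
        with 3 False x rk_ins rk_eq[OF sub] show ?thesis by auto
      qed
    qed
    with sub False show ?thesis by (auto simp: flats_def)
  next
    case True
    have "F \<in> flats M \<longleftrightarrow> (\<exists>S\<subseteq>{..<n}. F = full S)"
    proof
      assume flat: "F \<in> flats M"
      have closed: "x \<in> F" if "x \<in> ground M" "touched (insert x F) = touched F" for x
      proof (rule ccontr)
        assume "x \<notin> F"
        with flat that have "rk_of M F < rk_of M (insert x F)" by (auto simp: flats_def)
        moreover have "joined (insert x F)"
          using True both_mono[of F "insert x F"] by (auto simp: joined_def)
        ultimately show False using rk_ins[OF that(1)] rk_eq[OF sub] True that(2) by simp
      qed
      have "F = full (touched F)"
      proof
        show "F \<subseteq> full (touched F)"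
          using sub by (subst subset_full_iff) (auto simp: touched_def)
        show "full (touched F) \<subseteq> F"
        proof
          fix x assume "x \<in> full (touched F)"
          then consider j where "j \<in> touched F" "x = l j" | j where "j \<in> touched F" "x = r j"
            | "e \<in> ground M" "x = e"
            by (auto simp: full_def)
          then show "x \<in> F"
          proof cases
            case (1 j)
            then have "j < n" by (simp add: touched_def)
            with 1 show ?thesis by (intro closed) (auto simp: touched_insert_l)
          next
            case (2 j)
            then have "j < n" by (simp add: touched_def)
            with 2 show ?thesis by (intro closed) (auto simp: touched_insert_r)
          next
            case 3
            then show ?thesis by (intro closed) auto
          qed
        qed
      qed
      then show "\<exists>S\<subseteq>{..<n}. F = full S" by (intro exI[of _ "touched F"]) (auto simp: touched_def)
    next
      assume "\<exists>S\<subseteq>{..<n}. F = full S"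
      then obtain S where S: "S \<subseteq> {..<n}" "F = full S" by blast
      have "rk_of M F < rk_of M (insert x F)" if x: "x \<in> ground M - F" for x
      proof -
        from x have "x \<in> ground M" by blast
        then obtain j where "j < n" "j \<notin> S" "touched (insert x F) = insert j (touched F)"
        proof (cases rule: edge_cases)
          case (1 j)
          with x S that show ?thesis by (auto simp: touched_insert_l full_def)
        next
          case (2 j)
          with x S that show ?thesis by (auto simp: touched_insert_r full_def)
        next
          case 3
          with x S show ?thesis by (auto simp: full_def)
        qed
        moreover have "joined (insert x F)"
          using True both_mono[of F "insert x F"] by (auto simp: joined_def)
        ultimately show ?thesis
          using rk_ins[of x] x rk_eq[OF sub] True full_props(1)[OF S(1)] S(2)
            finite_subset[OF S(1)] by simp
      qed
      with sub show "F \<in> flats M" by (auto simp: flats_def)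
    qed
    with sub True show ?thesis by blast
  qed
qed

lemma ground_full: "ground M = full {..<n}"
  using ground_minus by (auto simp: full_def)

lemma rk_full: "S \<subseteq> {..<n} \<Longrightarrow> e \<in> ground M \<or> S \<noteq> {} \<Longrightarrow> rk_of M (full S) = Suc (card S)"
  using rk_eq[of "full S"] full_props[of S] by simp

lemma rk_ground: "rk M = Suc n"
proof -
  have "{..<n} \<noteq> {}" using two_le by (simp add: lessThan_empty_iff)
  then show ?thesis unfolding ground_full using rk_full[of "{..<n}"] by simp
qed

section \<open>Sums over the flats above a given flat\<close>

lemma rk_unjoined:
  assumes "F \<subseteq> ground M" "\<not> joined F"
  shows "rk_of M F = card F" "card (touched F) = card F"
  using rk_eq[OF assms(1)] card_edges[OF assms(1)] assms(2) by (auto simp: joined_def)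

definition selections :: "nat set \<Rightarrow> 'e set set" where
  "selections I = {H. H \<subseteq> l ` I \<union> r ` I \<and> both H = {}}"

lemma finite_selections: "finite I \<Longrightarrow> finite (selections I)"
  by (rule finite_subset[of _ "Pow (l ` I \<union> r ` I)"]) (auto simp: selections_def)

lemma selections_insert:
  assumes "insert i I \<subseteq> {..<n}" "i \<notin> I"
  shows "selections (insert i I) =
    selections I \<union> (insert (l i) ` selections I \<union> insert (r i) ` selections I)" (is "_ = ?R")
proof (intro set_eqI iffI)
  have i: "i < n" and I: "\<And>j. j \<in> I \<Longrightarrow> j < n \<and> j \<noteq> i" using assms by auto
  fix H
  assume H: "H \<in> selections (insert i I)"
  then have nb: "\<not> (l i \<in> H \<and> r i \<in> H)" using i by (auto simp: selections_def both_def)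
  have *: "H - {l i, r i} \<in> selections I"
    using H both_mono[of "H - {l i, r i}" H] by (auto simp: selections_def)
  consider "l i \<notin> H" "r i \<notin> H" | "l i \<in> H" "r i \<notin> H" | "l i \<notin> H" "r i \<in> H" using nb by blast
  then show "H \<in> ?R"
  proof cases
    case 1
    then have "H - {l i, r i} = H" by blast
    with * show ?thesis by simp
  next
    case 2
    then have "H = insert (l i) (H - {l i, r i})" by blast
    with * show ?thesis by blast
  next
    case 3
    then have "H = insert (r i) (H - {l i, r i})" by blast
    with * show ?thesis by blast
  qed
next
  have i: "i < n" and I: "\<And>j. j \<in> I \<Longrightarrow> j < n \<and> j \<noteq> i" using assms by auto
  fix H
  assume "H \<in> ?R"
  then consider "H \<in> selections I" | H' where "H = insert (l i) H'" "H' \<in> selections I"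
    | H' where "H = insert (r i) H'" "H' \<in> selections I" by blast
  then show "H \<in> selections (insert i I)"
  proof cases
    case 1
    then show ?thesis by (auto simp: selections_def)
  next
    case 2
    have "r i \<notin> l ` I \<union> r ` I" using i I assms(2) by (auto simp: edge_neq)
    then have "r i \<notin> H'" using 2 by (auto simp: selections_def)
    with 2 i show ?thesis by (auto simp: selections_def both_insert_l)
  next
    case 3
    have "l i \<notin> l ` I \<union> r ` I" using i I assms(2) by (auto simp: edge_neq)
    then have "l i \<notin> H'" using 3 by (auto simp: selections_def)
    with 3 i show ?thesis by (auto simp: selections_def both_insert_r)
  qed
qed

text \<open>Each vertex offers three options: no edge or either one of two. Taking an edge at a new
  vertex shifts \<open>f\<close> by one, hence the generalisation over \<open>f\<close>; the rest is
  Pascal's rule.\<close>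

lemma sum_selections:
  fixes f :: "nat \<Rightarrow> int poly"
  assumes "finite I" "I \<subseteq> {..<n}"
  shows "(\<Sum>H\<in>selections I. f (card H)) = (\<Sum>j\<le>card I. of_nat (card I choose j) * 2 ^ j * f j)"
  using assms
proof (induction I arbitrary: f rule: finite_induct)
  case empty
  have "selections {} = {{}}" by (auto simp: selections_def both_def)
  then show ?case by simp
next
  case (insert i I)
  have i: "i < n" and I: "\<And>j. j \<in> I \<Longrightarrow> j < n \<and> j \<noteq> i" using insert by auto
  have notin: "l i \<notin> H" "r i \<notin> H" "finite H" if "H \<in> selections I" for H
  proof -
    have "H \<subseteq> l ` I \<union> r ` I" using that by (simp add: selections_def)
    moreover from this insert.hyps(1) show "finite H" by (auto intro: finite_subset)
    moreover have "l i \<notin> l ` I \<union> r ` I" "r i \<notin> l ` I \<union> r ` I"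
      using i I insert.hyps(2) by (auto simp: edge_neq)
    ultimately show "l i \<notin> H" "r i \<notin> H" by blast+
  qed
  have inj: "inj_on (insert (l i)) (selections I)" "inj_on (insert (r i)) (selections I)"
    using notin by (auto simp: inj_on_def insert_ident)
  have disj: "insert (l i) ` selections I \<inter> insert (r i) ` selections I = {}"
    "selections I \<inter> (insert (l i) ` selections I \<union> insert (r i) ` selections I) = {}"
    using notin i by (auto simp: edge_neq dest: equalityD1)
  have fin: "finite (selections I)" using insert.hyps(1) by (rule finite_selections)
  have IH: "(\<Sum>H\<in>selections I. f (card H)) = (\<Sum>j\<le>card I. of_nat (card I choose j) * 2 ^ j * f j)"
    for f :: "nat \<Rightarrow> int poly"
    using insert.IH insert.prems by simp
  have "(\<Sum>H\<in>selections (insert i I). f (card H)) =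
      (\<Sum>H\<in>selections I. f (card H)) + 2 * (\<Sum>H\<in>selections I. f (Suc (card H)))"
    unfolding selections_insert[OF insert.prems insert.hyps(2)]
    using fin disj inj notin by (simp add: sum.union_disjoint sum.reindex)
  also have "\<dots> = (\<Sum>j\<le>card I. of_nat (card I choose j) * 2 ^ j * f j) +
      2 * (\<Sum>j\<le>card I. of_nat (card I choose j) * 2 ^ j * f (Suc j))"
    unfolding IH IH[of "\<lambda>k. f (Suc k)"] ..
  also have "(\<Sum>j\<le>card I. of_nat (card I choose j) * 2 ^ j * f j) =
      (\<Sum>j\<le>Suc (card I). of_nat (card I choose j) * 2 ^ j * f j)"
    by simp
  also have "\<dots> = f 0 + (\<Sum>j\<le>card I. of_nat (card I choose Suc j) * 2 ^ Suc j * f (Suc j))"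
    by (subst sum.atMost_Suc_shift) simp
  also have "\<dots> + 2 * (\<Sum>j\<le>card I. of_nat (card I choose j) * 2 ^ j * f (Suc j)) =
      f 0 + (\<Sum>j\<le>card I. of_nat (Suc (card I) choose Suc j) * 2 ^ Suc j * f (Suc j))"
    by (simp add: sum_distrib_left sum.distrib algebra_simps)
  also have "\<dots> = (\<Sum>j\<le>Suc (card I). of_nat (Suc (card I) choose j) * 2 ^ j * f j)"
    by (subst sum.atMost_Suc_shift) simp
  finally show ?case using insert.hyps by simp
qed

text \<open>\<open>G\<close> arises from \<open>F\<close> by a selection on the untouched vertices,
  because a second edge at a touched vertex would connect the hubs.\<close>

lemma sum_above_unjoined:
  fixes g :: "nat \<Rightarrow> int poly"
  assumes F: "F \<subseteq> ground M" "\<not> joined F"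
  shows "(\<Sum>G | F \<subseteq> G \<and> G \<subseteq> ground M \<and> \<not> joined G. g (card G - card F)) =
    (\<Sum>j\<le>n - card F. of_nat ((n - card F) choose j) * 2 ^ j * g j)"
proof -
  let ?I = "{..<n} - touched F"
  have card_I: "card ?I = n - card F"
    using rk_unjoined(2)[OF F] by (subst card_Diff_subset) (auto simp: touched_def)
  have eF: "e \<notin> F" and bF: "both F = {}" using F(2) by (auto simp: joined_def)
  have notin: "H \<inter> F = {}" if "H \<in> selections ?I" for H
  proof -
    have "l i \<notin> F \<and> r i \<notin> F" if "i \<in> ?I" for i using that by (auto simp: touched_def)
    then have "(l ` ?I \<union> r ` ?I) \<inter> F = {}" by auto
    with that show ?thesis unfolding selections_def by blast
  qed
  have "{G. F \<subseteq> G \<and> G \<subseteq> ground M \<and> \<not> joined G} = (\<lambda>H. F \<union> H) ` selections ?I"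
  proof (intro set_eqI iffI)
    fix G assume "G \<in> {G. F \<subseteq> G \<and> G \<subseteq> ground M \<and> \<not> joined G}"
    then have G: "F \<subseteq> G" "G \<subseteq> ground M" "e \<notin> G" "both G = {}" by (auto simp: joined_def)
    have "x \<in> l ` ?I \<union> r ` ?I" if x: "x \<in> G - F" for x
    proof -
      from x G(2) have "x \<in> ground M" by blast
      then show ?thesis
      proof (cases rule: edge_cases)
        case (1 j)
        then have "r j \<notin> F" using x G(1,4) by (auto simp: both_def)
        with 1 x show ?thesis by (auto simp: touched_def)
      next
        case (2 j)
        then have "l j \<notin> F" using x G(1,4) by (auto simp: both_def)
        with 2 x show ?thesis by (auto simp: touched_def)
      next
        case 3
        with x G(3) show ?thesis by blast
      qed
    qed
    moreover have "both (G - F) = {}" using both_mono[of "G - F" G] G(4) by auto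
    ultimately have "G - F \<in> selections ?I" by (auto simp: selections_def)
    moreover have "G = F \<union> (G - F)" using G(1) by blast
    ultimately show "G \<in> (\<lambda>H. F \<union> H) ` selections ?I" by blast
  next
    fix G assume "G \<in> (\<lambda>H. F \<union> H) ` selections ?I"
    then obtain H where H: "G = F \<union> H" "H \<subseteq> l ` ?I \<union> r ` ?I" "both H = {}"
      by (auto simp: selections_def)
    have "e \<notin> H" "H \<subseteq> ground M" using H(2) by (auto simp: edge_neq)
    moreover have "both G = {}"
    proof -
      have "i \<notin> both G" for i
      proof (cases "i \<in> touched F")
        case True
        then have "l i \<notin> H" "r i \<notin> H" using H(2) by (auto simp: touched_def edge_neq)
        moreover have "i \<notin> both F" using bF by blast
        ultimately show ?thesis by (auto simp: both_def H(1))
      next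
        case False
        moreover have "i \<notin> both H" using H(3) by blast
        ultimately show ?thesis by (auto simp: both_def touched_def H(1))
      qed
      then show ?thesis by blast
    qed
    ultimately show "G \<in> {G. F \<subseteq> G \<and> G \<subseteq> ground M \<and> \<not> joined G}"
      using F(1) eF H(1) by (auto simp: joined_def)
  qed
  moreover have "inj_on (\<lambda>H. F \<union> H) (selections ?I)"
    using notin by (intro inj_onI) blast
  moreover have "card (F \<union> H) - card F = card H" if H: "H \<in> selections ?I" for H
  proof -
    have "finite F" using F(1) finite_ground finite_subset by blast
    moreover have "finite H"
      using H by (auto simp: selections_def intro: finite_subset[of _ "l ` ?I \<union> r ` ?I"])
    moreover have "F \<inter> H = {}" using notin[OF H] by blast
    ultimately show ?thesis by (simp add: card_Un_disjoint)
  qed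
  ultimately have "(\<Sum>G | F \<subseteq> G \<and> G \<subseteq> ground M \<and> \<not> joined G. g (card G - card F)) =
      (\<Sum>H\<in>selections ?I. g (card H))"
    by (simp add: sum.reindex)
  also have "\<dots> = (\<Sum>j\<le>n - card F. of_nat ((n - card F) choose j) * 2 ^ j * g j)"
    using sum_selections[of ?I g] card_I by simp
  finally show ?thesis .
qed

lemma sum_supersets:
  assumes "K \<subseteq> {..<n}"
  shows "(\<Sum>S | K \<subseteq> S \<and> S \<subseteq> {..<n}. monom 1 (card S - card K)) =
    ([:1, 1:] ^ (n - card K) :: int poly)"
proof -
  have fin: "finite K" using assms finite_subset by blast
  have "{S. K \<subseteq> S \<and> S \<subseteq> {..<n}} = (\<lambda>J. K \<union> J) ` Pow ({..<n} - K)"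
  proof (intro set_eqI iffI)
    fix S assume "S \<in> {S. K \<subseteq> S \<and> S \<subseteq> {..<n}}"
    then have "S = K \<union> (S - K)" "S - K \<in> Pow ({..<n} - K)" by auto
    then show "S \<in> (\<lambda>J. K \<union> J) ` Pow ({..<n} - K)" by blast
  qed (use assms in auto)
  moreover have "inj_on (\<lambda>J. K \<union> J) (Pow ({..<n} - K))" by (intro inj_onI) auto
  moreover have "card (K \<union> J) - card K = card J" if "J \<in> Pow ({..<n} - K)" for J
  proof -
    have "finite J" using that finite_subset[of J "{..<n} - K"] by auto
    moreover have "K \<inter> J = {}" using that by blast
    ultimately show ?thesis using fin by (simp add: card_Un_disjoint)
  qed
  ultimately have "(\<Sum>S | K \<subseteq> S \<and> S \<subseteq> {..<n}. monom 1 (card S - card K)) =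
      (\<Sum>J\<in>Pow ({..<n} - K). monom 1 (card J) :: int poly)"
    by (simp add: sum.reindex)
  also have "\<dots> = [:1, 1:] ^ (n - card K)"
    using assms fin by (subst sum_Pow_card_X) (auto simp: card_Diff_subset)
  finally show ?thesis .
qed

lemma inj_on_full: "inj_on full (Pow {..<n})"
  by (rule inj_onI) (metis PowD full_props(1))

lemma joined_flats_above:
  "{G. G \<in> flats M \<and> joined G \<and> F \<subseteq> G} =
    full ` {S. S \<subseteq> {..<n} \<and> (e \<in> ground M \<or> S \<noteq> {}) \<and> F \<subseteq> full S}"
proof (intro set_eqI iffI)
  fix G assume "G \<in> {G. G \<in> flats M \<and> joined G \<and> F \<subseteq> G}"
  then obtain S where "S \<subseteq> {..<n}" "G = full S" "joined (full S)" "F \<subseteq> full S"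
    by (auto simp: flat_iff)
  then show "G \<in> full ` {S. S \<subseteq> {..<n} \<and> (e \<in> ground M \<or> S \<noteq> {}) \<and> F \<subseteq> full S}"
    using full_props(5)[of S] by blast
next
  fix G assume "G \<in> full ` {S. S \<subseteq> {..<n} \<and> (e \<in> ground M \<or> S \<noteq> {}) \<and> F \<subseteq> full S}"
  then obtain S where S: "S \<subseteq> {..<n}" "G = full S" "e \<in> ground M \<or> S \<noteq> {}" "F \<subseteq> full S"
    by blast
  then have "joined G" "G \<subseteq> ground M" using full_props(4,5)[of S] by auto
  with S show "G \<in> {G. G \<in> flats M \<and> joined G \<and> F \<subseteq> G}"
    using flat_iff by blast
qed

text \<open>The guess for the contractions by flats. Contracting a nonempty unjoined flat turns the
  second edge at a contracted vertex into an edge between the hubs, so the two graphs differ only at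
  \<open>F = {}\<close>.\<close>

definition flat_kl :: "'e set \<Rightarrow> int poly" where
  "flat_kl F = (if joined F then 1
     else if F = {} \<and> e \<notin> ground M then fan_kl n + monom 1 1 else fan_kl (n - card F))"

lemma sum_above:
  assumes "F \<in> flats M" "\<not> joined F"
  shows "(\<Sum>G | G \<in> flats M \<and> F \<subseteq> G. monom 1 (rk_of M G - rk_of M F) * flat_kl G) =
    fan_Z (n - card F)"
proof -
  let ?f = "\<lambda>G. monom 1 (rk_of M G - rk_of M F) * flat_kl G"
  let ?m = "n - card F"
  have sub: "F \<subseteq> ground M" using assms flat_subset_ground by blast
  have rkF: "rk_of M F = card F" "card (touched F) = card F"
    using rk_unjoined[OF sub assms(2)] by auto
  have K: "touched F \<subseteq> {..<n}" by (auto simp: touched_def)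
  \<comment> \<open>The surplus of \<open>flat_kl {}\<close> in the graph without the hub edge. It
    occurs with opposite signs in the sums over unjoined and over joined flats, since
    \<open>full {}\<close> is missing from the latter.\<close>
  define d :: "int poly" where "d = (if F = {} \<and> e \<notin> ground M then monom 1 1 else 0)"
  let ?U = "{G. F \<subseteq> G \<and> G \<subseteq> ground M \<and> \<not> joined G}"
  let ?g = "\<lambda>j. monom 1 j * fan_kl (?m - j)"
  have finU: "finite ?U" by (rule finite_subset[of _ "Pow (ground M)"]) (auto simp: finite_ground)
  have "sum ?f ?U = (\<Sum>G\<in>?U. ?g (card G - card F) + (if G = F then d else 0))"
  proof (rule sum.cong)
    fix G assume G: "G \<in> ?U"
    have "rk_of M G = card G" using G rk_unjoined by blast
    then have rkG: "rk_of M G - rk_of M F = card G - card F" using rkF by simp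
    have "card F \<le> card G"
      using G finite_ground by (auto intro: card_mono finite_subset)
    then have m: "?m - (card G - card F) = n - card G" by simp
    show "?f G = ?g (card G - card F) + (if G = F then d else 0)"
    proof (cases "G = F")
      case True
      with assms(2) show ?thesis by (simp add: flat_kl_def d_def)
    next
      case False
      with G have "G \<noteq> {}" by blast
      with False G show ?thesis unfolding rkG m by (simp add: flat_kl_def)
    qed
  qed simp
  also have "\<dots> = (\<Sum>G\<in>?U. ?g (card G - card F)) + d"
    using finU sub assms(2) by (simp add: sum.distrib sum.delta')
  also have "(\<Sum>G\<in>?U. ?g (card G - card F)) =
      (\<Sum>j\<le>?m. of_nat (?m choose j) * 2 ^ j * ?g j)"
    by (rule sum_above_unjoined[OF sub assms(2)])
  finally have U: "sum ?f ?U = (\<Sum>j\<le>?m. of_nat (?m choose j) * 2 ^ j * ?g j) + d" .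
  let ?A = "{S. S \<subseteq> {..<n} \<and> (e \<in> ground M \<or> S \<noteq> {}) \<and> F \<subseteq> full S}"
  let ?B = "{S. touched F \<subseteq> S \<and> S \<subseteq> {..<n}}"
  have finB: "finite ?B" by (rule finite_subset[of _ "Pow {..<n}"]) auto
  let ?x = "\<lambda>S. monom 1 (Suc (card S - card (touched F))) :: int poly"
  have "sum ?f {G. G \<in> flats M \<and> joined G \<and> F \<subseteq> G} = (\<Sum>S\<in>?A. ?f (full S))"
    unfolding joined_flats_above
    by (subst sum.reindex) (auto intro: inj_on_subset[OF inj_on_full])
  also have "\<dots> = sum ?x ?A"
  proof (rule sum.cong)
    fix S assume S: "S \<in> ?A"
    then have "touched F \<subseteq> S" using subset_full_iff[OF sub] by auto
    then have "card (touched F) \<le> card S"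
      using S by (auto intro!: card_mono finite_subset[of S "{..<n}"])
    then show "?f (full S) = ?x S"
      using S rkF full_props(5)[of S] rk_full[of S] by (simp add: flat_kl_def Suc_diff_le)
  qed simp
  also have "\<dots> = sum ?x ?B - d"
  proof (cases "F = {} \<and> e \<notin> ground M")
    case True
    then have "?B = insert {} ?A" using subset_full_iff[OF sub] by (auto simp: touched_def)
    moreover have "{} \<notin> ?A" using True by simp
    ultimately have "sum ?x ?B = ?x {} + sum ?x ?A"
      using finB by simp
    with True show ?thesis by (simp add: d_def)
  next
    case False
    have "e \<in> ground M \<or> S \<noteq> {}" if "S \<in> ?B" for S
    proof (rule ccontr)
      assume "\<not> (e \<in> ground M \<or> S \<noteq> {})"
      then have "touched F = {}" using that by auto
      then have "card F = 0" using rkF by simp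
      then have "F = {}" using sub finite_ground finite_subset by fastforce
      with False \<open>\<not> (e \<in> ground M \<or> S \<noteq> {})\<close> show False by simp
    qed
    then have "?A = ?B" using subset_full_iff[OF sub] by auto
    with False show ?thesis by (simp add: d_def)
  qed
  also have "sum ?x ?B = monom 1 1 * (\<Sum>S\<in>?B. monom 1 (card S - card (touched F)))"
    by (simp add: sum_distrib_left mult_monom)
  also have "\<dots> = monom 1 1 * [:1, 1:] ^ ?m"
    using sum_supersets[OF K] rkF by simp
  finally have J: "sum ?f {G. G \<in> flats M \<and> joined G \<and> F \<subseteq> G} =
      monom 1 1 * [:1, 1:] ^ ?m - d" .
  have "{G. G \<in> flats M \<and> F \<subseteq> G} = ?U \<union> {G. G \<in> flats M \<and> joined G \<and> F \<subseteq> G}"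
    by (auto simp: flat_iff)
  then have "sum ?f {G. G \<in> flats M \<and> F \<subseteq> G} =
      sum ?f ?U + sum ?f {G. G \<in> flats M \<and> joined G \<and> F \<subseteq> G}"
    using finU finite_flats by (simp add: sum.union_disjoint disjoint_iff)
  then show ?thesis
    unfolding U J fan_Z_def by simp
qed

text \<open>The flats above \<open>full S\<close> form a Boolean lattice, and \<open>flat_kl\<close>
  is 1 on them.\<close>

lemma sum_above_joined:
  assumes "S \<subseteq> {..<n}" "e \<in> ground M \<or> S \<noteq> {}"
  shows "(\<Sum>G | G \<in> flats M \<and> full S \<subseteq> G. monom 1 (rk_of M G - rk_of M (full S)) * flat_kl G) =
    [:1, 1:] ^ (n - card S)"
proof -
  have "joined G" if "full S \<subseteq> G" for G
    using full_props(5)[OF assms(1)] both_mono[OF that] that assms(2) by (auto simp: joined_def)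
  then have "{G. G \<in> flats M \<and> full S \<subseteq> G} = {G. G \<in> flats M \<and> joined G \<and> full S \<subseteq> G}"
    by blast
  also have "\<dots> = full ` {S'. S \<subseteq> S' \<and> S' \<subseteq> {..<n}}"
    unfolding joined_flats_above using assms full_subset_iff
    by (intro arg_cong[where f = "image full"]) auto
  finally have eq: "{G. G \<in> flats M \<and> full S \<subseteq> G} = full ` {S'. S \<subseteq> S' \<and> S' \<subseteq> {..<n}}" .
  have "(\<Sum>G | G \<in> flats M \<and> full S \<subseteq> G. monom 1 (rk_of M G - rk_of M (full S)) * flat_kl G) =
      (\<Sum>S' | S \<subseteq> S' \<and> S' \<subseteq> {..<n}. monom 1 (card S' - card S))"
    unfolding eq
  proof (subst sum.reindex)
    show "inj_on full {S'. S \<subseteq> S' \<and> S' \<subseteq> {..<n}}"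
      by (rule inj_on_subset[OF inj_on_full]) auto
    show "(\<Sum>S' | S \<subseteq> S' \<and> S' \<subseteq> {..<n}.
        ((\<lambda>G. monom 1 (rk_of M G - rk_of M (full S)) * flat_kl G) \<circ> full) S') =
        (\<Sum>S' | S \<subseteq> S' \<and> S' \<subseteq> {..<n}. monom 1 (card S' - card S))"
    proof (rule sum.cong)
      fix S' assume S': "S' \<in> {S'. S \<subseteq> S' \<and> S' \<subseteq> {..<n}}"
      then have "e \<in> ground M \<or> S' \<noteq> {}" using assms by auto
      with S' assms show "((\<lambda>G. monom 1 (rk_of M G - rk_of M (full S)) * flat_kl G) \<circ> full) S' =
          monom 1 (card S' - card S)"
        using full_props(5)[of S'] by (simp add: rk_full flat_kl_def)
    qed simp
  qed
  with sum_supersets[OF assms(1)] show ?thesis by simp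
qed

theorem Z_poly_eq: "Z_poly M = fan_Z n"
proof -
  have unjoined_empty: "\<not> joined {}" by (simp add: joined_def both_def)
  have joined_flat: "\<exists>S\<subseteq>{..<n}. F = full S \<and> (e \<in> ground M \<or> S \<noteq> {})" if "F \<in> flats M" "joined F" for F
    using that full_props(5) by (auto simp: flat_iff)
  have "Z_poly M = (\<Sum>F\<in>flats M. monom 1 (rk_of M F) * flat_kl F)"
  proof (rule Z_poly_eqI)
    show "flat_kl (ground M) = 1"
      using full_props(5)[of "{..<n}"] two_le
      by (auto simp: flat_kl_def ground_full lessThan_empty_iff)
    fix F assume F: "F \<in> flats M" "F \<noteq> ground M"
    show "2 * degree (flat_kl F) < rk M - rk_of M F"
    proof (cases "joined F")
      case True
      then show ?thesis
        using rk_flat_less[OF F(1), of "ground M"] flat_subset_ground[OF F(1)] F(2)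
        by (simp add: flat_kl_def psubset_eq)
    next
      case False
      have sub: "F \<subseteq> ground M" using F flat_subset_ground by blast
      have "card (touched F) \<le> card {..<n}" by (rule card_mono) (auto simp: touched_def)
      then have "card F \<le> n" using rk_unjoined[OF sub False] by simp
      moreover have "2 * degree (flat_kl F) < Suc n - card F"
      proof (cases "F = {} \<and> e \<notin> ground M")
        case True
        \<comment> \<open>Here \<open>2 \<le> n\<close> matters: the additional \<open>x\<close> has
          to stay within the degree bound.\<close>
        have "degree (fan_kl n + monom 1 1) \<le> n div 2"
          using degree_fan_kl[of n] two_le by (intro degree_add_le) (auto simp: degree_monom_eq)
        then have "2 * degree (fan_kl n + monom 1 1) < Suc n - card F" using True by simp
        then show ?thesis using True False unfolding flat_kl_def by simp
      next
        case F': False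
        with False degree_fan_kl[of "n - card F"] \<open>card F \<le> n\<close> show ?thesis
          unfolding flat_kl_def by auto
      qed
      ultimately show ?thesis using rk_unjoined[OF sub False] rk_ground by simp
    qed
    let ?Z = "\<Sum>G | G \<in> flats M \<and> F \<subseteq> G. monom 1 (rk_of M G - rk_of M F) * flat_kl G"
    show "rev_poly (rk M - rk_of M F) ?Z = ?Z"
    proof (cases "joined F")
      case True
      then obtain S where S: "S \<subseteq> {..<n}" "F = full S" "e \<in> ground M \<or> S \<noteq> {}"
        using joined_flat F(1) by blast
      show ?thesis
        unfolding S(2) sum_above_joined[OF S(1,3)]
        using palindromic_one_plus_X_power[of "n - card S"] by (simp add: rk_full S rk_ground)
    next
      case False
      have sub: "F \<subseteq> ground M" using F flat_subset_ground by blast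
      have "card (touched F) \<le> card {..<n}" by (rule card_mono) (auto simp: touched_def)
      then have "card F \<le> n" using rk_unjoined[OF sub False] by simp
      then have "rk M - rk_of M F = Suc (n - card F)"
        using rk_unjoined[OF sub False] rk_ground by simp
      then show ?thesis
        unfolding sum_above[OF F(1) False] by (simp add: degree_palindromic_fan_Z)
    qed
  qed
  also have "\<dots> = fan_Z n"
    using sum_above[OF empty_flat unjoined_empty] by simp
  finally show ?thesis .
qed

end

section \<open>Graphic matroids\<close>

locale fan_graph =
  fixes a b :: 'v and c :: "nat \<Rightarrow> 'v" and n :: nat
  assumes a_neq_b: "a \<noteq> b"
    and a_neq_c: "i < n \<Longrightarrow> c i \<noteq> a"
    and b_neq_c: "i < n \<Longrightarrow> c i \<noteq> b"
    and c_eq_iff: "i < n \<Longrightarrow> j < n \<Longrightarrow> c i = c j \<longleftrightarrow> i = j"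
begin

lemmas vertex_neq = a_neq_b a_neq_b[symmetric] a_neq_c a_neq_c[THEN not_sym]
  b_neq_c b_neq_c[THEN not_sym] c_eq_iff

definition full_edges :: "'v set set" where
  "full_edges = insert {a, b} ((\<lambda>i. {a, c i}) ` {..<n} \<union> (\<lambda>i. {b, c i}) ` {..<n})"

definition joined_to_both :: "'v set set \<Rightarrow> nat set" where
  "joined_to_both A = {i. i < n \<and> {a, c i} \<in> A \<and> {b, c i} \<in> A}"

lemma edge_at_c:
  assumes "A \<subseteq> full_edges" "i < n" "{c i, u} \<in> A"
  shows "u = a \<or> u = b"
proof -
  have "{c i, u} \<in> full_edges" using assms by blast
  then show ?thesis
    using assms(2) by (auto simp: full_edges_def doubleton_eq_iff vertex_neq)
qed

lemma has_cycleI_triangle: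
  assumes "{a, b} \<in> A" "i \<in> joined_to_both A"
  shows "has_cycle A"
  unfolding has_cycle_def
proof (rule exI[of _ "[a, b, c i]"], intro conjI allI impI)
  show "distinct [a, b, c i]" using assms(2) by (simp add: joined_to_both_def vertex_neq)
  have edges: "{b, c i} \<in> A" "{c i, a} \<in> A"
    using assms(2) by (simp_all add: joined_to_both_def insert_commute)
  fix p assume "p < length [a, b, c i]"
  then consider "p = 0" | "p = 1" | "p = 2" by fastforce
  then show "{[a, b, c i] ! p, [a, b, c i] ! (Suc p mod length [a, b, c i])} \<in> A"
    using assms(1) edges by cases simp_all
qed simp

lemma has_cycleI_square:
  assumes "i \<in> joined_to_both A" "j \<in> joined_to_both A" "i \<noteq> j"
  shows "has_cycle A"
  unfolding has_cycle_def
proof (rule exI[of _ "[a, c i, b, c j]"], intro conjI allI impI)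
  show "distinct [a, c i, b, c j]" using assms by (simp add: joined_to_both_def vertex_neq)
  have edges: "{a, c i} \<in> A" "{c i, b} \<in> A" "{b, c j} \<in> A" "{c j, a} \<in> A"
    using assms by (simp_all add: joined_to_both_def insert_commute)
  fix p assume "p < length [a, c i, b, c j]"
  then consider "p = 0" | "p = 1" | "p = 2" | "p = 3" by fastforce
  then show "{[a, c i, b, c j] ! p, [a, c i, b, c j] ! (Suc p mod length [a, c i, b, c j])} \<in> A"
    using edges by cases simp_all
qed simp

text \<open>On a cycle the two neighbours of a spoke vertex are distinct and both are hubs, so the
  vertex lies in \<open>joined_to_both A\<close>. The hubs account for at most two more vertices;
  hence either two spoke vertices occur or the cycle is a triangle and uses the hub edge.\<close>

lemma has_cycleD:
  assumes sub: "A \<subseteq> full_edges" and cycle: "has_cycle A"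
  shows "2 \<le> card (joined_to_both A) + (if {a, b} \<in> A then 1 else 0)"
proof -
  from cycle obtain vs where len: "3 \<le> length vs" and dist: "distinct vs"
    and edges: "\<And>p. p < length vs \<Longrightarrow> {vs ! p, vs ! (Suc p mod length vs)} \<in> A"
    by (auto simp: has_cycle_def)
  define k where "k = length vs"
  define next_pos where "next_pos p = (if Suc p = k then 0 else Suc p)" for p
  define prev_pos where "prev_pos p = (if p = 0 then k - 1 else p - 1)" for p
  have k: "3 \<le> k" using len by (simp add: k_def)
  have next_edge: "{vs ! p, vs ! next_pos p} \<in> A" if "p < k" for p
    using edges[of p] that by (auto simp: next_pos_def k_def split: if_splits)
  have prev_edge: "{vs ! p, vs ! prev_pos p} \<in> A" if "p < k" for p
  proof -
    have "prev_pos p < k" "next_pos (prev_pos p) = p"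
      using that k by (auto simp: prev_pos_def next_pos_def)
    with next_edge[of "prev_pos p"] show ?thesis by (simp add: insert_commute)
  qed
  have nbrs: "i \<in> joined_to_both A \<and> {vs ! next_pos p, vs ! prev_pos p} = {a, b}"
    if p: "p < k" "i < n" "vs ! p = c i" for p i
  proof -
    have "next_pos p < k" "prev_pos p < k" "next_pos p \<noteq> prev_pos p"
      using p k by (auto simp: prev_pos_def next_pos_def)
    then have "vs ! next_pos p \<noteq> vs ! prev_pos p"
      using dist by (simp add: nth_eq_iff_index_eq k_def)
    moreover have "vs ! next_pos p = a \<or> vs ! next_pos p = b" "vs ! prev_pos p = a \<or> vs ! prev_pos p = b"
      using edge_at_c[OF sub p(2)] next_edge[OF p(1)] prev_edge[OF p(1)] p(3) by auto
    ultimately show ?thesis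
      using next_edge[OF p(1)] prev_edge[OF p(1)] p(2,3)
      by (auto simp: joined_to_both_def insert_commute)
  qed
  define I where "I = {i. i < n \<and> c i \<in> set vs}"
  have I: "I \<subseteq> joined_to_both A"
    using nbrs by (auto simp: I_def in_set_conv_nth k_def)
  have fin: "finite (joined_to_both A)" "finite I" by (auto simp: joined_to_both_def I_def)
  have "vs ! p \<in> {a, b} \<union> c ` I" if "p < k" for p
  proof -
    have "{vs ! p, vs ! next_pos p} \<in> full_edges" using next_edge[OF that] sub by blast
    then have "vs ! p \<in> {a, b} \<union> c ` {..<n}"
      unfolding full_edges_def by (auto simp: doubleton_eq_iff)
    moreover have "vs ! p \<in> set vs" using that by (simp add: k_def)
    ultimately show ?thesis by (auto simp: I_def)
  qed
  then have "set vs \<subseteq> {a, b} \<union> c ` I" by (metis in_set_conv_nth k_def subsetI)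
  then have "card (set vs) \<le> card ({a, b} \<union> c ` I)" using fin by (intro card_mono) auto
  also have "\<dots> \<le> card {a, b} + card (c ` I)" by (rule card_Un_le)
  also have "\<dots> \<le> 2 + card I"
    using card_image_le[OF fin(2), of c] a_neq_b by simp
  finally have k_le: "k \<le> 2 + card I" using dist by (simp add: distinct_card k_def)
  have card_I: "card I \<le> card (joined_to_both A)" using fin I by (intro card_mono)
  show ?thesis
  proof (cases "2 \<le> card I")
    case True
    with card_I show ?thesis by simp
  next
    case False
    with k k_le have "k = 3" "card I = 1" by auto
    from \<open>card I = 1\<close> obtain i where "i \<in> I" by fastforce
    then obtain p where p: "p < k" "i < n" "vs ! p = c i"
      by (auto simp: I_def in_set_conv_nth k_def)
    have "next_pos p < k" "next_pos (next_pos p) = prev_pos p"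
      using p(1) \<open>k = 3\<close> by (auto simp: next_pos_def prev_pos_def)
    then have "{vs ! next_pos p, vs ! prev_pos p} \<in> A" using next_edge[of "next_pos p"] by metis
    then have "{a, b} \<in> A" using nbrs[OF p] by metis
    with card_I \<open>card I = 1\<close> show ?thesis by simp
  qed
qed

lemma acyclic_iff:
  assumes "A \<subseteq> full_edges"
  shows "\<not> has_cycle A \<longleftrightarrow> card (joined_to_both A) + (if {a, b} \<in> A then 1 else 0) \<le> 1"
proof
  assume acyclic: "\<not> has_cycle A"
  show "card (joined_to_both A) + (if {a, b} \<in> A then 1 else 0) \<le> 1"
  proof (cases "{a, b} \<in> A")
    case True
    with acyclic have "joined_to_both A = {}" using has_cycleI_triangle by blast
    then show ?thesis by simp
  next
    case False
    have "card (joined_to_both A) \<le> 1"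
      using acyclic has_cycleI_square by (intro card_le_Suc0_iff_eq[THEN iffD2, simplified One_nat_def[symmetric]])
        (auto simp: joined_to_both_def)
    with False show ?thesis by simp
  qed
next
  assume "card (joined_to_both A) + (if {a, b} \<in> A then 1 else 0) \<le> 1"
  with has_cycleD[OF assms] show "\<not> has_cycle A" by auto
qed

text \<open>Only the edges other than \<open>{a, b}\<close> are prescribed, so that both graphs are
  covered.\<close>

lemma Z_poly_graphic_matroid:
  assumes "2 \<le> n" and E: "E - {{a, b}} = (\<lambda>i. {a, c i}) ` {..<n} \<union> (\<lambda>i. {b, c i}) ` {..<n}"
  shows "Z_poly (graphic_matroid E) = fan_Z n"
proof -
  have "E \<subseteq> full_edges" using E unfolding full_edges_def by blast
  have "fan_matroid (\<lambda>i. {a, c i}) (\<lambda>i. {b, c i}) {a, b} n (graphic_matroid E)"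
  proof (rule fan_matroid.intro)
    show "indep (graphic_matroid E) A \<longleftrightarrow> A \<subseteq> ground (graphic_matroid E) \<and>
      card {i. i < n \<and> {a, c i} \<in> A \<and> {b, c i} \<in> A} + (if {a, b} \<in> A then 1 else 0) \<le> 1" for A
    proof (cases "A \<subseteq> E")
      case True
      with \<open>E \<subseteq> full_edges\<close> have "A \<subseteq> full_edges" by blast
      with True acyclic_iff[of A] show ?thesis
        by (simp add: graphic_matroid_def joined_to_both_def)
    qed (simp add: graphic_matroid_def)
    show "ground (graphic_matroid E) - {{a, b}} =
        (\<lambda>i. {a, c i}) ` {..<n} \<union> (\<lambda>i. {b, c i}) ` {..<n}"
      using E by (simp add: graphic_matroid_def)
    show "2 \<le> n" by (rule assms(1))
  qed (auto simp: doubleton_eq_iff vertex_neq)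
  then show ?thesis by (rule fan_matroid.Z_poly_eq)
qed

end

lemma edge_T_iff:
  "X \<in> T n \<longleftrightarrow> X = {(0, 0), (1, 0)} \<or> (\<exists>i<n. X = {(0, 0), (2, i)} \<or> X = {(1, 0), (2, i)})"
proof
  have vertex: "i = 0 \<and> x = 0 \<or> i = 1 \<and> x = 0 \<or> i = 2 \<and> x < n"
    if "i < length [1, 1, n]" "x < [1, 1, n] ! i" for i x
  proof -
    have "i = 0 \<or> i = 1 \<or> i = 2" using that(1) by auto
    with that(2) show ?thesis by auto
  qed
  assume "X \<in> T n"
  then obtain i x j y where X: "X = {(i, x), (j, y)}" "i \<noteq> j"
    and ij: "i < length [1, 1, n]" "x < [1, 1, n] ! i" "j < length [1, 1, n]" "y < [1, 1, n] ! j"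
    unfolding T_def complete_multipartite_def by blast
  from vertex[OF ij(1,2)] vertex[OF ij(3,4)] X
  show "X = {(0, 0), (1, 0)} \<or> (\<exists>i<n. X = {(0, 0), (2, i)} \<or> X = {(1, 0), (2, i)})"
    by (elim disjE) (auto simp: insert_commute)
next
  have edge: "{(i, x), (j, y)} \<in> T n"
    if "i < 3" "x < [1, 1, n] ! i" "j < 3" "y < [1, 1, n] ! j" "i \<noteq> j" for i x j y
    unfolding T_def complete_multipartite_def mem_Collect_eq
    by (rule exI[of _ i], rule exI[of _ x], rule exI[of _ j], rule exI[of _ y]) (use that in simp)
  assume "X = {(0, 0), (1, 0)} \<or> (\<exists>i<n. X = {(0, 0), (2, i)} \<or> X = {(1, 0), (2, i)})"
  then show "X \<in> T n"
    using edge[of 0 0 1 0] edge[of 0 0 2] edge[of 1 0 2] by auto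
qed

lemma edge_K2n_iff:
  "X \<in> K2n n \<longleftrightarrow> (\<exists>i<n. X = {(0, 0), (1, i)} \<or> X = {(0, 1), (1, i)})"
proof
  have vertex: "i = 0 \<and> (x = 0 \<or> x = 1) \<or> i = 1 \<and> x < n"
    if "i < length [2, n]" "x < [2, n] ! i" for i x
  proof -
    have "i = 0 \<or> i = 1" using that(1) by auto
    with that(2) show ?thesis by auto
  qed
  assume "X \<in> K2n n"
  then obtain i x j y where X: "X = {(i, x), (j, y)}" "i \<noteq> j"
    and ij: "i < length [2, n]" "x < [2, n] ! i" "j < length [2, n]" "y < [2, n] ! j"
    unfolding K2n_def complete_multipartite_def by blast
  from vertex[OF ij(1,2)] vertex[OF ij(3,4)] X
  show "\<exists>i<n. X = {(0, 0), (1, i)} \<or> X = {(0, 1), (1, i)}"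
    by (elim disjE conjE) (auto simp: insert_commute)
next
  have edge: "{(i, x), (j, y)} \<in> K2n n"
    if "i < 2" "x < [2, n] ! i" "j < 2" "y < [2, n] ! j" "i \<noteq> j" for i x j y
    unfolding K2n_def complete_multipartite_def mem_Collect_eq
    by (rule exI[of _ i], rule exI[of _ x], rule exI[of _ j], rule exI[of _ y]) (use that in simp)
  assume "\<exists>i<n. X = {(0, 0), (1, i)} \<or> X = {(0, 1), (1, i)}"
  then show "X \<in> K2n n"
    using edge[of 0 0 1] edge[of 0 1 1] by auto
qed

lemma Z_poly_T:
  assumes "2 \<le> n"
  shows "Z_poly (graphic_matroid (T n)) = fan_Z n"
proof -
  let ?R = "(\<lambda>i. {(0 :: nat, 0 :: nat), (2, i)}) ` {..<n} \<union> (\<lambda>i. {(1, 0), (2, i)}) ` {..<n}"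
  interpret fan_graph "(0, 0)" "(1, 0)" "\<lambda>i. (2 :: nat, i)" n
    by standard auto
  have "T n = insert {(0, 0), (1, 0)} ?R"
    by (simp only: set_eq_iff edge_T_iff insert_iff Un_iff image_iff Bex_def lessThan_iff
        ex_disj_distrib conj_disj_distribL simp_thms)
  moreover have "{(0, 0), (1, 0)} \<notin> ?R"
    by (simp add: image_iff doubleton_eq_iff)
  ultimately have "T n - {{(0, 0), (1, 0)}} = ?R" by simp
  then show ?thesis by (rule Z_poly_graphic_matroid[OF assms])
qed

lemma Z_poly_K2n:
  assumes "2 \<le> n"
  shows "Z_poly (graphic_matroid (K2n n)) = fan_Z n"
proof -
  let ?R = "(\<lambda>i. {(0 :: nat, 0 :: nat), (1, i)}) ` {..<n} \<union> (\<lambda>i. {(0, 1), (1, i)}) ` {..<n}"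
  interpret fan_graph "(0, 0)" "(0, 1)" "\<lambda>i. (1 :: nat, i)" n
    by standard auto
  have "K2n n = ?R"
    by (simp only: set_eq_iff edge_K2n_iff insert_iff Un_iff image_iff Bex_def lessThan_iff
        ex_disj_distrib conj_disj_distribL simp_thms)
  moreover have "{(0, 0), (0, 1)} \<notin> ?R"
    by (simp add: image_iff doubleton_eq_iff)
  ultimately have "K2n n - {{(0, 0), (0, 1)}} = ?R" by simp
  then show ?thesis by (rule Z_poly_graphic_matroid[OF assms])
qed

section \<open>A partial sum of a Gegenbauer-type sequence\<close>

text \<open>Solves the adjoint of the recurrence for \<open>V\<close> with right-hand side 1. The homogeneous adjoint
  equation is the differential equation of \<open>D powr (-3/2)\<close> for the moments, whence the integral.\<close>

lemma ex_summation_multiplier: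
  fixes \<rho> :: real
  assumes "1 < \<rho>"
  obtains \<mu> :: "nat \<Rightarrow> real" where
    "\<mu> 1 = (1 + sqrt (4 * \<rho> - 3)) / (4 * (\<rho> - 1))"
    and "\<And>k. real (Suc k) * \<mu> k - (4 * real k + 2) * \<mu> (Suc k) + 4 * real k * \<rho> * \<mu> (k + 2) = 1"
    and "\<And>k. \<mu> k \<ge> 1 / (real (Suc k) * (4 * \<rho> - 3))"
proof -
  \<comment> \<open>The radicand of \<open>1 - 2 * Y\<close> in the scaled variable, with
    \<open>\<rho> = 1 - w\<close>.\<close>
  define D where "D t = 1 - 4 * t + 4 * \<rho> * t\<^sup>2" for t
  define c where "c = 4 * \<rho> - 3"
  define \<phi> where "\<phi> t = 1 / (D t * sqrt (D t))" for t
  \<comment> \<open>The factor \<open>sqrt c = sqrt (D 1)\<close> normalises the boundary term at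
    \<open>t = 1\<close>, so that the right-hand side of the recurrence becomes 1.\<close>
  define \<mu> where "\<mu> k = sqrt c * integral {0..1} (\<lambda>t. t ^ k * \<phi> t)" for k :: nat
  have c: "c > 1" using assms by (simp add: c_def)
  have D_pos: "D t > 0" for t
  proof -
    have D: "D t = (1 - 2 * t)\<^sup>2 + 4 * (\<rho> - 1) * t\<^sup>2"
      by (simp add: D_def power2_eq_square algebra_simps)
    show ?thesis
    proof (cases "t = 0")
      case False
      then have "4 * (\<rho> - 1) * t\<^sup>2 > 0" using assms by simp
      then show ?thesis unfolding D by (simp add: add_nonneg_pos)
    qed (simp add: D_def)
  qed
  have D_le: "D t \<le> c" if "t \<in> {0..1}" for t
  proof -
    have "c - D t = 4 * (1 - t) * (\<rho> * (1 + t) - 1)"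
      by (simp add: D_def c_def power2_eq_square algebra_simps)
    moreover have "1 * 1 \<le> \<rho> * (1 + t)" using assms that by (intro mult_mono) auto
    ultimately have "c - D t \<ge> 0" using that by simp
    then show ?thesis by simp
  qed
  have D_deriv: "(D has_real_derivative (8 * \<rho> * t - 4)) (at t)" for t
    unfolding D_def by (auto intro!: derivative_eq_intros)
  have cont: "continuous_on {0..1} (\<lambda>t. t ^ k * \<phi> t)" for k :: nat
  proof -
    have "continuous_on {0..1} D" unfolding D_def by (intro continuous_intros)
    then show ?thesis
      unfolding \<phi>_def using D_pos by (intro continuous_intros) (auto simp: less_imp_neq[symmetric])
  qed
  have int: "(\<lambda>t. t ^ k * \<phi> t) integrable_on {0..1}" for k :: nat
    by (rule integrable_continuous_real[OF cont])
  have quotient_deriv: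
    "((\<lambda>t. f t / sqrt (D t)) has_real_derivative (f' * D t - f t * (4 * \<rho> * t - 2)) * \<phi> t) (at t)"
    if "(f has_real_derivative f') (at t)" for f :: "real \<Rightarrow> real" and f' t
  proof -
    have eq: "(f' * sqrt (D t) - f t * ((8 * \<rho> * t - 4) / (2 * sqrt (D t)))) / (sqrt (D t) * sqrt (D t)) =
        (f' * D t - f t * (4 * \<rho> * t - 2)) * \<phi> t"
    proof -
      have s: "sqrt (D t) > 0" "sqrt (D t) * sqrt (D t) = D t" using D_pos[of t] by simp_all
      show ?thesis
        unfolding \<phi>_def by (subst (4) s(2)[symmetric]) (use s in \<open>simp add: field_simps\<close>)
    qed
    have "((\<lambda>t. sqrt (D t)) has_real_derivative (8 * \<rho> * t - 4) / (2 * sqrt (D t))) (at t)"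
      using D_pos[of t] by (auto intro!: derivative_eq_intros D_deriv simp: field_simps)
    from DERIV_divide[OF that this] D_pos[of t] show ?thesis
      unfolding eq by simp
  qed
  have FTC: "integral {0..1} (\<lambda>t. (f' t * D t - f t * (4 * \<rho> * t - 2)) * \<phi> t) = f 1 / sqrt c - f 0"
    if "\<And>t. (f has_real_derivative f' t) (at t)" for f f' :: "real \<Rightarrow> real"
  proof -
    have "((\<lambda>t. (f' t * D t - f t * (4 * \<rho> * t - 2)) * \<phi> t) has_integral
        (f 1 / sqrt (D 1) - f 0 / sqrt (D 0))) {0..1}"
    proof (rule fundamental_theorem_of_calculus)
      show "((\<lambda>t. f t / sqrt (D t)) has_vector_derivative
          (f' t * D t - f t * (4 * \<rho> * t - 2)) * \<phi> t) (at t within {0..1})" for t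
        using quotient_deriv[OF that[of t]]
        by (simp add: has_real_derivative_iff_has_vector_derivative has_vector_derivative_at_within)
    qed simp
    then show ?thesis by (simp add: integral_unique D_def c_def)
  qed
  show thesis
  proof
    \<comment> \<open>The linear function \<open>2 * e * t - e\<close> is chosen so that its
      quotient by \<open>sqrt (D t)\<close> is an antiderivative of
      \<open>t * \<phi> t\<close>.\<close>
    define e where "e = 1 / (4 * (\<rho> - 1))"
    have e: "4 * e * \<rho> = 1 + 4 * e" using assms by (simp add: e_def field_simps)
    have "integral {0..1} (\<lambda>t. (2 * e * D t - (2 * e * t - e) * (4 * \<rho> * t - 2)) * \<phi> t) =
        (2 * e * 1 - e) / sqrt c - (2 * e * 0 - e)"
      by (rule FTC) (auto intro!: derivative_eq_intros)
    then have int_lin: "integral {0..1} (\<lambda>t. (2 * e * D t - (2 * e * t - e) * (4 * \<rho> * t - 2)) * \<phi> t) =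
        e / sqrt c + e" by simp
    have "2 * e * D t - (2 * e * t - e) * (4 * \<rho> * t - 2) = t" for t
      using e unfolding D_def by algebra
    then have "integral {0..1} (\<lambda>t. t * \<phi> t) = e * (1 / sqrt c + 1)"
      using int_lin by (simp only: distrib_left mult_1_right times_divide_eq_right)
    then have "\<mu> 1 = sqrt c * (e * (1 / sqrt c + 1))"
      by (simp add: \<mu>_def)
    also have "sqrt c * (e * (1 / sqrt c + 1)) = e * (1 + sqrt c)"
      using c by (simp add: field_simps)
    also have "\<dots> = (1 + sqrt c) / (4 * (\<rho> - 1))"
      by (simp add: e_def)
    finally show "\<mu> 1 = (1 + sqrt (4 * \<rho> - 3)) / (4 * (\<rho> - 1))"
      by (simp add: c_def)
  next
    fix k :: nat
    let ?I = "\<lambda>j. integral {0..1} (\<lambda>t. t ^ j * \<phi> t)"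
    \<comment> \<open>Integrates the derivative of \<open>t ^ Suc k / sqrt (D t)\<close>; the three
      powers of \<open>t\<close> in its numerator give the three moments.\<close>
    have "integral {0..1} (\<lambda>t. (real (Suc k) * t ^ k * D t - t ^ Suc k * (4 * \<rho> * t - 2)) * \<phi> t) =
        1 ^ Suc k / sqrt c - 0 ^ Suc k"
      by (rule FTC) (auto intro!: derivative_eq_intros simp del: power_Suc)
    moreover have "(real (Suc k) * t ^ k * D t - t ^ Suc k * (4 * \<rho> * t - 2)) * \<phi> t =
        real (Suc k) * (t ^ k * \<phi> t) - (4 * real k + 2) * (t ^ Suc k * \<phi> t)
          + 4 * real k * \<rho> * (t ^ (k + 2) * \<phi> t)" for t
      by (simp add: D_def power2_eq_square algebra_simps)
    moreover have "integral {0..1} (\<lambda>t. real (Suc k) * (t ^ k * \<phi> t) - (4 * real k + 2) * (t ^ Suc k * \<phi> t)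
          + 4 * real k * \<rho> * (t ^ (k + 2) * \<phi> t)) =
        real (Suc k) * ?I k - (4 * real k + 2) * ?I (Suc k) + 4 * real k * \<rho> * ?I (k + 2)"
      by (intro integral_unique has_integral_add has_integral_diff has_integral_mult_right
          integrable_integral int)
    ultimately have "real (Suc k) * ?I k - (4 * real k + 2) * ?I (Suc k) + 4 * real k * \<rho> * ?I (k + 2) =
        1 / sqrt c" by simp
    then have "sqrt c * (real (Suc k) * ?I k - (4 * real k + 2) * ?I (Suc k) + 4 * real k * \<rho> * ?I (k + 2)) = 1"
      using c by simp
    then show "real (Suc k) * \<mu> k - (4 * real k + 2) * \<mu> (Suc k) + 4 * real k * \<rho> * \<mu> (k + 2) = 1"
      by (simp add: \<mu>_def algebra_simps)
  next
    fix k :: nat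
    \<comment> \<open>On the unit interval \<open>D\<close> is at most its value \<open>c\<close> at
      1, so \<open>\<phi>\<close> is at least \<open>1 / (c * sqrt c)\<close>.\<close>
    have "integral {0..1} (\<lambda>t. t ^ k * (1 / (c * sqrt c))) \<le> integral {0..1} (\<lambda>t. t ^ k * \<phi> t)"
    proof (rule integral_le[OF _ int])
      show "(\<lambda>t. t ^ k * (1 / (c * sqrt c))) integrable_on {0..1}"
        by (intro integrable_continuous_real continuous_intros)
      fix t :: real assume t: "t \<in> {0..1}"
      have "D t * sqrt (D t) \<le> c * sqrt c"
        using D_le[OF t] D_pos[of t] c by (intro mult_mono) auto
      then have "1 / (c * sqrt c) \<le> \<phi> t"
        unfolding \<phi>_def using D_pos[of t] c by (intro divide_left_mono mult_pos_pos) auto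
      then show "t ^ k * (1 / (c * sqrt c)) \<le> t ^ k * \<phi> t"
        using t by (intro mult_left_mono) auto
    qed
    moreover have "integral {0..1} (\<lambda>t::real. t ^ k * (1 / (c * sqrt c))) = 1 / real (Suc k) * (1 / (c * sqrt c))"
    proof -
      have "((\<lambda>t::real. t ^ k) has_integral (1 ^ Suc k / real (Suc k) - 0 ^ Suc k / real (Suc k))) {0..1}"
        by (rule fundamental_theorem_of_calculus)
          (auto intro!: derivative_eq_intros simp del: power_Suc
            simp flip: has_real_derivative_iff_has_vector_derivative)
      then have "integral {0..1} (\<lambda>t::real. t ^ k) = 1 / real (Suc k)"
        using integral_unique[of "\<lambda>t::real. t ^ k"] by simp
      then show ?thesis by simp
    qed
    ultimately have "sqrt c * (1 / real (Suc k) * (1 / (c * sqrt c))) \<le> \<mu> k"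
      unfolding \<mu>_def using c by (intro mult_left_mono) auto
    then show "\<mu> k \<ge> 1 / (real (Suc k) * (4 * \<rho> - 3))"
      using c by (simp add: c_def)
  qed
qed

text \<open>Summation by parts: each \<open>V k\<close> is multiplied by the left-hand side of the
  equation for \<open>\<mu>\<close>, which equals 1, and the recurrence of \<open>V\<close> cancels
  all interior terms. One of the two upper boundary terms disappears where
  \<open>V (n + 1) = 0\<close>.\<close>

lemma recurrence_partial_sum:
  fixes V \<mu> :: "nat \<Rightarrow> real"
  assumes V3: "V 3 = 2 * V 2"
    and V: "\<And>m. m \<ge> 2 \<Longrightarrow> real (m + 2) * V (m + 2) =
      (4 * real m + 2) * V (m + 1) - 4 * (real m - 1) * \<rho> * V m"
    and \<mu>: "\<And>k. real (Suc k) * \<mu> k - (4 * real k + 2) * \<mu> (Suc k) + 4 * real k * \<rho> * \<mu> (k + 2) = 1"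
    and "n \<ge> 2"
  shows "(\<Sum>k=2..n. V k) =
    2 * \<mu> 1 * V 2 + 4 * \<mu> (n + 1) * (real n - 1) * \<rho> * V n - \<mu> n * real (n + 1) * V (n + 1)"
  using \<open>n \<ge> 2\<close>
proof (induction n rule: dec_induct)
  case base
  have "(2 * \<mu> 1 - 6 * \<mu> 2 + 4 * \<rho> * \<mu> 3) * V 2 = V 2"
    using \<mu>[of 1] by (simp add: numeral_2_eq_2 numeral_3_eq_3)
  then show ?case using V3 by (simp add: algebra_simps numeral_3_eq_3)
next
  case (step m)
  have "(real (m + 1) * \<mu> m - (4 * real m + 2) * \<mu> (m + 1) + 4 * real m * \<rho> * \<mu> (m + 2)) * V (m + 1) =
      V (m + 1)"
    using \<mu>[of m] by simp
  moreover have "(\<Sum>k=2..Suc m. V k) = (\<Sum>k=2..m. V k) + V (m + 1)"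
    using step.hyps by simp
  moreover have "\<mu> (m + 1) * (real (m + 2) * V (m + 2)) =
      \<mu> (m + 1) * ((4 * real m + 2) * V (m + 1) - 4 * (real m - 1) * \<rho> * V m)"
    using V[OF step.hyps(1)] by simp
  ultimately show ?case
    using step.IH by (simp add: algebra_simps)
qed

text \<open>This quadratic form is, up to scaling, \<open>(P k)\<^sup>2 + (P (k - 1))\<^sup>2 - 2 * z * P k * P (k - 1)\<close> for the
  Legendre polynomials at \<open>z = 1 / sqrt \<rho>\<close>; its growth bounds \<open>V n\<close> from below where \<open>V (n + 1)\<close> vanishes.\<close>

lemma recurrence_energy:
  fixes V :: "nat \<Rightarrow> real"
  assumes V3: "V 3 = 2 * V 2"
    and V: "\<And>m. m \<ge> 2 \<Longrightarrow> real (m + 2) * V (m + 2) =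
      (4 * real m + 2) * V (m + 1) - 4 * (real m - 1) * \<rho> * V m"
    and "1 < \<rho>" "n \<ge> 2"
  shows "(real n)\<^sup>2 * ((real (n + 1))\<^sup>2 * (V (n + 1))\<^sup>2 + 4 * \<rho> * (real n - 1)\<^sup>2 * (V n)\<^sup>2
      - 4 * ((real n)\<^sup>2 - 1) * V n * V (n + 1)) \<ge> (4 * \<rho>) ^ (n - 1) * (4 * (V 2)\<^sup>2)"
  using \<open>n \<ge> 2\<close>
proof (induction n rule: dec_induct)
  case base
  have "16 * \<rho> * (V 2)\<^sup>2 \<le> 4 * (12 + 4 * \<rho>) * (V 2)\<^sup>2"
    using assms(3) by (intro mult_right_mono) auto
  then show ?case using V3 by (simp add: power2_eq_square algebra_simps numeral_3_eq_3)
next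
  case (step m)
  define a b d k where "a = V m" and "b = V (m + 1)" and "d = V (m + 2)" and "k = real m"
  have rec: "(k + 2) * d = (4 * k + 2) * b - 4 * (k - 1) * \<rho> * a"
    using V[OF step.hyps(1)] by (simp add: a_def b_def d_def k_def add.commute)
  define J where "J = (k + 1)\<^sup>2 * b\<^sup>2 + 4 * \<rho> * (k - 1)\<^sup>2 * a\<^sup>2 - 4 * (k\<^sup>2 - 1) * a * b"
  have IH: "k\<^sup>2 * J \<ge> (4 * \<rho>) ^ (m - 1) * (4 * (V 2)\<^sup>2)"
    using step.IH by (simp add: a_def b_def k_def J_def add.commute)
  \<comment> \<open>The excess over the factor \<open>4 * \<rho>\<close> is a nonnegative multiple
    of a square.\<close>
  have "(k + 1)\<^sup>2 * (((k + 2) * d)\<^sup>2 + 4 * \<rho> * k\<^sup>2 * b\<^sup>2 - 4 * (k * b) * ((k + 2) * d)) =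
      4 * \<rho> * (k\<^sup>2 * J) + 4 * (2 * k + 1) * (2 * \<rho> * (k - 1) * a - (k + 1) * b)\<^sup>2"
    unfolding rec J_def by algebra
  also have "\<dots> \<ge> 4 * \<rho> * ((4 * \<rho>) ^ (m - 1) * (4 * (V 2)\<^sup>2))"
    using IH assms(3) by (intro add_increasing2 mult_left_mono) (auto simp: k_def)
  also have "4 * \<rho> * ((4 * \<rho>) ^ (m - 1) * (4 * (V 2)\<^sup>2)) = (4 * \<rho>) ^ (Suc m - 1) * (4 * (V 2)\<^sup>2)"
    using step.hyps by (cases m) auto
  finally show ?case
    unfolding a_def b_def d_def k_def
    by (simp add: power_mult_distrib power2_eq_square algebra_simps)
qed

text \<open>Equality holds at \<open>n = 4\<close>, and the estimate fails at 3. The factor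
  \<open>3 / 4\<close> is the inverse of the \<open>4 / 3\<close> in the bound on
  \<open>4 * \<rho> - 3\<close> with which it is combined.\<close>

lemma exponential_beats_quadratic:
  assumes "n \<ge> 4"
  shows "real n * real (n + 2) \<le> 3 / 4 * 2 ^ (n + 1)"
  using assms
proof (induction n rule: dec_induct)
  case (step m)
  have "real (Suc m) * real (Suc m + 2) = real m * real (m + 2) + (2 * real m + 3)"
    by (simp add: algebra_simps)
  also have "2 * real m + 3 \<le> real m * real (m + 2)"
  proof -
    have "real m \<ge> 4" using step.hyps by simp
    moreover from this have "4 * real m \<le> real m * real m" by (intro mult_right_mono) auto
    moreover have "real m * real (m + 2) = real m * real m + 2 * real m"
      by (simp add: algebra_simps)
    ultimately show ?thesis by linarith
  qed
  finally show ?case using step.IH by simp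
qed simp

text \<open>For \<open>V n < 0\<close> both terms of \<open>P - (S - 1) / 2\<close> are negative.
  For \<open>V n > 0\<close> the chain \<open>P \<ge> -w > (S - 1) / 2\<close> decides; its first
  half rests on the growth of \<open>V n\<close>, its second half is elementary.\<close>

lemma sign_of_partial_sum_at_zero:
  fixes V :: "nat \<Rightarrow> real"
  assumes "w < 0" "V 2 = w" "V 3 = 2 * w"
    and V: "\<And>m. m \<ge> 2 \<Longrightarrow> real (m + 2) * V (m + 2) =
      (4 * real m + 2) * V (m + 1) - 4 * (real m - 1) * (1 - w) * V m"
    and zero: "V (n + 1) = 0" and "n \<ge> 2"
  shows "V n * (1 + (\<Sum>k=2..n. V k)) > 0"
proof -
  define \<rho> where "\<rho> = 1 - w"
  have \<rho>: "1 < \<rho>" using assms(1) by (simp add: \<rho>_def)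
  have V3: "V 3 = 2 * V 2" using assms(2,3) by simp
  note V' = V[folded \<rho>_def]
  have "n \<noteq> 2" using zero assms(1,3) by (auto simp: numeral_3_eq_3)
  then have n: "n \<ge> 3" using \<open>n \<ge> 2\<close> by simp
  obtain \<mu> where l1: "\<mu> 1 = (1 + sqrt (4 * \<rho> - 3)) / (4 * (\<rho> - 1))"
    and rec: "\<And>k. real (Suc k) * \<mu> k - (4 * real k + 2) * \<mu> (Suc k) + 4 * real k * \<rho> * \<mu> (k + 2) = 1"
    and bound: "\<And>k. \<mu> k \<ge> 1 / (real (Suc k) * (4 * \<rho> - 3))"
    using ex_summation_multiplier[OF \<rho>] by blast
  have pos: "\<mu> k > 0" for k
    using \<rho> by (intro less_le_trans[OF _ bound]) simp
  have "2 * \<mu> 1 * w = - (1 + sqrt (4 * \<rho> - 3)) / 2"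
    using assms(1) unfolding l1 \<rho>_def by (simp add: field_simps)
  define S where "S = sqrt (4 * \<rho> - 3)"
  define P where "P = 4 * \<mu> (n + 1) * (real n - 1) * \<rho> * V n"
  have sum: "1 + (\<Sum>k=2..n. V k) =
      P - (S - 1) / 2"
    using recurrence_partial_sum[OF V3 V' rec \<open>n \<ge> 2\<close>] zero assms(2) \<open>2 * \<mu> 1 * w = _\<close>
    by (simp add: P_def S_def field_simps)
  have sq1: "S > 1" using \<rho> by (simp add: S_def)
  have energy: "(real n)\<^sup>2 * (4 * \<rho> * (real n - 1)\<^sup>2 * (V n)\<^sup>2) \<ge> (4 * \<rho>) ^ (n - 1) * (4 * w\<^sup>2)"
    using recurrence_energy[OF V3 V' \<rho> \<open>n \<ge> 2\<close>] zero assms(2) by simp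
  have "(4 * \<rho>) ^ (n - 1) * (4 * w\<^sup>2) > 0" using \<rho> assms(1) by simp
  have "V n \<noteq> 0"
  proof
    assume "V n = 0"
    then have "(4 * \<rho>) ^ (n - 1) * (4 * w\<^sup>2) \<le> 0" using energy by (simp only: zero_power2 mult_zero_right)
    with \<open>(4 * \<rho>) ^ (n - 1) * (4 * w\<^sup>2) > 0\<close> show False by linarith
  qed
  then consider "V n < 0" | "V n > 0" by linarith
  then show ?thesis
  proof cases
    case 1
    have "4 * \<mu> (n + 1) * (real n - 1) * \<rho> > 0" using pos[of "n + 1"] n \<rho> by simp
    then have "P < 0" unfolding P_def using 1 by (rule mult_pos_neg)
    then have "1 + (\<Sum>k=2..n. V k) < 0" unfolding sum using sq1 by argo
    with 1 show ?thesis by (simp add: mult_neg_neg)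
  next
    case 2
    \<comment> \<open>\<open>V 3 = 2 * w\<close> is negative, which excludes the one remaining index
      below the range of \<open>exponential_beats_quadratic\<close>.\<close>
    have "n \<noteq> 3" using 2 assms(1,3) by auto
    then have n4: "n \<ge> 4" using n by simp
    have nn: "real n * (real n - 1) > 0" using n4 by simp
    \<comment> \<open>Of the \<open>n - 2\<close> factors \<open>4 * \<rho>\<close> in the energy
      bound two are kept and the others lowered to 4, so that the square root has no half-integral
      powers. The surviving \<open>\<rho>\<close>, together with the one in \<open>P\<close>, is
      enough against \<open>4 * \<rho> - 3\<close>.\<close>
    have sq_le: "(2 * -w * (4 * \<rho> * 2 ^ (n - 4)))\<^sup>2 \<le> (real n * (real n - 1) * V n)\<^sup>2"
    proof -
      obtain j where j: "n = j + 4" using n4 le_Suc_ex by (metis add.commute)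
      have "(4 * \<rho>) * (2 * -w * (4 * \<rho> * 2 ^ (n - 4)))\<^sup>2 = (4 * \<rho>) ^ 3 * 4 ^ j * (4 * w\<^sup>2)"
        using power_mult_distrib[of "2 :: real" 2 j] by (simp add: j power_mult_distrib eval_nat_numeral)
      also have "\<dots> \<le> (4 * \<rho>) ^ 3 * (4 * \<rho>) ^ j * (4 * w\<^sup>2)"
        using \<rho> by (intro mult_right_mono mult_left_mono power_mono) auto
      also have "\<dots> = (4 * \<rho>) ^ (n - 1) * (4 * w\<^sup>2)"
      proof -
        have "n - 1 = 3 + j" using j by simp
        then show ?thesis by (simp only: power_add)
      qed
      also have "\<dots> \<le> (4 * \<rho>) * (real n * (real n - 1) * V n)\<^sup>2"
        using energy by (simp add: power_mult_distrib mult_ac)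
      finally show ?thesis using \<rho> by simp
    qed
    have V_ge: "2 * -w * (4 * \<rho> * 2 ^ (n - 4)) \<le> real n * (real n - 1) * V n"
      using sq_le by (rule power2_le_imp_le) (use nn 2 in simp)
    have c: "4 * \<rho> - 3 > 0" using \<rho> by simp
    \<comment> \<open>A tangent bound with equality at \<open>\<rho> = 3 / 2\<close>; it matches the
      \<open>\<rho>^2\<close> collected from \<open>P\<close> and \<open>V n\<close>.\<close>
    have c_le: "4 * \<rho> - 3 \<le> 4 / 3 * \<rho>\<^sup>2"
    proof -
      have "(2 * \<rho> - 3)\<^sup>2 \<ge> 0" by simp
      then show ?thesis by (simp add: power2_eq_square algebra_simps)
    qed
    have "real n * real (n + 2) * (4 * \<rho> - 3) \<le> (3 / 4 * 2 ^ (n + 1)) * (4 / 3 * \<rho>\<^sup>2)"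
      by (rule mult_mono[OF exponential_beats_quadratic[OF n4] c_le]) (use c in simp_all)
    also have "\<dots> = 2 ^ (n + 1) * \<rho>\<^sup>2" by simp
    finally have est: "real n * real (n + 2) * (4 * \<rho> - 3) \<le> 2 ^ (n + 1) * \<rho>\<^sup>2" .
    have "-w \<le> -w * (2 ^ (n + 1) * \<rho>\<^sup>2 / (real n * real (n + 2) * (4 * \<rho> - 3)))"
    proof -
      have "1 \<le> 2 ^ (n + 1) * \<rho>\<^sup>2 / (real n * real (n + 2) * (4 * \<rho> - 3))"
        using est n4 c by (subst le_divide_eq_1_pos) auto
      moreover have "0 \<le> -w" using assms(1) by simp
      ultimately have "-w * 1 \<le> -w * (2 ^ (n + 1) * \<rho>\<^sup>2 / (real n * real (n + 2) * (4 * \<rho> - 3)))"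
        by (rule mult_left_mono)
      then show ?thesis by (simp only: mult_1_right)
    qed
    also have "\<dots> = 4 * (1 / (real (n + 2) * (4 * \<rho> - 3))) * (real n - 1) * \<rho> *
        (2 * -w * (4 * \<rho> * 2 ^ (n - 4)) / (real n * (real n - 1)))"
    proof -
      have pow: "(2::real) ^ (n + 1) = 32 * 2 ^ (n - 4)"
        using n4 by (simp add: power_add[symmetric] flip: power_Suc) (simp add: power_diff)
      have "-w * (32 * E * \<rho>\<^sup>2 / (N * A * C)) =
          4 * (1 / (A * C)) * M * \<rho> * (2 * -w * (4 * \<rho> * E) / (N * M))"
        if "N \<noteq> 0" "M \<noteq> 0" "A \<noteq> 0" "C \<noteq> 0" for N M A C E :: real
        using that by (simp add: field_simps power2_eq_square)
      then show ?thesis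
        unfolding pow by this (use n4 c in simp_all)
    qed
    also have "\<dots> \<le> P"
      unfolding P_def
    proof (intro mult_mono)
      show "1 / (real (n + 2) * (4 * \<rho> - 3)) \<le> \<mu> (n + 1)" using bound[of "n + 1"] by simp
      show "2 * -w * (4 * \<rho> * 2 ^ (n - 4)) / (real n * (real n - 1)) \<le> V n"
        using V_ge by (simp only: pos_divide_le_eq[OF nn] mult_ac)
      show "0 \<le> 2 * -w * (4 * \<rho> * 2 ^ (n - 4)) / (real n * (real n - 1))"
        using nn \<rho> assms(1) by (intro divide_nonneg_pos mult_nonneg_nonneg) auto
    qed (use n4 \<rho> assms(1) pos[of "n + 1"] in \<open>auto intro!: mult_nonneg_nonneg divide_nonneg_nonneg simp: less_imp_le\<close>)
    finally have "-w \<le> P" .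
    moreover have "(S - 1) / 2 < -w"
    proof -
      \<comment> \<open>\<open>(1 - 2 * w)^2\<close> exceeds
        \<open>4 * \<rho> - 3 = 1 - 4 * w\<close> by \<open>4 * w^2\<close>.\<close>
      have "S < 1 - 2 * w"
        using assms(1) unfolding S_def by (intro real_less_lsqrt) (auto simp: \<rho>_def power2_eq_square algebra_simps mult_neg_neg)
      then show ?thesis by simp
    qed
    ultimately have "1 + (\<Sum>k=2..n. V k) > 0" unfolding sum by argo
    with 2 show ?thesis by simp
  qed
qed

section \<open>Interlacing roots\<close>

lemma poly_sign_at_minus_infinity:
  fixes p :: "real poly"
  assumes "lead_coeff p > 0"
  shows "\<exists>x<a. (-1) ^ degree p * poly p x > 0"
proof -
  define q where "q = smult ((-1) ^ degree p) (p \<circ>\<^sub>p [:0, -1:])"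
  have "degree q = degree p" by (simp add: q_def degree_pcompose)
  moreover have "lead_coeff (p \<circ>\<^sub>p [:0, -1:]) = lead_coeff p * (-1) ^ degree p"
    by (subst lead_coeff_comp) simp_all
  ultimately have "lead_coeff q = lead_coeff p"
    by (simp add: q_def degree_pcompose flip: power_add mult_2)
  then obtain m where m: "\<And>x. x \<ge> m \<Longrightarrow> poly q x \<ge> lead_coeff p"
    using poly_pinfty_gt_lc[of q] assms by auto
  define x where "x = - max m (1 - a)"
  have "poly q (- x) > 0" using m[of "- x"] assms by (simp add: x_def)
  then have "(-1) ^ degree p * poly p x > 0" by (simp add: q_def poly_pcompose)
  moreover have "x < a" by (simp add: x_def)
  ultimately show ?thesis by blast
qed

text \<open>The \<open>k\<close> distinct roots determine the factorisation, and exactly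
  \<open>i\<close> of the linear factors are negative at \<open>x\<close>.\<close>

lemma poly_sign_between_roots:
  fixes p :: "real poly"
  assumes lead: "lead_coeff p > 0" and deg: "degree p = k"
    and roots: "\<And>i. i < k \<Longrightarrow> poly p (r i) = 0"
    and decr: "\<And>i j. i < j \<Longrightarrow> j < k \<Longrightarrow> r j < r i"
    and "i \<le> k" and above: "\<And>j. j < i \<Longrightarrow> x < r j" and below: "\<And>j. i \<le> j \<Longrightarrow> j < k \<Longrightarrow> r j < x"
  shows "(-1) ^ i * poly p x > 0"
proof -
  let ?q = "\<Prod>j<k. [:- r j, 1:]"
  have inj: "inj_on r {..<k}"
    using decr by (intro linorder_inj_onI) (force simp: less_le)+
  have degq: "degree ?q = k" by (subst degree_prod_sum_eq) auto
  have leadq: "coeff ?q k = 1" using lead_coeff_prod[of "\<lambda>j. [:- r j, 1:]" "{..<k}"] degq by simp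
  have "p = smult (lead_coeff p) ?q"
  proof (rule poly_eqI_degree_lead_coeff[of _ k _ "r ` {..<k}"])
    show "coeff p k = coeff (smult (lead_coeff p) ?q) k" using leadq deg by simp
    show "card (r ` {..<k}) \<ge> k" using inj by (simp add: card_image)
    show "degree p \<le> k" "degree (smult (lead_coeff p) ?q) \<le> k" using deg degq by auto
    fix z assume "z \<in> r ` {..<k}"
    then obtain j where "j < k" "z = r j" by auto
    then show "poly p z = poly (smult (lead_coeff p) ?q) z"
      using roots by (auto simp: poly_prod prod_zero_iff)
  qed
  then have "poly p x = lead_coeff p * (\<Prod>j<k. x - r j)"
    by (metis (no_types, lifting) add.right_neutral mult.right_neutral poly_pCons poly_prod poly_smult
        mult_zero_right poly_0 prod.cong uminus_add_conv_diff)
  also have "(\<Prod>j<k. x - r j) = (\<Prod>j<i. x - r j) * (\<Prod>j=i..<k. x - r j)"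
    using \<open>i \<le> k\<close> by (simp add: prod.atLeastLessThan_concat lessThan_atLeast0)
  also have "(\<Prod>j<i. x - r j) = (\<Prod>j<i. (-1) * (r j - x))"
    by simp
  also have "\<dots> = (-1) ^ i * (\<Prod>j<i. r j - x)"
    by (subst prod.distrib) simp
  finally have "(-1) ^ i * poly p x = lead_coeff p * ((\<Prod>j<i. r j - x) * (\<Prod>j=i..<k. x - r j))"
    by (simp flip: power_add mult_2 add: mult.left_commute mult.assoc)
  also have "\<dots> > 0"
    using lead above below by (intro mult_pos_pos prod_pos) auto
  finally show ?thesis .
qed

text \<open>The sign changes along \<open>0 > r 0 > ... > r (k - 1)\<close> give \<open>k\<close>
  roots; in degree \<open>k + 1\<close> the sign at minus infinity yields one more to the left of
  all \<open>r i\<close>. The interlacing in the last two conclusions carries the induction over the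
  sequence.\<close>

lemma roots_from_alternating_signs:
  fixes p :: "real poly"
  assumes lead: "lead_coeff p > 0" and "poly p 0 > 0"
    and neg: "\<And>i. i < k \<Longrightarrow> r i < 0"
    and decr: "\<And>i j. i < j \<Longrightarrow> j < k \<Longrightarrow> r j < r i"
    and sign: "\<And>i. i < k \<Longrightarrow> (-1) ^ Suc i * poly p (r i) > 0"
    and deg: "degree p = d" "d = k \<or> d = Suc k"
  obtains b :: "nat \<Rightarrow> real" where
    "\<And>i. i < d \<Longrightarrow> poly p (b i) = 0" "\<And>i. i < d \<Longrightarrow> b i < 0"
    "\<And>i j. i < j \<Longrightarrow> j < d \<Longrightarrow> b j < b i"
    "\<And>i j. i < d \<Longrightarrow> j < i \<Longrightarrow> b i < r j" "\<And>i j. i < d \<Longrightarrow> i \<le> j \<Longrightarrow> j < k \<Longrightarrow> r j < b i"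
proof -
  define m where "m = (if k = 0 then 0 else r (k - 1))"
  obtain x where x: "x < m" "(-1) ^ degree p * poly p x > 0"
    using poly_sign_at_minus_infinity[OF lead] by blast
  \<comment> \<open>The separating points in decreasing order; \<open>x\<close> is reached only if
    \<open>d = Suc k\<close>.\<close>
  define a where "a i = (if i = 0 then 0 else if i \<le> k then r (i - 1) else x)" for i
  have r_le: "r j \<le> r i" if "i \<le> j" "j < k" for i j
    using decr[of i j] that by (cases "i = j") auto
  have m_le: "m \<le> r i" if "i < k" for i
    using r_le[of i "k - 1"] that by (simp add: m_def)
  have m_le_0: "m \<le> 0" using neg[of "k - 1"] by (auto simp: m_def)
  have r_le_0: "r i \<le> 0" and x_le_r: "x \<le> r i" if "i < k" for i
    using neg[OF that] m_le[OF that] x(1) by auto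
  have a_le: "a j \<le> a i" if "i \<le> j" "j \<le> d" for i j
    using that deg(2) r_le[of "i - 1" "j - 1"] r_le_0[of "j - 1"] x_le_r[of "i - 1"] x(1) m_le_0
    by (auto simp: a_def)
  have a_less: "a (Suc i) < a i" if "i < d" for i
  proof (cases "Suc i \<le> k")
    case True
    then show ?thesis using decr[of "i - 1" i] neg[of i] by (auto simp: a_def)
  next
    case False
    then have "i = k" using that deg(2) by auto
    then show ?thesis using x(1) by (auto simp: a_def m_def)
  qed
  have a_sign: "(-1) ^ i * poly p (a i) > 0" if "i \<le> d" for i
  proof -
    have "i = 0 \<or> (\<exists>j. i = Suc j \<and> j < k) \<or> i = Suc k \<and> d = Suc k"
      using that deg(2) by (cases i) auto
    then consider "i = 0" | j where "i = Suc j" "j < k" | "i = Suc k" "d = Suc k"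
      by blast
    then show ?thesis
    proof cases
      case (2 j)
      then show ?thesis using sign[of j] by (simp add: a_def)
    next
      case 3
      then show ?thesis using x(2) deg(1) by (simp add: a_def)
    qed (use assms(2) in \<open>simp add: a_def\<close>)
  qed
  have "\<exists>z. a (Suc i) < z \<and> z < a i \<and> poly p z = 0" if "i < d" for i
  proof (rule poly_IVT[OF a_less[OF that], simplified])
    have "((-1) ^ i * poly p (a i)) * ((-1) ^ Suc i * poly p (a (Suc i))) > 0"
      using that by (intro mult_pos_pos[OF a_sign a_sign]) simp_all
    also have "((-1) ^ i * poly p (a i)) * ((-1) ^ Suc i * poly p (a (Suc i))) =
        - (poly p (a (Suc i)) * poly p (a i))"
      by (simp add: minus_one_power_iff)
    finally show "poly p (a (Suc i)) * poly p (a i) < 0" by simp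
  qed
  then obtain b where b: "\<And>i. i < d \<Longrightarrow> a (Suc i) < b i \<and> b i < a i \<and> poly p (b i) = 0"
    by metis
  show thesis
  proof
    show "poly p (b i) = 0" if "i < d" for i using b that by blast
    show "b i < 0" if "i < d" for i
      using b[OF that] a_le[of 0 i] that by (simp add: a_def)
    show "b j < b i" if "i < j" "j < d" for i j
      using b[of i] b[of j] a_le[of "Suc i" j] that by auto
    show "b i < r j" if "i < d" "j < i" for i j
      using b[OF that(1)] a_le[of "Suc j" i] that deg(2) by (auto simp: a_def)
    show "r j < b i" if "i < d" "i \<le> j" "j < k" for i j
      using b[OF that(1)] r_le[OF that(2,3)] that by (auto simp: a_def)
  qed
qed

text \<open>In the notation of the introduction, \<open>V m = w * gegenbauer_w (m - 2)\<close> for \<open>m \<ge> 2\<close>.\<close>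

fun gegenbauer_w :: "nat \<Rightarrow> real poly" where
  "gegenbauer_w 0 = 1"
| "gegenbauer_w (Suc 0) = [:2:]"
| "gegenbauer_w (Suc (Suc j)) = smult (1 / (real j + 4))
     (smult (4 * real j + 10) (gegenbauer_w (Suc j)) - smult (4 * real j + 4) ([:1, -1:] * gegenbauer_w j))"

lemma gegenbauer_w_rec:
  "(real j + 4) * poly (gegenbauer_w (j + 2)) w =
    (4 * real j + 10) * poly (gegenbauer_w (j + 1)) w - (4 * real j + 4) * (1 - w) * poly (gegenbauer_w j) w"
  by (simp add: field_simps)

text \<open>Supplies the sign at the right end in the interlacing argument.\<close>

lemma poly_gegenbauer_w_0: "poly (gegenbauer_w j) 0 = 2 ^ j"
proof (induction j rule: gegenbauer_w.induct)
  case (3 j)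
  have "(real j + 4) * poly (gegenbauer_w (j + 2)) 0 = (real j + 4) * 2 ^ (j + 2)"
    unfolding gegenbauer_w_rec using 3 by (simp add: algebra_simps)
  then show ?case by simp
qed simp_all

text \<open>Nothing cancels at the top: two minus signs make the contribution of
  \<open>w * gegenbauer_w j\<close> positive, and \<open>gegenbauer_w (Suc j)\<close> reaches the
  same degree only for odd \<open>j\<close>, again with a positive coefficient.\<close>

lemma gegenbauer_w_coeffs:
  "(\<forall>i > j div 2. coeff (gegenbauer_w j) i = 0) \<and> coeff (gegenbauer_w j) (j div 2) > 0"
proof (induction j rule: gegenbauer_w.induct)
  case (3 j)
  have c: "coeff (gegenbauer_w (Suc (Suc j))) i = 1 / (real j + 4) *
      ((4 * real j + 10) * coeff (gegenbauer_w (Suc j)) i - (4 * real j + 4) * (coeff (gegenbauer_w j) i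
        - (case i of 0 \<Rightarrow> 0 | Suc i \<Rightarrow> coeff (gegenbauer_w j) i)))" for i
    by (simp add: coeff_pCons split: nat.split)
  show ?case
  proof (intro conjI allI impI)
    fix i assume "i > Suc (Suc j) div 2"
    then show "coeff (gegenbauer_w (Suc (Suc j))) i = 0"
      unfolding c using 3 by (cases i) auto
  next
    have "coeff (gegenbauer_w (Suc j)) (Suc (j div 2)) \<ge> 0"
    proof (cases "even j")
      case True
      then have "Suc j div 2 < Suc (j div 2)" by simp
      with 3 show ?thesis by simp
    next
      case False
      then have "Suc j div 2 = Suc (j div 2)" by (simp add: odd_Suc_div_two)
      with 3 show ?thesis by (metis less_imp_le)
    qed
    moreover have "coeff (gegenbauer_w j) (Suc (j div 2)) = 0" "coeff (gegenbauer_w j) (j div 2) > 0"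
      using 3 by auto
    ultimately show "coeff (gegenbauer_w (Suc (Suc j))) (Suc (Suc j) div 2) > 0"
      unfolding c by (auto intro!: divide_pos_pos add_nonneg_pos)
  qed
qed (simp_all add: coeff_pCons split: nat.split)

lemma degree_gegenbauer_w: "degree (gegenbauer_w j) = j div 2"
  and lead_coeff_gegenbauer_w: "lead_coeff (gegenbauer_w j) > 0"
proof -
  show "degree (gegenbauer_w j) = j div 2"
    using gegenbauer_w_coeffs[of j] by (intro antisym degree_le le_degree) auto
  then show "lead_coeff (gegenbauer_w j) > 0"
    using gegenbauer_w_coeffs[of j] by simp
qed

text \<open>At a root of \<open>gegenbauer_w (Suc j)\<close> its two neighbours in the sequence have
  opposite signs, because \<open>1 - w > 0\<close> for negative \<open>w\<close>. So the alternation
  of one neighbour passes to the other and produces its roots.\<close>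

lemma gegenbauer_w_roots:
  "\<exists>r. (\<forall>i < Suc j div 2. r i < 0 \<and> poly (gegenbauer_w (Suc j)) (r i) = 0 \<and>
        (-1) ^ i * poly (gegenbauer_w j) (r i) > 0) \<and>
      (\<forall>i j'. i < j' \<longrightarrow> j' < Suc j div 2 \<longrightarrow> r j' < r i)"
proof (induction j)
  case 0
  show ?case by simp
next
  case (Suc j)
  define k d where "k = Suc j div 2" and "d = Suc (Suc j) div 2"
  from Suc obtain r where r: "\<And>i. i < k \<Longrightarrow> r i < 0" "\<And>i. i < k \<Longrightarrow> poly (gegenbauer_w (Suc j)) (r i) = 0"
      "\<And>i. i < k \<Longrightarrow> (-1) ^ i * poly (gegenbauer_w j) (r i) > 0"
      and decr: "\<And>i j'. i < j' \<Longrightarrow> j' < k \<Longrightarrow> r j' < r i"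
    unfolding k_def by metis
  have sign: "(-1) ^ Suc i * poly (gegenbauer_w (Suc (Suc j))) (r i) > 0" if i: "i < k" for i
  proof -
    have "(real j + 4) * ((-1) ^ Suc i * poly (gegenbauer_w (Suc (Suc j))) (r i)) =
        (4 * real j + 4) * (1 - r i) * ((-1) ^ i * poly (gegenbauer_w j) (r i))"
      using gegenbauer_w_rec[of j "r i"] r(2)[OF i] by (simp del: gegenbauer_w.simps add: mult_ac)
    also have "\<dots> > 0"
    proof (rule mult_pos_pos[OF _ r(3)[OF i]])
      show "(4 * real j + 4) * (1 - r i) > 0" using r(1)[OF i] by (intro mult_pos_pos) auto
    qed
    finally have "(real j + 4) * ((-1) ^ Suc i * poly (gegenbauer_w (Suc (Suc j))) (r i)) > 0" .
    then show ?thesis by (rule zero_less_mult_pos) simp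
  qed
  have d: "d = k \<or> d = Suc k" by (auto simp: d_def k_def)
  have p0: "poly (gegenbauer_w (Suc (Suc j))) 0 > 0" unfolding poly_gegenbauer_w_0 by simp
  have deg: "degree (gegenbauer_w (Suc (Suc j))) = d" unfolding d_def by (rule degree_gegenbauer_w)
  obtain b where b: "\<And>i. i < d \<Longrightarrow> poly (gegenbauer_w (Suc (Suc j))) (b i) = 0" "\<And>i. i < d \<Longrightarrow> b i < 0"
    "\<And>i j. i < j \<Longrightarrow> j < d \<Longrightarrow> b j < b i"
    "\<And>i j. i < d \<Longrightarrow> j < i \<Longrightarrow> b i < r j" "\<And>i j. i < d \<Longrightarrow> i \<le> j \<Longrightarrow> j < k \<Longrightarrow> r j < b i"
    by (rule roots_from_alternating_signs[OF lead_coeff_gegenbauer_w[of "Suc (Suc j)"] p0 r(1) decr sign deg d])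
      (assumption | rule that)+
  have "(-1) ^ i * poly (gegenbauer_w (Suc j)) (b i) > 0" if "i < d" for i
    by (rule poly_sign_between_roots[OF lead_coeff_gegenbauer_w degree_gegenbauer_w])
      (use r(2) decr b(4,5) that d in \<open>auto simp: k_def\<close>)
  with b show ?case unfolding d_def by blast
qed

section \<open>Roots of the polynomials \<open>g n\<close> in the variable \<open>w\<close>\<close>

definition fan_g :: "nat \<Rightarrow> real poly" where
  "fan_g n = 1 + [:0, 1:] * (\<Sum>j<n. gegenbauer_w j)"

lemma poly_fan_g_0: "poly (fan_g n) 0 = 1"
  by (simp add: fan_g_def)

text \<open>In the top degree every summand contributes a nonnegative coefficient and the last one a
  positive coefficient.\<close>

lemma fan_g_coeffs:
  assumes "1 \<le> n"
  shows "degree (fan_g n) = Suc n div 2" and "lead_coeff (fan_g n) > 0"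
proof -
  obtain m where n: "n = Suc m" using assms by (cases n) auto
  have c: "coeff (fan_g n) (Suc i) = (\<Sum>j<n. coeff (gegenbauer_w j) i)" for i
    by (simp add: fan_g_def coeff_sum)
  have vanish: "coeff (gegenbauer_w j) i = 0" if "j div 2 < i" for i j
    using gegenbauer_w_coeffs[of j] that by blast
  have top: "coeff (gegenbauer_w j) i \<ge> 0" if "j div 2 \<le> i" for i j
    using gegenbauer_w_coeffs[of j] that by (cases "j div 2 = i") auto
  have "coeff (fan_g n) (Suc (m div 2)) > 0"
  proof -
    have "(\<Sum>j<m. coeff (gegenbauer_w j) (m div 2)) \<ge> 0"
      by (intro sum_nonneg top div_le_mono) simp
    moreover have "coeff (gegenbauer_w m) (m div 2) > 0" using gegenbauer_w_coeffs by blast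
    ultimately show ?thesis unfolding c by (simp add: n)
  qed
  moreover have "coeff (fan_g n) i = 0" if "Suc (m div 2) < i" for i
  proof -
    obtain k where k: "i = Suc k" "m div 2 < k" using \<open>Suc (m div 2) < i\<close> unfolding Suc_less_eq2 by blast
    have "coeff (gegenbauer_w j) k = 0" if "j < n" for j
      using that k(2) n div_le_mono[of j m 2] by (intro vanish) auto
    then show ?thesis unfolding k(1) c by simp
  qed
  ultimately have "degree (fan_g n) = Suc (m div 2)"
    by (intro antisym degree_le le_degree) auto
  with \<open>coeff (fan_g n) (Suc (m div 2)) > 0\<close>
  show "degree (fan_g n) = Suc n div 2" "lead_coeff (fan_g n) > 0"
    by (simp_all add: n)
qed

text \<open>The last summand of \<open>fan_g\<close> vanishes at the given root, which leaves the
  sum of \<open>V\<close> up to index \<open>m + 2\<close>. The inequality is reversed by the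
  negative factor \<open>w\<close> in \<open>V (m + 2)\<close>.\<close>

lemma fan_g_sign_at_roots:
  assumes w: "w < 0" and zero: "poly (gegenbauer_w (Suc m)) w = 0"
  shows "poly (gegenbauer_w m) w * poly (fan_g (Suc (Suc m))) w < 0"
proof -
  define V where "V k = w * poly (gegenbauer_w (k - 2)) w" for k
  have rec: "real (k + 2) * V (k + 2) = (4 * real k + 2) * V (k + 1) - 4 * (real k - 1) * (1 - w) * V k"
    if "2 \<le> k" for k
  proof -
    obtain j where j: "k = j + 2" using \<open>2 \<le> k\<close> le_Suc_ex by (metis add.commute)
    have "w * ((real j + 4) * poly (gegenbauer_w (j + 2)) w) =
        w * ((4 * real j + 10) * poly (gegenbauer_w (j + 1)) w -
          (4 * real j + 4) * (1 - w) * poly (gegenbauer_w j) w)"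
      by (simp only: gegenbauer_w_rec)
    then show ?thesis
      by (simp add: V_def j algebra_simps del: gegenbauer_w.simps)
  qed
  have "V (m + 2) * (1 + (\<Sum>k=2..m+2. V k)) > 0"
    by (rule sign_of_partial_sum_at_zero[OF w _ _ rec])
      (use zero in \<open>simp_all add: V_def numeral_2_eq_2 numeral_3_eq_3\<close>)
  moreover have "1 + (\<Sum>k=2..m+2. V k) = poly (fan_g (Suc (Suc m))) w"
  proof -
    have "(\<Sum>k=2..m+2. V k) = (\<Sum>j\<le>m. V (j + 2))"
      using sum.shift_bounds_cl_nat_ivl[of V 0 2 m] by (simp only: atLeast0AtMost add_0)
    also have "\<dots> = w * (\<Sum>j<Suc (Suc m). poly (gegenbauer_w j) w)"
      using zero by (simp add: V_def sum_distrib_left lessThan_Suc_atMost)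
    finally show ?thesis by (simp add: fan_g_def poly_sum del: gegenbauer_w.simps)
  qed
  ultimately have "w * (poly (gegenbauer_w m) w * poly (fan_g (Suc (Suc m))) w) > 0"
    by (simp add: V_def mult.assoc)
  then show ?thesis using w by (simp add: zero_less_mult_iff del: gegenbauer_w.simps)
qed

text \<open>The roots of \<open>gegenbauer_w (n - 1)\<close> are the separating points. The degree
  of \<open>fan_g n\<close> exceeds their number by one, so all its roots are caught.\<close>

lemma fan_g_roots:
  assumes "2 \<le> n"
  obtains b :: "nat \<Rightarrow> real" where
    "\<And>i. i < Suc n div 2 \<Longrightarrow> poly (fan_g n) (b i) = 0 \<and> b i < 0"
    "\<And>i j. i < j \<Longrightarrow> j < Suc n div 2 \<Longrightarrow> b j < b i"
proof -
  obtain m where n: "n = Suc (Suc m)" using assms by (metis Suc_le_D numeral_2_eq_2 Suc_le_mono)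
  obtain r where r: "\<And>i. i < Suc m div 2 \<Longrightarrow> r i < 0"
      "\<And>i. i < Suc m div 2 \<Longrightarrow> poly (gegenbauer_w (Suc m)) (r i) = 0"
      "\<And>i. i < Suc m div 2 \<Longrightarrow> (-1) ^ i * poly (gegenbauer_w m) (r i) > 0"
      and decr: "\<And>i j'. i < j' \<Longrightarrow> j' < Suc m div 2 \<Longrightarrow> r j' < r i"
    using gegenbauer_w_roots[of m] by metis
  have sign: "(-1) ^ Suc i * poly (fan_g n) (r i) > 0" if i: "i < Suc m div 2" for i
  proof -
    have "poly (gegenbauer_w m) (r i) * poly (fan_g n) (r i) < 0"
      unfolding n by (rule fan_g_sign_at_roots[OF r(1,2)[OF i]])
    with r(3)[OF i] show ?thesis
      by (cases "even i") (auto simp: mult_less_0_iff)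
  qed
  have p0: "poly (fan_g n) 0 > 0" by (simp add: poly_fan_g_0)
  have n1: "1 \<le> n" using assms by simp
  have d: "Suc n div 2 = Suc m div 2 \<or> Suc n div 2 = Suc (Suc m div 2)" using n by auto
  show thesis
    by (rule roots_from_alternating_signs[OF fan_g_coeffs(2)[OF n1] p0 r(1) decr sign fan_g_coeffs(1)[OF n1] d])
      (assumption | rule that conjI)+
qed

section \<open>From the variable \<open>w\<close> back to \<open>x\<close>\<close>

definition eval_int_poly :: "int poly \<Rightarrow> real \<Rightarrow> real" where
  "eval_int_poly p x = poly (map_poly of_int p) x"

lemma eval_int_poly_add: "eval_int_poly (p + q) x = eval_int_poly p x + eval_int_poly q x"
proof -
  have "map_poly of_int (p + q) = map_poly of_int p + (map_poly of_int q :: real poly)"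
    by (rule poly_eqI) (simp add: coeff_map_poly)
  then show ?thesis by (simp add: eval_int_poly_def)
qed

lemma eval_int_poly_diff: "eval_int_poly (p - q) x = eval_int_poly p x - eval_int_poly q x"
proof -
  have "map_poly of_int (p - q) = map_poly of_int p - (map_poly of_int q :: real poly)"
    by (rule poly_eqI) (simp add: coeff_map_poly)
  then show ?thesis by (simp add: eval_int_poly_def)
qed

lemma eval_int_poly_mult: "eval_int_poly (p * q) x = eval_int_poly p x * eval_int_poly q x"
proof -
  have "map_poly of_int (p * q) = map_poly of_int p * (map_poly of_int q :: real poly)"
    by (rule poly_eqI) (simp add: coeff_map_poly coeff_mult)
  then show ?thesis by (simp add: eval_int_poly_def)
qed

lemma eval_int_poly_pCons [simp]: "eval_int_poly (pCons a p) x = of_int a + x * eval_int_poly p x"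
  by (simp add: eval_int_poly_def map_poly_pCons)

lemma eval_int_poly_0 [simp]: "eval_int_poly 0 x = 0"
  by (simp add: eval_int_poly_def)

lemma eval_int_poly_of_nat: "eval_int_poly (of_nat k * p) x = real k * eval_int_poly p x"
  unfolding eval_int_poly_mult of_nat_poly by simp

lemma eval_rev_poly:
  assumes "degree p \<le> r" "x \<noteq> 0"
  shows "eval_int_poly (rev_poly r p) x = x ^ r * eval_int_poly p (1 / x)"
proof -
  have "map_poly of_int (rev_poly r p) = rev_poly r (map_poly of_int p :: real poly)"
    by (rule poly_eqI) (simp add: coeff_map_poly coeff_rev_poly)
  moreover have "degree (map_poly of_int p :: real poly) \<le> r"
    using assms(1) by (auto intro!: degree_le simp: coeff_map_poly coeff_eq_0)
  ultimately show ?thesis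
    using poly_rev_poly[of "map_poly of_int p :: real poly" r x] assms(2) by (simp add: eval_int_poly_def)
qed

text \<open>With \<open>x = s^2 * w\<close> the recurrence of \<open>fan_Y\<close> is homogeneous in
  \<open>s\<close>, with weight equal to the index, and what remains is the recurrence of
  \<open>gegenbauer_w\<close>. The point -1, where \<open>s = 0\<close>, is left to
  palindromicity.\<close>

lemma eval_fan_Y:
  fixes x :: real
  assumes "x \<noteq> -1"
  defines "s \<equiv> 1 + x" and "w \<equiv> x / (1 + x)\<^sup>2"
  shows "eval_int_poly (fan_Y $ (j + 2)) x = s ^ (j + 2) * (w * poly (gegenbauer_w j) w)"
proof (induction j rule: gegenbauer_w.induct)
  have s: "s \<noteq> 0" using assms(1) by (simp add: s_def)
  then have x: "x = s\<^sup>2 * w" by (simp add: w_def s_def)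
  {
    case 1
    show ?case using x by (simp add: fan_Y_2[unfolded numeral_2_eq_2] power2_eq_square)
  next
    case 2
    have "3 * eval_int_poly (fan_Y $ 3) x = 6 * (s * x)"
    proof -
      have "of_nat 3 * fan_Y $ 3 = of_nat 6 * (s_poly * x_poly)"
        using fan_Y_rec[of 0] by (simp add: fan_Y_2[unfolded numeral_2_eq_2])
      then have "eval_int_poly (of_nat 3 * fan_Y $ 3) x = eval_int_poly (of_nat 6 * (s_poly * x_poly)) x"
        by (rule arg_cong)
      then show ?thesis
        unfolding eval_int_poly_of_nat unfolding eval_int_poly_mult by (simp add: s_def)
    qed
    then show ?case using x by (simp add: numeral_3_eq_3 power2_eq_square mult_ac)
  next
    case (3 j)
    define Q where "Q = s_poly\<^sup>2 - x_poly"
    have q: "eval_int_poly Q x = s\<^sup>2 * (1 - w)"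
    proof -
      have "eval_int_poly Q x = s\<^sup>2 - x"
        by (simp add: Q_def power2_eq_square s_def algebra_simps)
      also have "\<dots> = s\<^sup>2 * (1 - w)" using x by (simp add: right_diff_distrib)
      finally show ?thesis .
    qed
    have s_eval: "eval_int_poly s_poly x = s" by (simp add: s_def)
    have "real (j + 4) * eval_int_poly (fan_Y $ (j + 4)) x =
        real (4 * (j + 1) + 6) * (s * eval_int_poly (fan_Y $ (j + 3)) x) -
        real (4 * (j + 1)) * ((s\<^sup>2 * (1 - w)) * eval_int_poly (fan_Y $ (j + 2)) x)"
      using arg_cong[OF fan_Y_rec[of "j + 1", folded Q_def], of "\<lambda>p. eval_int_poly p x"]
      unfolding eval_int_poly_diff eval_int_poly_of_nat eval_int_poly_mult[of s_poly]
        eval_int_poly_mult[of Q] q s_eval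
      by (simp add: eval_nat_numeral)
    also have "\<dots> = s ^ (j + 4) * w * ((4 * real j + 10) * poly (gegenbauer_w (j + 1)) w -
        (4 * real j + 4) * (1 - w) * poly (gegenbauer_w j) w)"
      using 3 by (simp add: eval_nat_numeral algebra_simps del: gegenbauer_w.simps)
    also have "\<dots> = real (j + 4) * (s ^ (j + 4) * (w * poly (gegenbauer_w (j + 2)) w))"
      unfolding gegenbauer_w_rec[symmetric] by (simp add: algebra_simps del: gegenbauer_w.simps)
    finally show ?case
      by (simp add: eval_nat_numeral del: gegenbauer_w.simps)
  }
qed

lemma eval_fan_Z:
  fixes x :: real
  assumes "x \<noteq> -1"
  shows "eval_int_poly (fan_Z n) x = (1 + x) ^ Suc n * poly (fan_g n) (x / (1 + x)\<^sup>2)"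
proof (induction n)
  case 0
  then show ?case by (simp add: fan_Z_0 fan_Y_1[unfolded One_nat_def] fan_g_def)
next
  case (Suc n)
  let ?w = "x / (1 + x)\<^sup>2"
  have "eval_int_poly (fan_Z (Suc n)) x =
      (1 + x) * eval_int_poly (fan_Z n) x + eval_int_poly (fan_Y $ (n + 2)) x"
    unfolding fan_Z_Suc eval_int_poly_add eval_int_poly_mult by simp
  also have "\<dots> = (1 + x) ^ Suc (Suc n) * (poly (fan_g n) ?w + ?w * poly (gegenbauer_w n) ?w)"
    unfolding Suc eval_fan_Y[OF assms] by (simp add: algebra_simps)
  also have "poly (fan_g n) ?w + ?w * poly (gegenbauer_w n) ?w = poly (fan_g (Suc n)) ?w"
    by (simp add: fan_g_def poly_sum algebra_simps)
  finally show ?case .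
qed

lemma eval_fan_Z_reciprocal:
  "x \<noteq> 0 \<Longrightarrow> x ^ Suc n * eval_int_poly (fan_Z n) (1 / x) = eval_int_poly (fan_Z n) x"
  using eval_rev_poly[of "fan_Z n" "Suc n" x] degree_palindromic_fan_Z[of n] by simp

text \<open>\<open>w * (1 + x)^2 - x\<close> is 1 at -1 and \<open>w\<close> at 0. The other
  preimage \<open>1 / x\<close> comes later from palindromicity.\<close>

lemma ex_preimage_of_negative:
  fixes w :: real
  assumes "w < 0"
  shows "\<exists>x. -1 < x \<and> x < 0 \<and> x / (1 + x)\<^sup>2 = w"
proof -
  have "\<exists>x > -1. x < 0 \<and> poly [:w, 2 * w - 1, w:] x = 0"
    using assms by (intro poly_IVT) (auto simp: mult_less_0_iff)
  then obtain x where x: "-1 < x" "x < 0" "poly [:w, 2 * w - 1, w:] x = 0" by blast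
  have "w * (1 + x)\<^sup>2 = x" using x(3) by (simp add: power2_eq_square algebra_simps)
  with x show ?thesis by (intro exI[of _ x]) (auto simp: field_simps)
qed

lemma card_negative_roots_fan_Z:
  assumes "2 \<le> n"
  shows "card {x::real. x < 0 \<and> eval_int_poly (fan_Z n) x = 0} = n + 1"
proof (rule antisym)
  let ?R = "{x::real. x < 0 \<and> eval_int_poly (fan_Z n) x = 0}"
  let ?d = "Suc n div 2"
  let ?p = "map_poly of_int (fan_Z n) :: real poly"
  have "eval_int_poly (fan_Z n) 0 = 1" using eval_fan_Z[of 0 n] by (simp add: poly_fan_g_0)
  then have "?p \<noteq> 0" by (auto simp: eval_int_poly_def)
  have fin: "finite {x. poly ?p x = 0}" by (rule poly_roots_finite[OF \<open>?p \<noteq> 0\<close>])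
  then have finR: "finite ?R" by (rule finite_subset[rotated]) (auto simp: eval_int_poly_def)
  have "degree ?p \<le> n + 1"
    using degree_palindromic_fan_Z[of n] by (auto intro!: degree_le simp: coeff_map_poly coeff_eq_0)
  have "card ?R \<le> card {x. poly ?p x = 0}"
    using fin by (intro card_mono) (auto simp: eval_int_poly_def)
  also have "\<dots> \<le> degree ?p" by (rule card_poly_roots_bound[OF \<open>?p \<noteq> 0\<close>])
  finally show "card ?R \<le> n + 1" using \<open>degree ?p \<le> n + 1\<close> by simp
  obtain b :: "nat \<Rightarrow> real" where b: "\<And>i. i < ?d \<Longrightarrow> poly (fan_g n) (b i) = 0 \<and> b i < 0"
    and decr: "\<And>i j. i < j \<Longrightarrow> j < ?d \<Longrightarrow> b j < b i"
    using fan_g_roots[OF assms] by blast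
  have "\<exists>x. -1 < x \<and> x < 0 \<and> x / (1 + x)\<^sup>2 = b i" if "i < ?d" for i
    using ex_preimage_of_negative b[OF that] by blast
  then obtain \<xi> where \<xi>: "\<And>i. i < ?d \<Longrightarrow> -1 < \<xi> i \<and> \<xi> i < 0 \<and> \<xi> i / (1 + \<xi> i)\<^sup>2 = b i"
    by metis
  have inj: "inj_on \<xi> {..<?d}"
  proof (rule linorder_inj_onI')
    fix i j assume "i \<in> {..<?d}" "j \<in> {..<?d}" "i < j"
    then show "\<xi> i \<noteq> \<xi> j" using \<xi>[of i] \<xi>[of j] decr[of i j] by force
  qed
  have root: "eval_int_poly (fan_Z n) (\<xi> i) = 0" if "i < ?d" for i
    using eval_fan_Z[of "\<xi> i" n] \<xi>[OF that] b[OF that] by simp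
  have root': "eval_int_poly (fan_Z n) (1 / \<xi> i) = 0" if "i < ?d" for i
    using eval_fan_Z_reciprocal[of "\<xi> i" n] root[OF that] \<xi>[OF that] by simp
  define A where "A = \<xi> ` {..<?d}"
  define B where "B = (\<lambda>x. 1 / x) ` A"
  define C where "C = (if even n then {-1 :: real} else {})"
  have A: "x \<in> ?R \<and> -1 < x \<and> x < 0" if "x \<in> A" for x
    using that \<xi> root by (auto simp: A_def)
  have B: "x \<in> ?R \<and> x < -1" if "x \<in> B" for x
    using that \<xi> root' by (force simp: A_def B_def field_simps)
  \<comment> \<open>For even \<open>n\<close> the exponent \<open>n + 1\<close> is odd, so
    reciprocity at -1 says that the value there equals its own negative.\<close>
  have C: "C \<subseteq> ?R"
    using eval_fan_Z_reciprocal[of "-1" n] by (auto simp: C_def)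
  have "finite A" "finite B" "finite C" by (auto simp: A_def B_def C_def)
  have "inj_on (\<lambda>x::real. 1 / x) A" by (auto simp: inj_on_def)
  have "card A = ?d" "card B = ?d"
    using inj \<open>inj_on (\<lambda>x::real. 1 / x) A\<close> by (simp_all add: A_def B_def card_image)
  moreover have "card C = (if even n then 1 else 0)" by (simp add: C_def)
  moreover have "card (A \<union> B \<union> C) = card A + card B + card C"
  proof -
    have "A \<inter> B = {}" using A B by fastforce
    moreover have "(A \<union> B) \<inter> C = {}" using A B by (force simp: C_def)
    ultimately show ?thesis
      using \<open>finite A\<close> \<open>finite B\<close> \<open>finite C\<close> by (simp add: card_Un_disjoint)
  qed
  moreover have "2 * ?d + (if even n then 1 else 0) = n + 1" by auto
  ultimately have "card (A \<union> B \<union> C) = n + 1" by simp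
  moreover have "A \<union> B \<union> C \<subseteq> ?R" using A B C by blast
  ultimately show "n + 1 \<le> card ?R" using card_mono[OF finR] by metis
qed

theorem theorem1p3:
  fixes n :: nat
  assumes "n \<ge> 2"
  shows "Z_poly (graphic_matroid (T n)) = Z_poly (graphic_matroid (K2n n)) \<and>
    card {x::real. x < 0 \<and> poly (map_poly of_int (Z_poly (graphic_matroid (T n)))) x = 0} = n + 1"
  using card_negative_roots_fan_Z[OF assms]
  by (simp add: Z_poly_T[OF assms] Z_poly_K2n[OF assms] eval_int_poly_def)

end
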